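(* Fix an implicit Runge–Kutta method with stability function $r$ and row vector $q=(q_1,\dots,q_m)$ as in the context, an integer base $B>1$, constants $M>0$, $\sigma\in\mathbb R$, $\varphi\in(0,\frac{\pi}{2})$, an angle $\alpha$ with $0<\alpha<\frac{\pi}{2}-\varphi$, and a final time $T>0$. Then there are constants $c>0$, $h_0>0$ and $\kappa>0$ such that for every $\varepsilon\in(0,\tfrac12]$ there exist an integer $K\ge 1$ with $$K\le \kappa\,\log\tfrac1\varepsilon \qquad\Big(\text{i.e. } K=O\big(\log\tfrac1\varepsilon\big)\Big)$$ and a step length $\tau>0$ (not depending on $\ell$) with the following property. For every $h\in(0,h_0]$ and every integer $\ell\ge1$ there is a parameter $\mu_\ell>0$ such that, for every square matrix $A$ satisfying the sectoriality bound $$\|(\lambda+A)^{-1}\|\le \frac{M}{|\lambda-\sigma|}\qquad\text{for } |\arg(\lambda-\sigma)|\le \pi-\varphi ,$$ and for every integer $n$ with $nh\in I_\ell=[B^{\ell-1}h,B^\ell h)$, $nh\le T$ and $n\ge c\,\log\frac1\varepsilon$, the quadrature error satisfies $$\Big\| r(-hA)^n q(-hA)-\sum_{k=-K}^{K} w_k^{(\ell)}\,(\lambda_k^{(\ell)}+A)^{-1}\, r(h\lambda_k^{(\ell)})^n\, q(h\lambda_k^{(\ell)})\Big\|\le \varepsilon ,$$ where the quadrature points and weights are $$\lambda_k^{(\ell)}=\gamma_\ell(k\tau),\qquad w_k^{(\ell)}=\frac{i\tau}{2\pi}\,\gamma_\ell'(k\tau),\qquad \gamma_\ell(\theta)=\mu_\ell\,(1-\sin(\alpha+i\theta))+\sigma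 .$$ In particular the required number $K$ is independent of $\ell$, and of $n$ and $h\le h_0$ with $nh\le T$; it depends on $\varphi$, $M$ and $\sigma$ but is otherwise independent of $A$. If $\sigma\le 0$, then $K$ can moreover be chosen independent of $T$.
   Context: Runge–Kutta method: an $m$-stage implicit Runge–Kutta method is given by a real coefficient matrix $\mathcal O=(a_{ij})\in\mathbb R^{m\times m}$ and a row vector of weights $b^T=(b_1,\dots,b_m)$. With $\mathbf 1=(1,\dots,1)^T$ set $$r(z)=1+z\,b^T(I-z\mathcal O)^{-1}\mathbf 1,\qquad q(z)=(q_1(z),\dots,q_m(z))=b^T(I-z\mathcal O)^{-1}.$$ Standing assumptions: all eigenvalues of $\mathcal O$ have positive real part; the method is L-stable, i.e. $|r(z)|\le1$ for $\operatorname{Re} z\le 0$ and $r(\infty)=0$; and the method is consistent, i.e. $r'(0)=1$ (equivalently $b^T\mathbf 1=1$). $A$ is a complex square matrix (of arbitrary size), $\|\cdot\|$ is the operator norm corresponding to a vector norm, and $r(-hA)$, $q(-hA)=(q_1(-hA),\dots,q_m(-hA))$ are defined by the rational functional calculus; $q(-hA)$ and $(\lambda+A)^{-1}q(h\lambda)=\big(q_1(h\lambda)(\lambda+A)^{-1},\dots,q_m(h\lambda)(\lambda+A)^{-1}\big)$ are row $m$-tuples of matrices, and the norm of such a tuple is, e.g., the maximum of the operator norms of its entries. Here $i$ denotes the imaginary unit in the formulas for $\gamma_\ell$ and $w_k^{(\ell)}$. *)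

theory Defs
  imports "HOL-Analysis.Analysis"
    "Jordan_Normal_Form.Char_Poly"
    "Jordan_Normal_Form.Gauss_Jordan_Elimination"
begin

text \<open>Matrices and vectors carry explicit dimensions, because the size of \<open>A\<close> is quantified
  after constants that must not depend on it.\<close>

abbreviation minv :: "complex mat \<Rightarrow> complex mat" where
  "minv X \<equiv> the (mat_inverse X)"

definition mat_sum :: "nat \<Rightarrow> ('a \<Rightarrow> complex mat) \<Rightarrow> 'a set \<Rightarrow> complex mat" where
  "mat_sum N f S = finsum (module_mat TYPE(complex) N N) f S"

definition poly_mat :: "complex poly \<Rightarrow> complex mat \<Rightarrow> complex mat" where
  "poly_mat p X = mat_sum (dim_row X) (\<lambda>i. coeff p i \<cdot>\<^sub>m (X ^\<^sub>m i)) {..degree p}"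

text \<open>Rational functional calculus: if \<open>f = p / d\<close> with polynomials \<open>p\<close>, \<open>d\<close> and \<open>d(X)\<close> is
  invertible, then \<open>f(X) = p(X) d(X)\<^sup>-\<^sup>1\<close>, and this does not depend on the choice of \<open>p\<close> and \<open>d\<close>.
  Finitely many exceptional points are allowed since \<open>f\<close> has arbitrary values at its poles.\<close>

definition rat_fun_mat :: "(complex \<Rightarrow> complex) \<Rightarrow> complex mat \<Rightarrow> complex mat" where
  "rat_fun_mat f X = (THE Y. \<exists>p d. finite {z. f z \<noteq> poly p z / poly d z} \<and>
     invertible_mat (poly_mat d X) \<and> Y = poly_mat p X * minv (poly_mat d X))"

definition is_vec_norm :: "nat \<Rightarrow> (complex vec \<Rightarrow> real) \<Rightarrow> bool" where
  "is_vec_norm N \<nu> \<longleftrightarrow>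
     (\<forall>v\<in>carrier_vec N. 0 \<le> \<nu> v \<and> (\<nu> v = 0 \<longleftrightarrow> v = 0\<^sub>v N)) \<and>
     (\<forall>v\<in>carrier_vec N. \<forall>c. \<nu> (c \<cdot>\<^sub>v v) = cmod c * \<nu> v) \<and>
     (\<forall>v\<in>carrier_vec N. \<forall>w\<in>carrier_vec N. \<nu> (v + w) \<le> \<nu> v + \<nu> w)"

definition op_norm :: "nat \<Rightarrow> (complex vec \<Rightarrow> real) \<Rightarrow> complex mat \<Rightarrow> real" where
  "op_norm N \<nu> X = (SUP v\<in>carrier_vec N - {0\<^sub>v N}. \<nu> (X *\<^sub>v v) / \<nu> v)"

definition tuple_norm ::
  "nat \<Rightarrow> nat \<Rightarrow> (complex vec \<Rightarrow> real) \<Rightarrow> (nat \<Rightarrow> complex mat) \<Rightarrow> real" where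
  "tuple_norm m N \<nu> Y = Max ((\<lambda>j. op_norm N \<nu> (Y j)) ` {..<m})"

definition rk_r :: "real mat \<Rightarrow> real vec \<Rightarrow> complex \<Rightarrow> complex" where
  "rk_r \<O> b z = (let m = dim_row \<O> in
     1 + z * scalar_prod (map_vec complex_of_real b)
       (minv (1\<^sub>m m - z \<cdot>\<^sub>m map_mat complex_of_real \<O>) *\<^sub>v Matrix.vec m (\<lambda>_. 1)))"

definition rk_q :: "real mat \<Rightarrow> real vec \<Rightarrow> nat \<Rightarrow> complex \<Rightarrow> complex" where
  "rk_q \<O> b j z = (let m = dim_row \<O> in
     (mat_of_row (map_vec complex_of_real b) *
       minv (1\<^sub>m m - z \<cdot>\<^sub>m map_mat complex_of_real \<O>)) $$ (0, j))"

definition L_stable :: "(complex \<Rightarrow> complex) \<Rightarrow> bool" where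
  "L_stable r \<longleftrightarrow> (\<forall>z. Re z \<le> 0 \<longrightarrow> cmod (r z) \<le> 1) \<and> (r \<longlongrightarrow> 0) at_infinity"

definition resolvent :: "complex mat \<Rightarrow> complex \<Rightarrow> complex mat" where
  "resolvent A z = minv (z \<cdot>\<^sub>m 1\<^sub>m (dim_row A) + A)"

text \<open>The vertex \<open>\<sigma>\<close> is excluded explicitly, since in the library \<open>Arg 0 = 0\<close> and \<open>M / 0 = 0\<close>.\<close>

definition sectorial ::
  "nat \<Rightarrow> (complex vec \<Rightarrow> real) \<Rightarrow> real \<Rightarrow> real \<Rightarrow> real \<Rightarrow> complex mat \<Rightarrow> bool" where
  "sectorial N \<nu> M \<sigma> \<phi> A \<longleftrightarrow>
     (\<forall>z. z \<noteq> complex_of_real \<sigma> \<and> \<bar>Arg (z - complex_of_real \<sigma>)\<bar> \<le> pi - \<phi> \<longrightarrow>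
        invertible_mat (z \<cdot>\<^sub>m 1\<^sub>m N + A) \<and>
        op_norm N \<nu> (resolvent A z) \<le> M / cmod (z - complex_of_real \<sigma>))"

definition hyperbola :: "real \<Rightarrow> real \<Rightarrow> real \<Rightarrow> real \<Rightarrow> complex" where
  "hyperbola \<alpha> \<sigma> \<mu> \<theta> =
     complex_of_real \<mu> * (1 - sin (complex_of_real \<alpha> + \<i> * complex_of_real \<theta>)) + complex_of_real \<sigma>"

definition quad_point :: "real \<Rightarrow> real \<Rightarrow> real \<Rightarrow> real \<Rightarrow> int \<Rightarrow> complex" where
  "quad_point \<alpha> \<sigma> \<mu> \<tau> k = hyperbola \<alpha> \<sigma> \<mu> (of_int k * \<tau>)"

definition quad_weight :: "real \<Rightarrow> real \<Rightarrow> real \<Rightarrow> real \<Rightarrow> int \<Rightarrow> complex" where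
  "quad_weight \<alpha> \<sigma> \<mu> \<tau> k =
     \<i> * complex_of_real \<tau> / (2 * complex_of_real pi) *
       vector_derivative (hyperbola \<alpha> \<sigma> \<mu>) (at (of_int k * \<tau>))"

text \<open>Entry \<open>j\<close> of the row tuple \<open>r(-hA)\<^sup>n q(-hA) - \<Sum>\<^sub>k w\<^sub>k (\<lambda>\<^sub>k + A)\<^sup>-\<^sup>1 r(h\<lambda>\<^sub>k)\<^sup>n q(h\<lambda>\<^sub>k)\<close>.\<close>

definition quad_error :: "real mat \<Rightarrow> real vec \<Rightarrow> real \<Rightarrow> real \<Rightarrow> real \<Rightarrow> real \<Rightarrow> nat \<Rightarrow>
    real \<Rightarrow> nat \<Rightarrow> complex mat \<Rightarrow> nat \<Rightarrow> complex mat" where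
  "quad_error \<O> b \<alpha> \<sigma> \<mu> \<tau> K h n A j =
     (rat_fun_mat (rk_r \<O> b) (complex_of_real (- h) \<cdot>\<^sub>m A)) ^\<^sub>m n *
       rat_fun_mat (rk_q \<O> b j) (complex_of_real (- h) \<cdot>\<^sub>m A)
     - mat_sum (dim_row A)
         (\<lambda>k. let p = quad_point \<alpha> \<sigma> \<mu> \<tau> k in
            (quad_weight \<alpha> \<sigma> \<mu> \<tau> k * rk_r \<O> b (complex_of_real h * p) ^ n *
              rk_q \<O> b j (complex_of_real h * p)) \<cdot>\<^sub>m resolvent A p)
         {- int K..int K}"

text \<open>The accuracy property of the pair \<open>K\<close>, \<open>\<tau>\<close>. The matrix \<open>A\<close>, its size \<open>N\<close> and the vector norm
  \<open>\<nu>\<close> are quantified innermost, so no parameter depends on them.\<close>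

definition quad_accurate :: "real mat \<Rightarrow> real vec \<Rightarrow> nat \<Rightarrow> real \<Rightarrow> real \<Rightarrow> real \<Rightarrow> real \<Rightarrow> real \<Rightarrow>
    real \<Rightarrow> real \<Rightarrow> real \<Rightarrow> nat \<Rightarrow> real \<Rightarrow> bool" where
  "quad_accurate \<O> b B M \<sigma> \<phi> \<alpha> T c h\<^sub>0 \<epsilon> K \<tau> \<longleftrightarrow>
     (\<forall>h l. 0 < h \<and> h \<le> h\<^sub>0 \<and> 1 \<le> l \<longrightarrow>
       (\<exists>\<mu>>0. \<forall>N \<nu> A n.
          0 < N \<and> is_vec_norm N \<nu> \<and> A \<in> carrier_mat N N \<and> sectorial N \<nu> M \<sigma> \<phi> A \<and>
          real n * h \<in> {real B ^ (l - 1) * h ..< real B ^ l * h} \<and>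
          real n * h \<le> T \<and> c * ln (1 / \<epsilon>) \<le> real n \<longrightarrow>
          tuple_norm (dim_row \<O>) N \<nu> (quad_error \<O> b \<alpha> \<sigma> \<mu> \<tau> K h n A) \<le> \<epsilon>))"

end

theory Submission
  imports Defs "HOL-Complex_Analysis.Complex_Analysis"
begin

text \<open>A functional \<open>\<psi>\<close> that norms a given vector (Hahn-Banach) turns the matrix estimate into a scalar one for
  \<open>s v z = \<psi> ((z + A)\<^sup>-\<^sup>1 v)\<close>, which satisfies \<open>cmod (s v z) \<le> M \<nu>(v) / cmod (z - \<sigma>)\<close>. Writing
  \<open>f z = r(h z)\<^sup>n q\<^sub>j(h z)\<close>, the function \<open>f \<cdot> s v - s (f(-A) v)\<close> extends holomorphically to the half-plane left of the
  poles of \<open>f\<close>, so the integral of \<open>f \<cdot> s v\<close> along the hyperbola is \<open>\<psi> (f(-A) v)\<close>. The residue theorem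
  on a rectangle compares this integral with the trapezoidal sum.

  For \<open>L = ln (1 / \<epsilon>)\<close> take \<open>h \<mu> = L / B\<^sup>l\<close> and \<open>\<tau>\<close> proportional to \<open>1 / L\<close>, so that \<open>K \<tau>\<close> stays
  bounded. Consistency, the maximum principle and \<open>r(\<infinity>) = 0\<close> give \<open>cmod (r w) \<le> 1 / (1 + c cmod w)\<close> in
  sectors about the negative real axis. Hence \<open>r\<^sup>n\<close> is at most \<open>exp (O(L))\<close> on the hyperbolas of the
  strip, which the discretization factor \<open>exp (- 2 \<pi> d / \<tau>)\<close> absorbs, and it is below any given
  power of \<open>\<epsilon>\<close> at the truncation points and beyond.\<close>

section \<open>Vector norms and norming functionals\<close>

text \<open>The bound must not see the size of \<open>A\<close> or the norm, so every constant in it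
  comes from the method, \<open>B\<close>, \<open>M\<close>, \<open>\<sigma>\<close>,
  \<open>\<phi>\<close>, \<open>\<alpha>\<close> and a bound on \<open>T * max \<sigma> 0\<close>.
  With \<open>h \<mu> = L / B\<^sup>l\<close> the product \<open>n h \<mu>\<close> lies between
  \<open>L / B\<close> and \<open>L\<close> on the whole \<open>l\<close>-th time interval. Its
  upper end limits the growth of \<open>r\<^sup>n\<close> right of the imaginary axis, its lower end
  drives the decay on the far branches. Both exponents are then linear in \<open>L\<close>, so at a
  fixed abscissa the decay beats any prescribed multiple of \<open>L\<close>; this is what keeps
  \<open>K \<tau>\<close> bounded. The price is that \<open>h \<mu>\<close> must stay below the
  distance to the poles, and this is where the condition \<open>n \<ge> c L\<close> comes from. The
  extension of \<open>f \<cdot> s v - s (f(-A) v)\<close> does not integrate to zero along the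
  hyperbola: it decays only like \<open>1 / z\<close>, as does \<open>s (f(-A) v)\<close>, with
  opposite leading coefficients. Closing the two parts by complementary arcs of one circle recovers
  \<open>\<psi> (f(-A) v)\<close>. The constants avoid circularity by being fixed in the order decay
  exponent \<open>p\<close>, truncation abscissa, discretization exponent \<open>q\<close>, step
  \<open>\<tau>\<close>.\<close>

lemma is_vec_normD:
  assumes "is_vec_norm N \<nu>"
  shows vec_norm_nonneg: "v \<in> carrier_vec N \<Longrightarrow> 0 \<le> \<nu> v"
    and vec_norm_eq_0: "v \<in> carrier_vec N \<Longrightarrow> \<nu> v = 0 \<longleftrightarrow> v = 0\<^sub>v N"
    and vec_norm_smult: "v \<in> carrier_vec N \<Longrightarrow> \<nu> (c \<cdot>\<^sub>v v) = cmod c * \<nu> v"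
    and vec_norm_triangle: "v \<in> carrier_vec N \<Longrightarrow> w \<in> carrier_vec N \<Longrightarrow> \<nu> (v + w) \<le> \<nu> v + \<nu> w"
  using assms unfolding is_vec_norm_def by blast+

text \<open>Real sublinearity on a complex space: the scalars are nonnegative reals, so the real
  Hahn-Banach argument applies. Complex linearity is restored at the very end.\<close>

definition sublin :: "nat \<Rightarrow> (complex vec \<Rightarrow> real) \<Rightarrow> bool" where
  "sublin N p \<longleftrightarrow>
     (\<forall>v\<in>carrier_vec N. \<forall>t\<ge>0. p (complex_of_real t \<cdot>\<^sub>v v) = t * p v) \<and>
     (\<forall>v\<in>carrier_vec N. \<forall>w\<in>carrier_vec N. p (v + w) \<le> p v + p w)"

text \<open>The Hahn-Banach minorant for one direction: lowering \<open>p\<close> to its least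
  excess along the ray through \<open>d\<close> yields a sublinear functional that is linear on the
  real line spanned by \<open>d\<close>.\<close>

definition sublin_min :: "(complex vec \<Rightarrow> real) \<Rightarrow> complex vec \<Rightarrow> complex vec \<Rightarrow> real" where
  "sublin_min p d v = (INF t\<in>{0..}. p (v + complex_of_real t \<cdot>\<^sub>v d) - t * p d)"

lemma sublin_scale:
  assumes "sublin N p" "v \<in> carrier_vec N" "0 \<le> t"
  shows "p (complex_of_real t \<cdot>\<^sub>v v) = t * p v"
  using assms unfolding sublin_def by blast

lemma sublin_add:
  assumes "sublin N p" "v \<in> carrier_vec N" "w \<in> carrier_vec N"
  shows "p (v + w) \<le> p v + p w"
  using assms unfolding sublin_def by blast

lemma sublin_0:
  assumes "sublin N p"
  shows "p (0\<^sub>v N) = 0"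
proof -
  have "p (complex_of_real 0 \<cdot>\<^sub>v 0\<^sub>v N) = 0 * p (0\<^sub>v N)"
    by (rule sublin_scale[OF assms]) auto
  moreover have "complex_of_real 0 \<cdot>\<^sub>v 0\<^sub>v N = 0\<^sub>v N" by auto
  ultimately show ?thesis by simp
qed

lemma sublin_neg:
  assumes "sublin N p" "v \<in> carrier_vec N"
  shows "- p (- v) \<le> p v"
proof -
  have "p (v + (- v)) \<le> p v + p (- v)"
    by (rule sublin_add[OF assms(1)]) (use assms in auto)
  moreover have "v + (- v) = 0\<^sub>v N" using assms by auto
  ultimately show ?thesis using sublin_0[OF assms(1)] by simp
qed

text \<open>Makes the infimum in \<open>sublin_min\<close> a true greatest lower bound, since
  \<open>- p (- v)\<close> does not depend on \<open>t\<close>.\<close>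

lemma sublin_min_bdd:
  assumes p: "sublin N p" and d: "d \<in> carrier_vec N" and v: "v \<in> carrier_vec N" and t: "0 \<le> t"
  shows "- p (- v) \<le> p (v + complex_of_real t \<cdot>\<^sub>v d) - t * p d"
proof -
  let ?x = "v + complex_of_real t \<cdot>\<^sub>v d"
  have "p (?x + (- v)) \<le> p ?x + p (- v)"
    by (rule sublin_add[OF p]) (use v d in auto)
  moreover have "?x + (- v) = complex_of_real t \<cdot>\<^sub>v d" using v d by auto
  ultimately show ?thesis using sublin_scale[OF p d t] by simp
qed

lemma sublin_min_le:
  assumes p: "sublin N p" and d: "d \<in> carrier_vec N" and v: "v \<in> carrier_vec N" and t: "0 \<le> t"
  shows "sublin_min p d v \<le> p (v + complex_of_real t \<cdot>\<^sub>v d) - t * p d"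
  unfolding sublin_min_def
proof (rule cINF_lower)
  show "bdd_below ((\<lambda>t. p (v + complex_of_real t \<cdot>\<^sub>v d) - t * p d) ` {0..})"
    by (rule bdd_belowI2[where m = "- p (- v)"]) (use sublin_min_bdd[OF p d v] in auto)
qed (use t in auto)

lemma sublin_min_greatest:
  assumes "\<And>t. 0 \<le> t \<Longrightarrow> a \<le> p (v + complex_of_real t \<cdot>\<^sub>v d) - t * p d"
  shows "a \<le> sublin_min p d v"
  unfolding sublin_min_def by (rule cINF_greatest) (use assms in auto)

lemma sublin_min_dominated:
  assumes p: "sublin N p" and d: "d \<in> carrier_vec N" and v: "v \<in> carrier_vec N"
  shows "sublin_min p d v \<le> p v"
proof -
  have "v + complex_of_real 0 \<cdot>\<^sub>v d = v" using v d by auto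
  thus ?thesis using sublin_min_le[OF p d v, of 0] by simp
qed

text \<open>The choice \<open>t = 1\<close> reaches the zero vector. Together with domination by
  \<open>p\<close> and subadditivity this forces equality, so \<open>d\<close> becomes a direction
  of linearity.\<close>

lemma sublin_min_direction:
  assumes p: "sublin N p" and d: "d \<in> carrier_vec N"
  shows "sublin_min p d (- d) \<le> - p d"
proof -
  have "- d + complex_of_real 1 \<cdot>\<^sub>v d = 0\<^sub>v N" using d by auto
  thus ?thesis using sublin_min_le[OF p d, of "- d" 1] d sublin_0[OF p] by simp
qed

text \<open>Ray parameters \<open>t\<close> for \<open>v\<close> and \<open>s\<close> for
  \<open>w\<close> combine to \<open>t + s\<close> for \<open>v + w\<close>. For homogeneity the ray
  is reparametrized by \<open>c * t\<close>; the reverse inequality is the same one applied with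
  \<open>1 / c\<close>.\<close>

lemma sublin_sublin_min:
  assumes p: "sublin N p" and d: "d \<in> carrier_vec N"
  shows "sublin N (sublin_min p d)"
proof -
  have add: "sublin_min p d (v + w) \<le> sublin_min p d v + sublin_min p d w"
    if v: "v \<in> carrier_vec N" and w: "w \<in> carrier_vec N" for v w
  proof -
    have vw: "v + w \<in> carrier_vec N" using v w by simp
    have A: "sublin_min p d (v + w) - (p (w + complex_of_real s \<cdot>\<^sub>v d) - s * p d)
      \<le> p (v + complex_of_real t \<cdot>\<^sub>v d) - t * p d" if "0 \<le> t" "0 \<le> s" for t s
    proof -
      have "sublin_min p d (v + w) \<le> p ((v + w) + complex_of_real (t + s) \<cdot>\<^sub>v d) - (t + s) * p d"
        by (rule sublin_min_le[OF p d vw]) (use that in auto)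
      also have "(v + w) + complex_of_real (t + s) \<cdot>\<^sub>v d
          = (v + complex_of_real t \<cdot>\<^sub>v d) + (w + complex_of_real s \<cdot>\<^sub>v d)"
        using v w d by (auto simp: algebra_simps)
      also have "p \<dots> \<le> p (v + complex_of_real t \<cdot>\<^sub>v d) + p (w + complex_of_real s \<cdot>\<^sub>v d)"
        by (rule sublin_add[OF p]) (use v w d in auto)
      finally show ?thesis by (simp add: algebra_simps)
    qed
    have "sublin_min p d (v + w) - (p (w + complex_of_real s \<cdot>\<^sub>v d) - s * p d) \<le> sublin_min p d v"
      if "0 \<le> s" for s
      by (rule sublin_min_greatest) (use A that in auto)
    hence "sublin_min p d (v + w) - sublin_min p d v \<le> p (w + complex_of_real s \<cdot>\<^sub>v d) - s * p d"
      if "0 \<le> s" for s using that by (force simp: algebra_simps)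
    hence "sublin_min p d (v + w) - sublin_min p d v \<le> sublin_min p d w"
      by (rule sublin_min_greatest)
    thus ?thesis by simp
  qed
  have le: "sublin_min p d (complex_of_real c \<cdot>\<^sub>v v) \<le> c * sublin_min p d v"
    if v: "v \<in> carrier_vec N" and c: "0 < c" for v c
  proof -
    have "sublin_min p d (complex_of_real c \<cdot>\<^sub>v v) / c \<le> sublin_min p d v"
    proof (rule sublin_min_greatest)
      fix t :: real assume t: "0 \<le> t"
      let ?x = "v + complex_of_real t \<cdot>\<^sub>v d"
      have "sublin_min p d (complex_of_real c \<cdot>\<^sub>v v)
          \<le> p (complex_of_real c \<cdot>\<^sub>v v + complex_of_real (c * t) \<cdot>\<^sub>v d) - (c * t) * p d"
        by (rule sublin_min_le[OF p d]) (use v t c in auto)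
      also have "complex_of_real c \<cdot>\<^sub>v v + complex_of_real (c * t) \<cdot>\<^sub>v d = complex_of_real c \<cdot>\<^sub>v ?x"
        using v d by (auto simp: algebra_simps)
      also have "p \<dots> = c * p ?x" by (rule sublin_scale[OF p]) (use v d c in auto)
      finally show "sublin_min p d (complex_of_real c \<cdot>\<^sub>v v) / c \<le> p ?x - t * p d"
        using c by (simp add: field_simps)
    qed
    thus ?thesis using c by (simp add: field_simps)
  qed
  have scale: "sublin_min p d (complex_of_real c \<cdot>\<^sub>v v) = c * sublin_min p d v"
    if v: "v \<in> carrier_vec N" and c: "0 \<le> c" for v c
  proof (cases "c = 0")
    case True
    have z: "sublin_min p d (0\<^sub>v N) = 0"
    proof (rule antisym)
      show "sublin_min p d (0\<^sub>v N) \<le> 0"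
        using sublin_min_dominated[OF p d, of "0\<^sub>v N"] sublin_0[OF p] by simp
      have "- (0\<^sub>v N) = (0\<^sub>v N :: complex vec)" by auto
      thus "0 \<le> sublin_min p d (0\<^sub>v N)"
        using sublin_min_bdd[OF p d, of "0\<^sub>v N"] sublin_0[OF p] by (intro sublin_min_greatest) auto
    qed
    have "complex_of_real 0 \<cdot>\<^sub>v v = 0\<^sub>v N" using v by auto
    thus ?thesis using z True by simp
  next
    case False
    hence c: "0 < c" using c by simp
    have "complex_of_real (1 / c) \<cdot>\<^sub>v (complex_of_real c \<cdot>\<^sub>v v) = v"
      using c v by (auto simp: smult_smult_assoc)
    moreover have "sublin_min p d (complex_of_real (1 / c) \<cdot>\<^sub>v (complex_of_real c \<cdot>\<^sub>v v))
        \<le> (1 / c) * sublin_min p d (complex_of_real c \<cdot>\<^sub>v v)"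
      by (rule le) (use v c in auto)
    ultimately have "c * sublin_min p d v \<le> sublin_min p d (complex_of_real c \<cdot>\<^sub>v v)"
      using c by (simp add: field_simps)
    thus ?thesis using le[OF v c] by simp
  qed
  show ?thesis unfolding sublin_def using add scale by blast
qed

text \<open>A sublinear functional which is additive along \<open>d\<close> and \<open>-d\<close> stays so after passing to a
  smaller sublinear functional, so processing \<open>u\<close> and a basis one after the other ends in a
  linear functional.\<close>

lemma sublin_linear_directions:
  assumes p: "sublin N p" and ds: "set ds \<subseteq> carrier_vec N"
  shows "\<exists>q. sublin N q \<and> (\<forall>v\<in>carrier_vec N. q v \<le> p v) \<and> (\<forall>d\<in>set ds. q (- d) = - q d)"
  using ds
proof (induction ds)
  case Nil
  show ?case using p by auto
next
  case (Cons d ds)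
  then obtain q where q: "sublin N q" "\<forall>v\<in>carrier_vec N. q v \<le> p v" "\<forall>d\<in>set ds. q (- d) = - q d"
    by auto
  have d: "d \<in> carrier_vec N" using Cons.prems by simp
  let ?q = "sublin_min q d"
  have dom: "?q v \<le> q v" if "v \<in> carrier_vec N" for v by (rule sublin_min_dominated[OF q(1) d that])
  have sl: "sublin N ?q" by (rule sublin_sublin_min[OF q(1) d])
  have "?q (- d) = - ?q d"
    using sublin_min_direction[OF q(1) d] dom[OF d] sublin_neg[OF sl d] by simp
  moreover have "?q (- e) = - ?q e" if e: "e \<in> set ds" for e
  proof -
    have ec: "e \<in> carrier_vec N" using e Cons.prems by auto
    have "- e \<in> carrier_vec N" using ec by simp
    from dom[OF this] dom[OF ec] sublin_neg[OF sl ec] q(3) e show ?thesis by force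
  qed
  ultimately show ?case using sl q(2) dom by (intro exI[of _ ?q]) force
qed

lemma sublin_real_mult:
  assumes q: "sublin N q" and d: "d \<in> carrier_vec N" and neg: "q (- d) = - q d"
  shows "q (complex_of_real t \<cdot>\<^sub>v d) = t * q d"
proof (cases "0 \<le> t")
  case True
  thus ?thesis by (rule sublin_scale[OF q d])
next
  case False
  have "complex_of_real t \<cdot>\<^sub>v d = complex_of_real (- t) \<cdot>\<^sub>v (- d)" using d by auto
  moreover have "q (complex_of_real (- t) \<cdot>\<^sub>v (- d)) = (- t) * q (- d)"
    by (rule sublin_scale[OF q]) (use d False in auto)
  ultimately show ?thesis using neg by simp
qed

lemma sublin_add_eq:
  assumes q: "sublin N q" and v: "v \<in> carrier_vec N" and w: "w \<in> carrier_vec N"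
    and nv: "q (- v) = - q v" and nw: "q (- w) = - q w"
  shows "q (v + w) = q v + q w" "q (- (v + w)) = - q (v + w)"
proof -
  have vw: "v + w \<in> carrier_vec N" using v w by simp
  have "- (v + w) = - v + - w" using v w by auto
  moreover have "q (- v + - w) \<le> q (- v) + q (- w)"
    by (rule sublin_add[OF q]) (use v w in auto)
  ultimately have "q (- (v + w)) \<le> - q v - q w" using nv nw by simp
  with sublin_add[OF q v w] sublin_neg[OF q vw]
  show "q (v + w) = q v + q w" "q (- (v + w)) = - q (v + w)" by simp_all
qed

text \<open>Hahn-Banach without Zorn's lemma, as finitely many real directions suffice. The first
  minorant is taken along \<open>u\<close> itself, which pins the value at \<open>u\<close> to
  \<open>\<nu> u\<close>; the later ones enforce linearity.\<close>

lemma norming_functional: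
  assumes \<nu>: "is_vec_norm N \<nu>" and u: "u \<in> carrier_vec N"
  obtains \<psi> where "\<And>v w. v \<in> carrier_vec N \<Longrightarrow> w \<in> carrier_vec N \<Longrightarrow> \<psi> (v + w) = \<psi> v + \<psi> w"
    "\<And>v c. v \<in> carrier_vec N \<Longrightarrow> \<psi> (c \<cdot>\<^sub>v v) = c * \<psi> v"
    "\<And>v. v \<in> carrier_vec N \<Longrightarrow> cmod (\<psi> v) \<le> \<nu> v" "cmod (\<psi> u) = \<nu> u"
proof -
  \<comment> \<open>A basis of the space over the reals, hence each unit vector together with its
    multiple by the imaginary unit.\<close>
  define bs where "bs = map (unit_vec N) [0..<N] @ map (\<lambda>i. \<i> \<cdot>\<^sub>v unit_vec N i) [0..<N]"
  have bs: "set bs \<subseteq> carrier_vec N" unfolding bs_def by auto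
  have sl: "sublin N \<nu>"
    unfolding sublin_def using vec_norm_smult[OF \<nu>] vec_norm_triangle[OF \<nu>] by simp
  obtain q where q: "sublin N q" "\<forall>v\<in>carrier_vec N. q v \<le> sublin_min \<nu> u v"
      "\<forall>d\<in>set bs. q (- d) = - q d"
    using sublin_linear_directions[OF sublin_sublin_min[OF sl u] bs] by (elim exE conjE)
  have q\<nu>: "q v \<le> \<nu> v" if "v \<in> carrier_vec N" for v
    using q(2) sublin_min_dominated[OF sl u that] that by force
  have qu: "q u = \<nu> u"
    using q\<nu>[OF u] sublin_neg[OF q(1) u] bspec[OF q(2), of "- u"] sublin_min_direction[OF sl u] u
    by simp
  have coord: "q (- (c \<cdot>\<^sub>v unit_vec N i)) = - q (c \<cdot>\<^sub>v unit_vec N i)" if i: "i < N" for c i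
  proof -
    let ?e = "unit_vec N i :: complex vec"
    have n1: "q (- ?e) = - q ?e" and n2: "q (- (\<i> \<cdot>\<^sub>v ?e)) = - q (\<i> \<cdot>\<^sub>v ?e)"
      using q(3) i unfolding bs_def by auto
    have ng: "q (- (complex_of_real t \<cdot>\<^sub>v d)) = - q (complex_of_real t \<cdot>\<^sub>v d)"
      if "d \<in> carrier_vec N" "q (- d) = - q d" for t d
    proof -
      have "- (complex_of_real t \<cdot>\<^sub>v d) = complex_of_real (- t) \<cdot>\<^sub>v d" using that by auto
      thus ?thesis using sublin_real_mult[OF q(1) that, of "- t"] sublin_real_mult[OF q(1) that, of t]
        by simp
    qed
    let ?a = "complex_of_real (Re c) \<cdot>\<^sub>v ?e" and ?b = "complex_of_real (Im c) \<cdot>\<^sub>v (\<i> \<cdot>\<^sub>v ?e)"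
    have "c \<cdot>\<^sub>v ?e = ?a + ?b"
      by (rule eq_vecI) (auto simp: complex_eq_iff unit_vec_def)
    moreover have "q (- (?a + ?b)) = - q (?a + ?b)"
      by (rule sublin_add_eq(2)[OF q(1) _ _ ng[OF _ n1] ng[OF _ n2]]) auto
    ultimately show ?thesis by simp
  qed
  \<comment> \<open>Truncations of \<open>v\<close> grow by one coordinate at a time, so oddness
    spreads from the coordinate directions to every vector.\<close>
  have neg: "q (- v) = - q v" if v: "v \<in> carrier_vec N" for v
  proof -
    have "q (- (Matrix.vec N (\<lambda>i. if i < k then v $ i else 0)))
        = - q (Matrix.vec N (\<lambda>i. if i < k then v $ i else 0))" if "k \<le> N" for k
      using that
    proof (induction k)
      case 0
      have "Matrix.vec N (\<lambda>i. if i < 0 then v $ i else 0) = 0\<^sub>v N"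
        "- (0\<^sub>v N) = (0\<^sub>v N :: complex vec)" by auto
      thus ?case using sublin_0[OF q(1)] by (simp only: neg_equal_0_iff_equal)
    next
      case (Suc k)
      let ?a = "Matrix.vec N (\<lambda>i. if i < k then v $ i else 0)" and ?b = "v $ k \<cdot>\<^sub>v unit_vec N k"
      have "Matrix.vec N (\<lambda>i. if i < Suc k then v $ i else 0) = ?a + ?b"
        by (intro eq_vecI) (auto simp: unit_vec_def less_Suc_eq)
      moreover have "q (- (?a + ?b)) = - q (?a + ?b)"
        by (rule sublin_add_eq(2)[OF q(1) _ _ Suc.IH coord]) (use Suc.prems in auto)
      ultimately show ?case by simp
    qed
    from this[of N] have "q (- (Matrix.vec N (\<lambda>i. if i < N then v $ i else 0)))
        = - q (Matrix.vec N (\<lambda>i. if i < N then v $ i else 0))" by simp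
    moreover have "Matrix.vec N (\<lambda>i. if i < N then v $ i else 0) = v" using v by auto
    ultimately show ?thesis by simp
  qed
  have add: "q (v + w) = q v + q w" if "v \<in> carrier_vec N" "w \<in> carrier_vec N" for v w
    by (rule sublin_add_eq(1)[OF q(1) that neg[OF that(1)] neg[OF that(2)]])
  have scale: "q (complex_of_real t \<cdot>\<^sub>v v) = t * q v" if "v \<in> carrier_vec N" for t v
    by (rule sublin_real_mult[OF q(1) that neg[OF that]])
  \<comment> \<open>The usual complexification of a real functional, dictated by
    \<open>Im z = - Re (\<i> * z)\<close>.\<close>
  define \<psi> where "\<psi> v = Complex (q v) (- q (\<i> \<cdot>\<^sub>v v))" for v
  have padd: "\<psi> (v + w) = \<psi> v + \<psi> w" if v: "v \<in> carrier_vec N" and w: "w \<in> carrier_vec N" for v w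
  proof -
    have "\<i> \<cdot>\<^sub>v (v + w) = \<i> \<cdot>\<^sub>v v + \<i> \<cdot>\<^sub>v w" using v w by (auto simp: algebra_simps)
    thus ?thesis using add[OF v w] add[of "\<i> \<cdot>\<^sub>v v" "\<i> \<cdot>\<^sub>v w"] v w unfolding \<psi>_def
      by (simp add: complex_eq_iff)
  qed
  have psc: "\<psi> (c \<cdot>\<^sub>v v) = c * \<psi> v" if v: "v \<in> carrier_vec N" for v c
  proof -
    have 1: "c \<cdot>\<^sub>v v = complex_of_real (Re c) \<cdot>\<^sub>v v + complex_of_real (Im c) \<cdot>\<^sub>v (\<i> \<cdot>\<^sub>v v)"
      by (rule eq_vecI) (use v in \<open>auto simp: complex_eq_iff\<close>)
    have 2: "\<i> \<cdot>\<^sub>v (c \<cdot>\<^sub>v v) = complex_of_real (Re c) \<cdot>\<^sub>v (\<i> \<cdot>\<^sub>v v) + complex_of_real (- Im c) \<cdot>\<^sub>v v"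
      by (rule eq_vecI) (use v in \<open>auto simp: complex_eq_iff\<close>)
    have "q (c \<cdot>\<^sub>v v) = Re c * q v + Im c * q (\<i> \<cdot>\<^sub>v v)"
      unfolding 1 using v by (simp add: add scale)
    moreover have "q (\<i> \<cdot>\<^sub>v (c \<cdot>\<^sub>v v)) = Re c * q (\<i> \<cdot>\<^sub>v v) - Im c * q v"
      unfolding 2 using v scale[OF v, of "- Im c"] by (simp add: add scale)
    ultimately show ?thesis unfolding \<psi>_def by (simp add: complex_eq_iff algebra_simps)
  qed
  have pb: "cmod (\<psi> v) \<le> \<nu> v" if v: "v \<in> carrier_vec N" for v
  proof -
    \<comment> \<open>A rotation that makes \<open>\<psi> v\<close> real and nonnegative. For
      \<open>\<psi> v = 0\<close> the quotient is \<open>0\<close>, which is harmless because the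
      argument only uses \<open>cmod ?c \<le> 1\<close>.\<close>
    let ?c = "cnj (\<psi> v) / complex_of_real (cmod (\<psi> v))"
    have "?c * \<psi> v = (\<psi> v * cnj (\<psi> v)) / complex_of_real (cmod (\<psi> v))" by simp
    also have "\<dots> = complex_of_real (cmod (\<psi> v))"
      unfolding complex_norm_square[symmetric] by (simp add: power2_eq_square)
    finally have "cmod (\<psi> v) = Re (?c * \<psi> v)" by simp
    also have "\<dots> = Re (\<psi> (?c \<cdot>\<^sub>v v))" using psc[OF v] by simp
    also have "\<dots> = q (?c \<cdot>\<^sub>v v)" by (simp add: \<psi>_def)
    also have "\<dots> \<le> \<nu> (?c \<cdot>\<^sub>v v)" using q\<nu> v by simp
    also have "\<dots> = cmod ?c * \<nu> v" by (rule vec_norm_smult[OF \<nu> v])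
    also have "\<dots> \<le> \<nu> v"
      using vec_norm_nonneg[OF \<nu> v] by (auto simp: norm_divide)
    finally show ?thesis .
  qed
  have "\<nu> u \<le> cmod (\<psi> u)"
    using qu abs_Re_le_cmod[of "\<psi> u"] by (simp add: \<psi>_def)
  hence "cmod (\<psi> u) = \<nu> u" using pb[OF u] by simp
  from that[OF padd psc pb this] show ?thesis .
qed


section \<open>Equivalence of norms and operator norms in finite dimension\<close>

lemma vec_norm_zero:
  assumes "is_vec_norm N \<nu>" shows "\<nu> (0\<^sub>v N) = 0"
  using vec_norm_eq_0[OF assms, of "0\<^sub>v N"] by simp

lemma vec_norm_pos:
  assumes "is_vec_norm N \<nu>" "v \<in> carrier_vec N" "v \<noteq> 0\<^sub>v N" shows "0 < \<nu> v"
  using vec_norm_eq_0[OF assms(1,2)] vec_norm_nonneg[OF assms(1,2)] assms(3) by simp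

lemma vec_norm_uminus:
  assumes "is_vec_norm N \<nu>" "v \<in> carrier_vec N" shows "\<nu> (- v) = \<nu> v"
proof -
  have "- v = (-1) \<cdot>\<^sub>v v" using assms by auto
  thus ?thesis using vec_norm_smult[OF assms, of "-1"] by simp
qed

lemma vec_norm_le_sum:
  assumes \<nu>: "is_vec_norm N \<nu>"
  shows "\<nu> (Matrix.vec N x) \<le> (\<Sum>i<N. cmod (x i) * \<nu> (unit_vec N i))"
proof -
  have "\<nu> (Matrix.vec N (\<lambda>i. if i < k then x i else 0)) \<le> (\<Sum>i<k. cmod (x i) * \<nu> (unit_vec N i))"
    if "k \<le> N" for k using that
  proof (induction k)
    case 0
    have "Matrix.vec N (\<lambda>i. if i < 0 then x i else 0) = 0\<^sub>v N" by auto
    thus ?case using vec_norm_zero[OF \<nu>] by simp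
  next
    case (Suc k)
    let ?a = "Matrix.vec N (\<lambda>i. if i < k then x i else 0)" and ?b = "x k \<cdot>\<^sub>v unit_vec N k"
    have "Matrix.vec N (\<lambda>i. if i < Suc k then x i else 0) = ?a + ?b"
      by (intro eq_vecI) (auto simp: unit_vec_def less_Suc_eq)
    moreover have "\<nu> (?a + ?b) \<le> \<nu> ?a + \<nu> ?b"
      by (rule vec_norm_triangle[OF \<nu>]) auto
    moreover have "\<nu> ?b = cmod (x k) * \<nu> (unit_vec N k)"
      by (rule vec_norm_smult[OF \<nu>]) auto
    ultimately show ?case using Suc by simp
  qed
  from this[of N] show ?thesis
    by (smt (verit, best) eq_vecI dim_vec index_vec order_refl)
qed

lemma vec_norm_diff_le:
  assumes \<nu>: "is_vec_norm N \<nu>" and v: "v \<in> carrier_vec N" and w: "w \<in> carrier_vec N"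
  shows "\<bar>\<nu> v - \<nu> w\<bar> \<le> \<nu> (v - w)"
proof -
  have "v = w + (v - w)" "w = v + - (v - w)" using v w by auto
  hence "\<nu> v \<le> \<nu> w + \<nu> (v - w)" "\<nu> w \<le> \<nu> v + \<nu> (- (v - w))"
    using vec_norm_triangle[OF \<nu>, of w "v - w"] vec_norm_triangle[OF \<nu>, of v "- (v - w)"] v w
    by auto
  thus ?thesis using vec_norm_uminus[OF \<nu>, of "v - w"] v w by auto
qed

text \<open>Vectors are represented by coordinate functions with the product topology, so that
  compactness of products of discs becomes available for an arbitrary \<open>N\<close>. Only the
  finitely many coordinates below \<open>N\<close> enter, which gives continuity.\<close>

lemma continuous_on_vec_norm:
  assumes \<nu>: "is_vec_norm N \<nu>"
  shows "continuous_on UNIV (\<lambda>x :: nat \<Rightarrow> complex. \<nu> (Matrix.vec N x))"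
proof (rule continuous_at_imp_continuous_on, rule ballI)
  fix x :: "nat \<Rightarrow> complex"
  have "((\<lambda>y. \<Sum>i<N. cmod (y i - x i) * \<nu> (unit_vec N i)) \<longlongrightarrow> (\<Sum>i<N. cmod (x i - x i) * \<nu> (unit_vec N i))) (at x)"
  proof -
    have "isCont (\<lambda>y. \<Sum>i<N. cmod (y i - x i) * \<nu> (unit_vec N i)) x"
      by (intro continuous_intros continuous_on_interior[of UNIV])
         (auto intro!: continuous_on_product_coordinates)
    thus ?thesis by (simp add: isCont_def)
  qed
  hence lim: "((\<lambda>y. \<Sum>i<N. cmod (y i - x i) * \<nu> (unit_vec N i)) \<longlongrightarrow> 0) (at x)" by simp
  have "((\<lambda>y. \<nu> (Matrix.vec N y) - \<nu> (Matrix.vec N x)) \<longlongrightarrow> 0) (at x)"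
  proof (rule Lim_null_comparison[OF _ lim], rule always_eventually, rule allI)
    fix y :: "nat \<Rightarrow> complex"
    have "\<bar>\<nu> (Matrix.vec N y) - \<nu> (Matrix.vec N x)\<bar> \<le> \<nu> (Matrix.vec N y - Matrix.vec N x)"
      by (rule vec_norm_diff_le[OF \<nu>]) auto
    also have "Matrix.vec N y - Matrix.vec N x = Matrix.vec N (\<lambda>i. y i - x i)" by auto
    also have "\<nu> \<dots> \<le> (\<Sum>i<N. cmod (y i - x i) * \<nu> (unit_vec N i))" by (rule vec_norm_le_sum[OF \<nu>])
    finally show "norm (\<nu> (Matrix.vec N y) - \<nu> (Matrix.vec N x)) \<le> (\<Sum>i<N. cmod (y i - x i) * \<nu> (unit_vec N i))"
      by simp
  qed
  thus "isCont (\<lambda>x. \<nu> (Matrix.vec N x)) x"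
    unfolding isCont_def by (simp add: LIM_zero_iff)
qed

text \<open>The norm attains a positive minimum on the compact unit sphere of the sum norm; by
  homogeneity the reciprocal of that minimum is the constant.\<close>

lemma vec_norm_coord_bound:
  assumes \<nu>: "is_vec_norm N \<nu>"
  shows "\<exists>C>0. \<forall>v\<in>carrier_vec N. (\<Sum>i<N. cmod (v $ i)) \<le> C * \<nu> v"
proof (cases "N = 0")
  case True
  have "\<nu> v \<ge> 0" if "v \<in> carrier_vec N" for v using vec_norm_nonneg[OF \<nu> that] .
  thus ?thesis using True by (intro exI[of _ 1]) auto
next
  case False
  \<comment> \<open>Coordinates from \<open>N\<close> on stay free in the unit disc instead of being
    set to zero. Thus \<open>S\<close> is a closed part of a product of discs, compact by
    Tychonoff's theorem.\<close>
  define S where "S = {x :: nat \<Rightarrow> complex. (\<forall>i. x i \<in> cball 0 1) \<and> (\<Sum>i<N. cmod (x i)) = 1}"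
  have sum_cont: "continuous_on UNIV (\<lambda>x :: nat \<Rightarrow> complex. \<Sum>i<N. cmod (x i))"
    by (intro continuous_intros continuous_on_product_coordinates)
  have cpt: "compact (PiE UNIV (\<lambda>i :: nat. cball (0 :: complex) 1))"
    unfolding compactin_euclidean_iff[symmetric] euclidean_product_topology[symmetric]
    by (subst compactin_PiE) auto
  have "S = PiE UNIV (\<lambda>i. cball 0 1) \<inter> ((\<lambda>x. \<Sum>i<N. cmod (x i)) -` {1})"
    unfolding S_def by auto
  moreover have "closed ((\<lambda>x :: nat \<Rightarrow> complex. \<Sum>i<N. cmod (x i)) -` {1})"
    by (rule closed_vimage[OF _ sum_cont]) auto
  ultimately have S: "compact S" using cpt by (simp add: compact_Int_closed)
  have "(\<Sum>i<N. cmod ((\<lambda>j. if j = 0 then 1 else 0) i)) = 1"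
    using False by (subst sum.cong[OF refl, of _ _ "\<lambda>i. if i = 0 then 1 else 0"]) auto
  hence "(\<lambda>j. if j = 0 then 1 else 0) \<in> S" unfolding S_def by auto
  hence "S \<noteq> {}" by blast
  then obtain x0 where x0: "x0 \<in> S" "\<forall>y\<in>S. \<nu> (Matrix.vec N x0) \<le> \<nu> (Matrix.vec N y)"
    using continuous_attains_inf[OF S _ continuous_on_subset[OF continuous_on_vec_norm[OF \<nu>] subset_UNIV]]
    by blast
  define c where "c = \<nu> (Matrix.vec N x0)"
  have "Matrix.vec N x0 \<noteq> 0\<^sub>v N"
  proof
    assume "Matrix.vec N x0 = 0\<^sub>v N"
    hence "x0 i = 0" if "i < N" for i using that by (metis index_vec index_zero_vec(1))
    hence "(\<Sum>i<N. cmod (x0 i)) = 0" by simp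
    thus False using x0(1) unfolding S_def by simp
  qed
  hence c: "0 < c" unfolding c_def by (intro vec_norm_pos[OF \<nu>]) auto
  have "(\<Sum>i<N. cmod (v $ i)) \<le> (1 / c) * \<nu> v" if v: "v \<in> carrier_vec N" for v
  proof (cases "(\<Sum>i<N. cmod (v $ i)) = 0")
    case True
    thus ?thesis using vec_norm_nonneg[OF \<nu> v] c by (simp add: field_simps)
  next
    case False
    define s where "s = (\<Sum>i<N. cmod (v $ i))"
    have s: "0 < s" using False unfolding s_def by (smt (verit) sum_nonneg norm_ge_zero)
    define y where "y i = (if i < N then v $ i / complex_of_real s else 0)" for i
    have "cmod (v $ i) \<le> s" if "i < N" for i
      unfolding s_def by (rule member_le_sum) (use that in auto)
    hence "\<forall>i. y i \<in> cball 0 1" using s by (auto simp: y_def norm_divide)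
    moreover have "(\<Sum>i<N. cmod (y i)) = (\<Sum>i<N. cmod (v $ i) / s)"
      using s by (intro sum.cong) (auto simp: y_def norm_divide)
    hence "(\<Sum>i<N. cmod (y i)) = 1" using s by (simp add: sum_divide_distrib[symmetric] s_def[symmetric])
    ultimately have "c \<le> \<nu> (Matrix.vec N y)" using x0(2) unfolding S_def c_def by blast
    also have "Matrix.vec N y = complex_of_real (1 / s) \<cdot>\<^sub>v v"
      using v by (intro eq_vecI) (auto simp: y_def)
    also have "\<nu> \<dots> = (1 / s) * \<nu> v" using vec_norm_smult[OF \<nu> v, of "complex_of_real (1 / s)"] s
      by (simp add: norm_divide)
    finally show ?thesis using s c unfolding s_def[symmetric] by (simp add: field_simps)
  qed
  thus ?thesis using c by (intro exI[of _ "1 / c"]) auto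
qed

lemma mult_mat_vec_norm_bound:
  assumes \<nu>: "is_vec_norm N \<nu>" and X: "X \<in> carrier_mat N N"
  shows "\<exists>C>0. \<forall>v\<in>carrier_vec N. \<nu> (X *\<^sub>v v) \<le> C * \<nu> v"
proof -
  obtain C where C: "0 < C" "\<And>v. v \<in> carrier_vec N \<Longrightarrow> (\<Sum>i<N. cmod (v $ i)) \<le> C * \<nu> v"
    using vec_norm_coord_bound[OF \<nu>] by blast
  define m where "m = (\<Sum>i<N. \<Sum>j<N. cmod (X $$ (i, j)))"
  define e where "e = (\<Sum>i<N. \<nu> (unit_vec N i))"
  have e: "\<nu> (unit_vec N i) \<le> e" if "i < N" for i
    unfolding e_def by (rule member_le_sum) (use that vec_norm_nonneg[OF \<nu>] in auto)
  have e0: "0 \<le> e" unfolding e_def by (rule sum_nonneg) (use vec_norm_nonneg[OF \<nu>] in auto)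
  have m0: "0 \<le> m" unfolding m_def by (intro sum_nonneg) auto
  \<comment> \<open>The summand \<open>1\<close> keeps the constant positive, for instance when
    \<open>X = 0\<close>.\<close>
  have "\<nu> (X *\<^sub>v v) \<le> (m * e * C + 1) * \<nu> v" if v: "v \<in> carrier_vec N" for v
  proof -
    let ?s = "\<Sum>j<N. cmod (v $ j)"
    have xi: "cmod ((X *\<^sub>v v) $ i) \<le> (\<Sum>j<N. cmod (X $$ (i, j))) * ?s" if i: "i < N" for i
    proof -
      have "(X *\<^sub>v v) $ i = (\<Sum>j<N. X $$ (i, j) * v $ j)"
        using X v i by (auto simp: scalar_prod_def lessThan_atLeast0 intro!: sum.cong)
      also have "cmod \<dots> \<le> (\<Sum>j<N. cmod (X $$ (i, j)) * cmod (v $ j))"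
        by (rule order_trans[OF norm_sum]) (simp add: norm_mult)
      also have "\<dots> \<le> (\<Sum>j<N. cmod (X $$ (i, j)) * ?s)"
        by (intro sum_mono mult_left_mono member_le_sum) auto
      finally show ?thesis by (simp add: sum_distrib_right)
    qed
    have "X *\<^sub>v v = Matrix.vec N (\<lambda>i. (X *\<^sub>v v) $ i)" using X by auto
    hence "\<nu> (X *\<^sub>v v) = \<nu> (Matrix.vec N (\<lambda>i. (X *\<^sub>v v) $ i))" by (rule arg_cong)
    also have "\<dots> \<le> (\<Sum>i<N. cmod ((X *\<^sub>v v) $ i) * \<nu> (unit_vec N i))"
      by (rule vec_norm_le_sum[OF \<nu>])
    also have "\<dots> \<le> (\<Sum>i<N. ((\<Sum>j<N. cmod (X $$ (i, j))) * ?s) * e)"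
      by (intro sum_mono mult_mono) (use xi e vec_norm_nonneg[OF \<nu>] in \<open>auto intro!: mult_nonneg_nonneg sum_nonneg\<close>)
    also have "\<dots> = m * ?s * e" by (simp add: m_def sum_distrib_right)
    also have "\<dots> \<le> m * (C * \<nu> v) * e" by (intro mult_right_mono mult_left_mono C(2) v m0 e0)
    also have "\<dots> \<le> (m * e * C + 1) * \<nu> v" using vec_norm_nonneg[OF \<nu> v] by (simp add: algebra_simps)
    finally show ?thesis .
  qed
  moreover have "0 < m * e * C + 1" using m0 e0 C(1) by (intro add_nonneg_pos mult_nonneg_nonneg) auto
  ultimately show ?thesis by blast
qed

text \<open>Finite dimension bounds the quotients in the definition, so the supremum really
  dominates each of them; at the zero vector both sides vanish.\<close>

lemma le_op_norm:
  assumes \<nu>: "is_vec_norm N \<nu>" and X: "X \<in> carrier_mat N N" and v: "v \<in> carrier_vec N"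
  shows "\<nu> (X *\<^sub>v v) \<le> op_norm N \<nu> X * \<nu> v"
proof (cases "v = 0\<^sub>v N")
  case True
  hence "X *\<^sub>v v = 0\<^sub>v N" using X by auto
  thus ?thesis using vec_norm_zero[OF \<nu>] True by simp
next
  case False
  obtain C where C: "\<And>v. v \<in> carrier_vec N \<Longrightarrow> \<nu> (X *\<^sub>v v) \<le> C * \<nu> v"
    using mult_mat_vec_norm_bound[OF \<nu> X] by blast
  have "\<nu> (X *\<^sub>v v) / \<nu> v \<le> op_norm N \<nu> X"
    unfolding op_norm_def
  proof (rule cSUP_upper)
    show "bdd_above ((\<lambda>v. \<nu> (X *\<^sub>v v) / \<nu> v) ` (carrier_vec N - {0\<^sub>v N}))"
      by (rule bdd_aboveI2[of _ _ C]) (use C vec_norm_pos[OF \<nu>] in \<open>auto simp: divide_le_eq\<close>)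
  qed (use v False in auto)
  thus ?thesis using vec_norm_pos[OF \<nu> v False] by (simp add: divide_le_eq)
qed

text \<open>Positive dimension supplies a nonzero vector, so the supremum runs over a nonempty
  set.\<close>

lemma op_norm_le:
  assumes \<nu>: "is_vec_norm N \<nu>" and N: "0 < N"
    and le: "\<And>v. v \<in> carrier_vec N \<Longrightarrow> \<nu> (X *\<^sub>v v) \<le> C * \<nu> v"
  shows "op_norm N \<nu> X \<le> C"
  unfolding op_norm_def
proof (rule cSUP_least)
  have "unit_vec N 0 \<in> carrier_vec N" "unit_vec N 0 \<noteq> (0\<^sub>v N :: complex vec)"
    using N by (auto simp: vec_eq_iff intro: exI[of _ 0])
  thus "carrier_vec N - {0\<^sub>v N} \<noteq> ({} :: complex vec set)" by blast
  show "\<nu> (X *\<^sub>v v) / \<nu> v \<le> C" if "v \<in> carrier_vec N - {0\<^sub>v N}" for v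
    using le vec_norm_pos[OF \<nu>] that by (auto simp: divide_le_eq)
qed

section \<open>Polynomials and rational functions of matrices\<close>

lemma minv_inverse:
  assumes X: "X \<in> carrier_mat N N" and inv: "invertible_mat X"
  shows "minv X \<in> carrier_mat N N" "X * minv X = 1\<^sub>m N" "minv X * X = 1\<^sub>m N"
proof -
  obtain B where B: "X * B = 1\<^sub>m N" "B * X = 1\<^sub>m (dim_row B)"
    using inv X unfolding invertible_mat_def inverts_mat_def by auto
  have "dim_col B = N" using arg_cong[OF B(1), of dim_col] by simp
  moreover have "dim_row B = N" using arg_cong[OF B(2), of dim_col] X by simp
  ultimately have Bc: "B \<in> carrier_mat N N" by auto
  have "X \<in> Units (ring_mat TYPE(complex) N ())"
    unfolding Units_def using X Bc B by (auto simp: ring_mat_def intro!: bexI[of _ B])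
  then obtain Y where "mat_inverse X = Some Y"
    using mat_inverse(1)[OF X, of "()"] by (cases "mat_inverse X") auto
  thus "minv X \<in> carrier_mat N N" "X * minv X = 1\<^sub>m N" "minv X * X = 1\<^sub>m N"
    using mat_inverse(2)[OF X] by auto
qed

lemma invertible_matI:
  assumes X: "(X :: complex mat) \<in> carrier_mat N N" and Y: "Y \<in> carrier_mat N N"
    and XY: "X * Y = 1\<^sub>m N"
  shows "invertible_mat X"
  using mat_mult_left_right_inverse[OF X Y XY] X Y XY
  unfolding invertible_mat_def inverts_mat_def by (auto intro!: exI[of _ Y])

lemma minv_eqI:
  assumes X: "X \<in> carrier_mat N N" and Y: "Y \<in> carrier_mat N N" and XY: "X * Y = 1\<^sub>m N"
  shows "minv X = Y"
proof -
  note inv = minv_inverse[OF X invertible_matI[OF assms]]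
  have "minv X = minv X * (X * Y)" using XY inv(1) by simp
  also have "\<dots> = (minv X * X) * Y" by (rule assoc_mult_mat[symmetric]) (use X Y inv in auto)
  finally show ?thesis using inv(3) Y by simp
qed

lemma invertible_mat_kernelI:
  assumes X: "(X :: complex mat) \<in> carrier_mat N N"
    and ker: "\<And>v. v \<in> carrier_vec N \<Longrightarrow> X *\<^sub>v v = 0\<^sub>v N \<Longrightarrow> v = 0\<^sub>v N"
  shows "invertible_mat X"
proof -
  have "det X \<noteq> 0" using det_0_iff_vec_prod_zero_field[OF X] ker by blast
  from det_non_zero_imp_unit[OF X this, of "()"]
  obtain Y where "Y \<in> carrier_mat N N" "X * Y = 1\<^sub>m N"
    unfolding Units_def by (auto simp: ring_mat_def)
  thus ?thesis by (rule invertible_matI[OF X])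
qed

lemma invertible_mat_kernelD:
  assumes X: "(X :: complex mat) \<in> carrier_mat N N" and inv: "invertible_mat X"
    and v: "v \<in> carrier_vec N" and "X *\<^sub>v v = 0\<^sub>v N"
  shows "v = 0\<^sub>v N"
proof -
  note iX = minv_inverse[OF X inv]
  have "v = (minv X * X) *\<^sub>v v" using iX v by simp
  also have "\<dots> = minv X *\<^sub>v (X *\<^sub>v v)" by (rule assoc_mult_mat_vec) (use iX X v in auto)
  finally show ?thesis using assms(4) iX(1) by auto
qed

lemma smult_mult_mat_vec:
  assumes "(X :: complex mat) \<in> carrier_mat n k" "v \<in> carrier_vec k"
  shows "(c \<cdot>\<^sub>m X) *\<^sub>v v = c \<cdot>\<^sub>v (X *\<^sub>v v)"
  using assms by (intro eq_vecI) auto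

lemma mat_sum_empty [simp]: "mat_sum N f {} = 0\<^sub>m N N"
  using abelian_monoid.finsum_empty[OF abelian_group.axioms(1)[OF abelian_group_mat], of N N f]
  unfolding mat_sum_def by (simp add: module_mat_simps)

lemma mat_sum_insert:
  assumes "finite S" "s \<notin> S" "\<And>x. x \<in> insert s S \<Longrightarrow> f x \<in> carrier_mat N N"
  shows "mat_sum N f (insert s S) = f s + mat_sum N f S"
  using abelian_monoid.finsum_insert[OF abelian_group.axioms(1)[OF abelian_group_mat], of S s f N N] assms
  unfolding mat_sum_def by (auto simp: module_mat_simps)

lemma mat_sum_closed:
  assumes "finite S" "\<And>x. x \<in> S \<Longrightarrow> f x \<in> carrier_mat N N"
  shows "mat_sum N f S \<in> carrier_mat N N"
  using assms
proof (induction S)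
  case (insert s S)
  thus ?case by (subst mat_sum_insert) auto
qed auto

lemma mat_sum_mult_vec:
  assumes "finite S" "\<And>x. x \<in> S \<Longrightarrow> f x \<in> carrier_mat N N" and v: "v \<in> carrier_vec N"
    and add: "\<And>v w. v \<in> carrier_vec N \<Longrightarrow> w \<in> carrier_vec N \<Longrightarrow> \<psi> (v + w) = \<psi> v + (\<psi> w :: complex)"
  shows "\<psi> (mat_sum N f S *\<^sub>v v) = (\<Sum>x\<in>S. \<psi> (f x *\<^sub>v v))"
  using assms(1,2)
proof (induction S)
  case empty
  have "\<psi> (0\<^sub>v N + 0\<^sub>v N) = \<psi> (0\<^sub>v N) + \<psi> (0\<^sub>v N)" by (rule add) auto
  moreover have "0\<^sub>v N + 0\<^sub>v N = (0\<^sub>v N :: complex vec)" by auto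
  ultimately have "\<psi> (0\<^sub>v N) = 0" by simp
  moreover have "0\<^sub>m N N *\<^sub>v v = 0\<^sub>v N" using v by auto
  ultimately show ?case by simp
next
  case (insert s S)
  have c: "f s \<in> carrier_mat N N" "mat_sum N f S \<in> carrier_mat N N"
    using insert by (auto intro!: mat_sum_closed)
  have "mat_sum N f (insert s S) = f s + mat_sum N f S"
    using insert by (intro mat_sum_insert) auto
  also have "\<dots> *\<^sub>v v = f s *\<^sub>v v + mat_sum N f S *\<^sub>v v"
    by (rule add_mult_distrib_mat_vec[OF c v])
  also have "\<psi> \<dots> = \<psi> (f s *\<^sub>v v) + \<psi> (mat_sum N f S *\<^sub>v v)" by (rule add) (use c v in auto)
  finally show ?case using insert by simp
qed

lemma add_mat_left_commute:
  assumes "P \<in> carrier_mat n k" "Q \<in> carrier_mat n k" "R \<in> carrier_mat n k"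
  shows "P + (Q + R) = Q + (P + R :: complex mat)"
  using assms by (auto intro!: eq_matI)

lemma scalar_mat_add:
  assumes "P \<in> carrier_mat N N" "Q \<in> carrier_mat N N"
  shows "(a + b) \<cdot>\<^sub>m 1\<^sub>m N + (P + Q) = (a \<cdot>\<^sub>m 1\<^sub>m N + P) + (b \<cdot>\<^sub>m 1\<^sub>m N + Q :: complex mat)"
  using assms by (intro eq_matI) (auto simp: algebra_simps)

lemma scalar_mat_smult:
  assumes "P \<in> carrier_mat N N"
  shows "(c * a) \<cdot>\<^sub>m 1\<^sub>m N + c \<cdot>\<^sub>m P = c \<cdot>\<^sub>m (a \<cdot>\<^sub>m 1\<^sub>m N + P :: complex mat)"
  using assms by (intro eq_matI) (auto simp: algebra_simps)

text \<open>Cross-multiplication for matrix fractions: \<open>D\<close> commutes with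
  \<open>D'\<close>, hence also with its inverse \<open>I'\<close>, and moving \<open>I'\<close>
  past \<open>D\<close> lets \<open>D\<close> cancel against \<open>I\<close>.\<close>

lemma mat_fraction_eq:
  fixes P D P' D' I I' :: "complex mat"
  assumes c: "P \<in> carrier_mat N N" "D \<in> carrier_mat N N" "P' \<in> carrier_mat N N" "D' \<in> carrier_mat N N"
      "I \<in> carrier_mat N N" "I' \<in> carrier_mat N N"
    and eq: "P * D' = P' * D" "D * D' = D' * D" "D * I = 1\<^sub>m N" "D' * I' = 1\<^sub>m N" "I' * D' = 1\<^sub>m N"
  shows "P * I = P' * I'"
proof -
  note A = assoc_mult_mat[of _ N N _ N _ N]
  have comm: "D * I' = I' * D"
  proof -
    have "D * I' = (I' * D') * (D * I')" using c eq(5) by simp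
    also have "\<dots> = I' * ((D' * D) * I')" using c by (simp add: A)
    also have "\<dots> = I' * (D * (D' * I'))" unfolding eq(2)[symmetric] using c by (simp add: A)
    finally show ?thesis using eq(4) c by simp
  qed
  have "P * I = P * (D' * I') * I" using eq(4) c by simp
  also have "\<dots> = (P * D') * (I' * I)" using c by (simp add: A)
  also have "\<dots> = P' * ((D * I') * I)" unfolding eq(1) using c by (simp add: A)
  also have "\<dots> = P' * (I' * (D * I))" unfolding comm using c by (simp add: A)
  finally show ?thesis using eq(3) c by simp
qed

text \<open>Padding with zero coefficients frees the summation limit from the degree, which behaves
  irregularly under \<open>pCons\<close> at the zero polynomial.\<close>

lemma poly_mat_upto:
  assumes X: "X \<in> carrier_mat N N" and n: "degree p \<le> n"
  shows "mat_sum N (\<lambda>i. coeff p i \<cdot>\<^sub>m (X ^\<^sub>m i)) {..n} = poly_mat p X"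
  using n
proof (induction n rule: dec_induct)
  case base
  show ?case using X unfolding poly_mat_def by simp
next
  case (step n)
  have "mat_sum N (\<lambda>i. coeff p i \<cdot>\<^sub>m (X ^\<^sub>m i)) {..Suc n}
      = coeff p (Suc n) \<cdot>\<^sub>m (X ^\<^sub>m Suc n) + mat_sum N (\<lambda>i. coeff p i \<cdot>\<^sub>m (X ^\<^sub>m i)) {..n}"
    unfolding atMost_Suc using X by (subst mat_sum_insert) (auto intro!: smult_carrier_mat mult_carrier_mat[of _ N N] pow_carrier_mat)
  moreover have "coeff p (Suc n) = 0" using step by (intro coeff_eq_0) auto
  moreover have "mat_sum N (\<lambda>i. coeff p i \<cdot>\<^sub>m (X ^\<^sub>m i)) {..n} \<in> carrier_mat N N"
    using X by (intro mat_sum_closed) auto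
  moreover have "0 \<cdot>\<^sub>m (X ^\<^sub>m Suc n) = 0\<^sub>m N N" using X by auto
  ultimately show ?case using step by (simp del: pow_mat.simps)
qed

lemma poly_mat_carrier [simp]:
  assumes "X \<in> carrier_mat N N" shows "poly_mat p X \<in> carrier_mat N N"
  using mat_sum_closed[of "{..degree p}" "\<lambda>i. coeff p i \<cdot>\<^sub>m (X ^\<^sub>m i)" N] assms
  unfolding poly_mat_def by auto

lemma poly_mat_0 [simp]:
  assumes "X \<in> carrier_mat N N" shows "poly_mat 0 X = 0\<^sub>m N N"
  using assms unfolding poly_mat_def by (auto simp: mat_sum_insert)

text \<open>The Horner step. From this recursion additivity, multiplicativity and commutation with
  \<open>X\<close> follow by induction on the polynomial.\<close>

lemma poly_mat_pCons:
  assumes X: "X \<in> carrier_mat N N"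
  shows "poly_mat (pCons a p) X = a \<cdot>\<^sub>m 1\<^sub>m N + poly_mat p X * X"
proof -
  let ?q = "pCons a p"
  have c: "coeff r i \<cdot>\<^sub>m (X ^\<^sub>m i) \<in> carrier_mat N N" for r i using X by auto
  have mc: "mat_sum N (\<lambda>i. coeff r i \<cdot>\<^sub>m (X ^\<^sub>m i)) {..n} \<in> carrier_mat N N" for r n
    using c by (intro mat_sum_closed) auto
  have "mat_sum N (\<lambda>i. coeff ?q i \<cdot>\<^sub>m (X ^\<^sub>m i)) {..Suc n}
      = a \<cdot>\<^sub>m 1\<^sub>m N + mat_sum N (\<lambda>i. coeff p i \<cdot>\<^sub>m (X ^\<^sub>m i)) {..n} * X" for n
  proof (induction n)
    case 0
    have "{..Suc 0} = insert 1 {0 :: nat}" by auto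
    hence "mat_sum N (\<lambda>i. coeff ?q i \<cdot>\<^sub>m (X ^\<^sub>m i)) {..Suc 0} = coeff p 0 \<cdot>\<^sub>m X + a \<cdot>\<^sub>m 1\<^sub>m N"
      using X by (auto simp: mat_sum_insert)
    also have "\<dots> = a \<cdot>\<^sub>m 1\<^sub>m N + coeff p 0 \<cdot>\<^sub>m X" using X by (intro comm_add_mat) auto
    also have "coeff p 0 \<cdot>\<^sub>m X = mat_sum N (\<lambda>i. coeff p i \<cdot>\<^sub>m (X ^\<^sub>m i)) {..0} * X"
      using X by (auto simp: mat_sum_insert mult_smult_assoc_mat[of _ N N])
    finally show ?case .
  next
    case (Suc n)
    let ?S = "mat_sum N (\<lambda>i. coeff p i \<cdot>\<^sub>m (X ^\<^sub>m i)) {..n}"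
    have "mat_sum N (\<lambda>i. coeff ?q i \<cdot>\<^sub>m (X ^\<^sub>m i)) {..Suc (Suc n)}
        = coeff p (Suc n) \<cdot>\<^sub>m (X ^\<^sub>m Suc (Suc n)) + (a \<cdot>\<^sub>m 1\<^sub>m N + ?S * X)"
      unfolding Suc.IH[symmetric] atMost_Suc[of "Suc n"]
      by (subst mat_sum_insert) (use c in \<open>auto simp del: pow_mat.simps\<close>)
    also have "\<dots> = a \<cdot>\<^sub>m 1\<^sub>m N + (coeff p (Suc n) \<cdot>\<^sub>m (X ^\<^sub>m Suc (Suc n)) + ?S * X)"
      by (rule add_mat_left_commute[of _ N N]) (use X mc c in \<open>auto simp del: pow_mat.simps intro: mult_carrier_mat\<close>)
    also have "coeff p (Suc n) \<cdot>\<^sub>m (X ^\<^sub>m Suc (Suc n)) + ?S * X = (coeff p (Suc n) \<cdot>\<^sub>m (X ^\<^sub>m Suc n) + ?S) * X"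
      using X mc by (subst add_mult_distrib_mat[of _ N N])
        (auto intro!: arg_cong2[of _ _ _ _ "(+)"] mult_smult_assoc_mat[of _ N N, symmetric] mult_carrier_mat pow_carrier_mat)
    also have "coeff p (Suc n) \<cdot>\<^sub>m (X ^\<^sub>m Suc n) + ?S = mat_sum N (\<lambda>i. coeff p i \<cdot>\<^sub>m (X ^\<^sub>m i)) {..Suc n}"
      unfolding atMost_Suc by (subst mat_sum_insert) (use c in \<open>auto simp del: pow_mat.simps\<close>)
    finally show ?case .
  qed
  from this[of "degree p"] show ?thesis
    using poly_mat_upto[OF X, of ?q "Suc (degree p)"] poly_mat_upto[OF X, of p "degree p"]
    by (simp add: degree_pCons_le)
qed

lemma poly_mat_add:
  assumes X: "X \<in> carrier_mat N N"
  shows "poly_mat (p + q) X = poly_mat p X + poly_mat q X"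
proof (induction p q rule: poly_induct2)
  case 0
  show ?case using X by simp
next
  case (pCons a p b q)
  have c: "poly_mat p X \<in> carrier_mat N N" "poly_mat q X \<in> carrier_mat N N" using X by simp_all
  have "poly_mat (pCons a p + pCons b q) X = (a + b) \<cdot>\<^sub>m 1\<^sub>m N + (poly_mat p X + poly_mat q X) * X"
    using pCons by (simp add: poly_mat_pCons[OF X])
  also have "(poly_mat p X + poly_mat q X) * X = poly_mat p X * X + poly_mat q X * X"
    by (rule add_mult_distrib_mat[OF c X])
  also have "(a + b) \<cdot>\<^sub>m 1\<^sub>m N + \<dots> = (a \<cdot>\<^sub>m 1\<^sub>m N + poly_mat p X * X) + (b \<cdot>\<^sub>m 1\<^sub>m N + poly_mat q X * X)"
    by (rule scalar_mat_add) (use mult_carrier_mat[OF c(1) X] mult_carrier_mat[OF c(2) X] in auto)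
  finally show ?case by (simp add: poly_mat_pCons[OF X])
qed

lemma poly_mat_smult:
  assumes X: "X \<in> carrier_mat N N"
  shows "poly_mat (Polynomial.smult c p) X = c \<cdot>\<^sub>m poly_mat p X"
proof (induction p)
  case 0
  show ?case using X by auto
next
  case (pCons a p)
  have pc: "poly_mat p X \<in> carrier_mat N N" using X by simp
  have "poly_mat (Polynomial.smult c (pCons a p)) X = (c * a) \<cdot>\<^sub>m 1\<^sub>m N + (c \<cdot>\<^sub>m poly_mat p X) * X"
    using pCons by (simp add: poly_mat_pCons[OF X])
  also have "(c \<cdot>\<^sub>m poly_mat p X) * X = c \<cdot>\<^sub>m (poly_mat p X * X)"
    by (rule mult_smult_assoc_mat[OF pc X])
  also have "(c * a) \<cdot>\<^sub>m 1\<^sub>m N + \<dots> = c \<cdot>\<^sub>m (a \<cdot>\<^sub>m 1\<^sub>m N + poly_mat p X * X)"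
    by (rule scalar_mat_smult[OF mult_carrier_mat[OF pc X]])
  finally show ?case by (simp add: poly_mat_pCons[OF X])
qed

lemma poly_mat_X_comm:
  assumes X: "X \<in> carrier_mat N N"
  shows "poly_mat p X * X = X * poly_mat p X"
proof (induction p)
  case 0
  show ?case using X by simp
next
  case (pCons a p)
  have pc: "poly_mat p X \<in> carrier_mat N N" using X by simp
  have "poly_mat (pCons a p) X * X = (a \<cdot>\<^sub>m 1\<^sub>m N) * X + (poly_mat p X * X) * X"
    unfolding poly_mat_pCons[OF X] by (rule add_mult_distrib_mat[OF _ mult_carrier_mat[OF pc X] X]) auto
  also have "(a \<cdot>\<^sub>m 1\<^sub>m N) * X = X * (a \<cdot>\<^sub>m 1\<^sub>m N)"
    using mult_smult_assoc_mat[OF one_carrier_mat X] mult_smult_distrib[OF X one_carrier_mat] X by simp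
  also have "(poly_mat p X * X) * X = X * (poly_mat p X * X)"
    using assoc_mult_mat[OF X pc X] pCons.IH by simp
  also have "X * (a \<cdot>\<^sub>m 1\<^sub>m N) + X * (poly_mat p X * X) = X * poly_mat (pCons a p) X"
    unfolding poly_mat_pCons[OF X]
    by (rule mult_add_distrib_mat[OF X _ mult_carrier_mat[OF pc X], symmetric]) auto
  finally show ?case .
qed

lemma poly_mat_mult:
  assumes X: "X \<in> carrier_mat N N"
  shows "poly_mat (p * q) X = poly_mat p X * poly_mat q X"
proof (induction p)
  case 0
  show ?case using X left_mult_zero_mat[OF poly_mat_carrier[OF X]] by simp
next
  case (pCons a p)
  have c: "poly_mat r X \<in> carrier_mat N N" for r using X by simp
  have "poly_mat (pCons a p * q) X = a \<cdot>\<^sub>m poly_mat q X + poly_mat (pCons 0 (p * q)) X"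
    by (simp add: poly_mat_add[OF X] poly_mat_smult[OF X])
  also have "poly_mat (pCons 0 (p * q)) X = (poly_mat p X * poly_mat q X) * X"
  proof -
    have "0 \<cdot>\<^sub>m 1\<^sub>m N + P = P" if "P \<in> carrier_mat N N" for P :: "complex mat"
      using that by (intro eq_matI) auto
    thus ?thesis
      unfolding poly_mat_pCons[OF X] pCons.IH using mult_carrier_mat[OF mult_carrier_mat[OF c c] X] .
  qed
  also have "\<dots> = poly_mat p X * (poly_mat q X * X)" by (rule assoc_mult_mat[OF c c X])
  also have "poly_mat q X * X = X * poly_mat q X" by (rule poly_mat_X_comm[OF X])
  also have "poly_mat p X * (X * poly_mat q X) = (poly_mat p X * X) * poly_mat q X"
    by (rule assoc_mult_mat[OF c X c, symmetric])
  also have "a \<cdot>\<^sub>m poly_mat q X = (a \<cdot>\<^sub>m 1\<^sub>m N) * poly_mat q X"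
    using mult_smult_assoc_mat[OF one_carrier_mat c] left_mult_one_mat[OF c] by simp
  also have "(a \<cdot>\<^sub>m 1\<^sub>m N) * poly_mat q X + (poly_mat p X * X) * poly_mat q X = poly_mat (pCons a p) X * poly_mat q X"
    unfolding poly_mat_pCons[OF X]
    by (rule add_mult_distrib_mat[OF _ mult_carrier_mat[OF c X] c, symmetric]) auto
  finally show ?case .
qed

lemma poly_mat_comm:
  assumes X: "X \<in> carrier_mat N N"
  shows "poly_mat p X * poly_mat q X = poly_mat q X * poly_mat p X"
  using poly_mat_mult[OF X, of p q] poly_mat_mult[OF X, of q p] by (simp add: mult.commute)

text \<open>Over the complex numbers \<open>d\<close> loses one linear factor at a time, and a
  product of matrices with trivial kernel has trivial kernel.\<close>

lemma invertible_poly_mat: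
  assumes X: "X \<in> carrier_mat N N" and d: "d \<noteq> 0"
    and roots: "\<And>z. poly d z = 0 \<Longrightarrow> invertible_mat (- z \<cdot>\<^sub>m 1\<^sub>m N + X)"
  shows "invertible_mat (poly_mat d X)"
  using d roots
proof (induction "degree d" arbitrary: d)
  case 0
  then obtain c where c: "d = [:c:]" "c \<noteq> 0" by (metis degree_eq_zeroE pCons_0_0)
  have "poly_mat d X = c \<cdot>\<^sub>m 1\<^sub>m N" using X unfolding c by (auto simp: poly_mat_pCons)
  moreover have "(c \<cdot>\<^sub>m 1\<^sub>m N) * ((1 / c) \<cdot>\<^sub>m 1\<^sub>m N) = 1\<^sub>m N"
    using c(2) by (subst mult_smult_assoc_mat[of _ N N]) (auto intro!: eq_matI)
  ultimately show ?case by (intro invertible_matI[of _ N "(1 / c) \<cdot>\<^sub>m 1\<^sub>m N"]) auto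
next
  case (Suc k)
  have "degree d \<noteq> 0" using Suc by simp
  hence "\<not> constant (poly d)" by (simp add: constant_degree)
  from Fundamental_Theorem_Algebra.fundamental_theorem_of_algebra[OF this] obtain z where z: "poly d z = 0" by auto
  then obtain e where e: "d = [:- z, 1:] * e" by (metis dvdE poly_eq_0_iff_dvd)
  have e0: "e \<noteq> 0" using Suc.prems(1) e by auto
  have "degree d = Suc (degree e)" unfolding e using e0 by (subst degree_mult_eq) auto
  hence ie: "invertible_mat (poly_mat e X)"
    using Suc e0 e by (intro Suc.hyps(1)) auto
  have lin: "poly_mat [:- z, 1:] X = - z \<cdot>\<^sub>m 1\<^sub>m N + X"
    using X by (auto simp: poly_mat_pCons)
  have iz: "invertible_mat (poly_mat [:- z, 1:] X)" unfolding lin by (rule Suc.prems(2)[OF z])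
  have c: "poly_mat r X \<in> carrier_mat N N" for r using X by simp
  show ?case
  proof (rule invertible_mat_kernelI[OF c])
    fix v assume v: "v \<in> carrier_vec N" "poly_mat d X *\<^sub>v v = 0\<^sub>v N"
    have "poly_mat d X *\<^sub>v v = poly_mat [:- z, 1:] X *\<^sub>v (poly_mat e X *\<^sub>v v)"
      unfolding e poly_mat_mult[OF X] by (rule assoc_mult_mat_vec[OF c c v(1)])
    with v have "poly_mat [:- z, 1:] X *\<^sub>v (poly_mat e X *\<^sub>v v) = 0\<^sub>v N" by simp
    hence "poly_mat e X *\<^sub>v v = 0\<^sub>v N"
      by (rule invertible_mat_kernelD[OF c iz mult_mat_vec_carrier[OF c v(1)]])
    thus "v = 0\<^sub>v N" by (rule invertible_mat_kernelD[OF c ie v(1)])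
  qed
qed

text \<open>The work lies in uniqueness. Two admissible fractions agree off a finite set, hence as
  polynomials after cross-multiplication, and this identity passes to matrices.\<close>

lemma rat_fun_mat_eq:
  assumes X: "X \<in> carrier_mat N N" and N: "0 < N"
    and f: "finite {z. f z \<noteq> poly p z / poly d z}" and inv: "invertible_mat (poly_mat d X)"
  shows "rat_fun_mat f X = poly_mat p X * minv (poly_mat d X)"
  unfolding rat_fun_mat_def
proof (rule the_equality)
  show "\<exists>p' d'. finite {z. f z \<noteq> poly p' z / poly d' z} \<and> invertible_mat (poly_mat d' X) \<and>
      poly_mat p X * minv (poly_mat d X) = poly_mat p' X * minv (poly_mat d' X)"
    using f inv by blast
next
  fix Y
  assume "\<exists>p' d'. finite {z. f z \<noteq> poly p' z / poly d' z} \<and> invertible_mat (poly_mat d' X) \<and>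
      Y = poly_mat p' X * minv (poly_mat d' X)"
  then obtain p' d' where *: "finite {z. f z \<noteq> poly p' z / poly d' z}"
    "invertible_mat (poly_mat d' X)" "Y = poly_mat p' X * minv (poly_mat d' X)" by blast
  have c: "poly_mat r X \<in> carrier_mat N N" for r using X by simp
  \<comment> \<open>In positive dimension the zero matrix is singular, so an admissible denominator
    is not the zero polynomial.\<close>
  have nz: "r \<noteq> 0" if "invertible_mat (poly_mat r X)" for r
  proof
    assume "r = 0"
    hence "poly_mat r X *\<^sub>v unit_vec N 0 = 0\<^sub>v N" using X by auto
    from invertible_mat_kernelD[OF c that _ this] have "unit_vec N 0 = (0\<^sub>v N :: complex vec)" by simp
    thus False using N by (auto simp: vec_eq_iff)
  qed
  have "p * d' = p' * d"
  proof (rule ccontr)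
    assume "p * d' \<noteq> p' * d"
    hence "finite {z. poly (p * d' - p' * d) z = 0}" by (intro poly_roots_finite) simp
    moreover have "finite {z. poly d z = 0}" "finite {z. poly d' z = 0}"
      using poly_roots_finite nz inv *(2) by blast+
    \<comment> \<open>Outside the exceptional points and the zeros of the two denominators, equality
      of both fractions with \<open>f\<close> makes \<open>p * d' - p' * d\<close> vanish. Five
      finite sets would thus cover the plane.\<close>
    ultimately have "finite ({z. f z \<noteq> poly p z / poly d z} \<union> {z. f z \<noteq> poly p' z / poly d' z}
        \<union> {z. poly d z = 0} \<union> {z. poly d' z = 0} \<union> {z. poly (p * d' - p' * d) z = 0})"
      (is "finite ?S") using f *(1) by blast
    moreover have "?S = UNIV" by (auto simp: field_simps)
    ultimately show False using infinite_UNIV_char_0[where 'a = complex] by argo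
  qed
  hence eq: "poly_mat p X * poly_mat d' X = poly_mat p' X * poly_mat d X"
    using poly_mat_mult[OF X, of p d'] poly_mat_mult[OF X, of p' d] by simp
  show "Y = poly_mat p X * minv (poly_mat d X)"
    unfolding *(3)
    by (rule mat_fraction_eq[OF c c c c _ _ eq[symmetric] poly_mat_comm[OF X]])
      (use minv_inverse[OF c inv] minv_inverse[OF c *(2)] in auto)
qed

section \<open>Scalar resolvent functions\<close>

lemma holomorphic_on_poly_mult: "(\<lambda>z. poly q (c * z)) holomorphic_on S"
  by (induction q) (auto intro!: holomorphic_intros)

text \<open>The functional is bounded by the norm but need not be norming anywhere. The zero
  functional is therefore an instance, which gives access to algebraic facts before a functional
  adapted to the error matrix has been chosen.\<close>

locale resolvent_functional =
  fixes N :: nat and \<nu> :: "complex vec \<Rightarrow> real" and A :: "complex mat" and \<psi> :: "complex vec \<Rightarrow> complex"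
  assumes vec_norm: "is_vec_norm N \<nu>" and A: "A \<in> carrier_mat N N"
    and \<psi>_add: "\<And>v w. v \<in> carrier_vec N \<Longrightarrow> w \<in> carrier_vec N \<Longrightarrow> \<psi> (v + w) = \<psi> v + \<psi> w"
    and \<psi>_smult: "\<And>v c. v \<in> carrier_vec N \<Longrightarrow> \<psi> (c \<cdot>\<^sub>v v) = c * \<psi> v"
    and \<psi>_bound: "\<And>v. v \<in> carrier_vec N \<Longrightarrow> cmod (\<psi> v) \<le> \<nu> v"
begin

definition R :: "complex set" where "R = {z. invertible_mat (z \<cdot>\<^sub>m 1\<^sub>m N + A)}"

definition s :: "complex vec \<Rightarrow> complex \<Rightarrow> complex" where
  "s w z = \<psi> (resolvent A z *\<^sub>v w)"

lemma shift_carrier: "z \<cdot>\<^sub>m 1\<^sub>m N + A \<in> carrier_mat N N" using A by simp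

lemma resolvent_inverse:
  assumes "z \<in> R"
  shows "resolvent A z \<in> carrier_mat N N" "(z \<cdot>\<^sub>m 1\<^sub>m N + A) * resolvent A z = 1\<^sub>m N"
    "resolvent A z * (z \<cdot>\<^sub>m 1\<^sub>m N + A) = 1\<^sub>m N"
  using minv_inverse[OF shift_carrier, of z] assms A unfolding R_def resolvent_def by simp_all

lemma shift_mult_vec:
  assumes "v \<in> carrier_vec N"
  shows "(z \<cdot>\<^sub>m 1\<^sub>m N + A) *\<^sub>v v = z \<cdot>\<^sub>v v + A *\<^sub>v v"
proof -
  have "(z \<cdot>\<^sub>m 1\<^sub>m N + A) *\<^sub>v v = (z \<cdot>\<^sub>m 1\<^sub>m N) *\<^sub>v v + A *\<^sub>v v"
    by (rule add_mult_distrib_mat_vec[OF _ A assms]) auto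
  thus ?thesis using smult_mult_mat_vec[OF one_carrier_mat assms] assms by simp
qed

lemma resolvent_vec:
  assumes z: "z \<in> R" and w: "w \<in> carrier_vec N"
  shows "resolvent A z *\<^sub>v w \<in> carrier_vec N"
    "z \<cdot>\<^sub>v (resolvent A z *\<^sub>v w) + A *\<^sub>v (resolvent A z *\<^sub>v w) = w"
proof -
  note r = resolvent_inverse[OF z]
  show c: "resolvent A z *\<^sub>v w \<in> carrier_vec N" by (rule mult_mat_vec_carrier[OF r(1) w])
  have "((z \<cdot>\<^sub>m 1\<^sub>m N + A) * resolvent A z) *\<^sub>v w = (z \<cdot>\<^sub>m 1\<^sub>m N + A) *\<^sub>v (resolvent A z *\<^sub>v w)"
    by (rule assoc_mult_mat_vec[OF shift_carrier r(1) w])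
  thus "z \<cdot>\<^sub>v (resolvent A z *\<^sub>v w) + A *\<^sub>v (resolvent A z *\<^sub>v w) = w"
    using r(2) w shift_mult_vec[OF c] by simp
qed

lemma resolvent_vec_unique:
  assumes z: "z \<in> R" and y: "y \<in> carrier_vec N" and eq: "z \<cdot>\<^sub>v y + A *\<^sub>v y = w"
  shows "resolvent A z *\<^sub>v w = y"
proof -
  note r = resolvent_inverse[OF z]
  have "(resolvent A z * (z \<cdot>\<^sub>m 1\<^sub>m N + A)) *\<^sub>v y = resolvent A z *\<^sub>v ((z \<cdot>\<^sub>m 1\<^sub>m N + A) *\<^sub>v y)"
    by (rule assoc_mult_mat_vec[OF r(1) shift_carrier y])
  thus ?thesis using r(3) y shift_mult_vec[OF y] eq by simp
qed

lemma s_add: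
  assumes z: "z \<in> R" and v: "v \<in> carrier_vec N" and w: "w \<in> carrier_vec N"
  shows "s (v + w) z = s v z + s w z"
  unfolding s_def mult_add_distrib_mat_vec[OF resolvent_inverse(1)[OF z] v w]
  by (rule \<psi>_add) (use resolvent_vec(1)[OF z] v w in auto)

lemma s_smult:
  assumes z: "z \<in> R" and v: "v \<in> carrier_vec N"
  shows "s (c \<cdot>\<^sub>v v) z = c * s v z"
  unfolding s_def mult_mat_vec[OF resolvent_inverse(1)[OF z] v]
  by (rule \<psi>_smult[OF resolvent_vec(1)[OF z v]])

text \<open>Rests on \<open>(z + A)\<^sup>-\<^sup>1 A = I - z (z + A)\<^sup>-\<^sup>1\<close>: up to
  a constant, \<open>- A\<close> acts on \<open>s\<close> as multiplication by
  \<open>z\<close>.\<close>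

lemma s_mult_A:
  assumes z: "z \<in> R" and v: "v \<in> carrier_vec N"
  shows "s (A *\<^sub>v v) z = \<psi> v - z * s v z"
proof -
  have Av: "A *\<^sub>v v \<in> carrier_vec N" by (rule mult_mat_vec_carrier[OF A v])
  have zv: "z \<cdot>\<^sub>v v \<in> carrier_vec N" using v by simp
  have "resolvent A z *\<^sub>v (z \<cdot>\<^sub>v v + A *\<^sub>v v) = v" by (rule resolvent_vec_unique[OF z v refl])
  hence "s (z \<cdot>\<^sub>v v + A *\<^sub>v v) z = \<psi> v" unfolding s_def by simp
  thus ?thesis using s_add[OF z zv Av] s_smult[OF z v] by (simp add: eq_diff_eq add.commute)
qed

lemma s_bound:
  assumes z: "z \<in> R" and v: "v \<in> carrier_vec N"
  shows "cmod (s v z) \<le> op_norm N \<nu> (resolvent A z) * \<nu> v"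
  unfolding s_def
  using \<psi>_bound[OF resolvent_vec(1)[OF z v]] le_op_norm[OF vec_norm resolvent_inverse(1)[OF z] v]
  by simp

text \<open>Iterates \<open>s_mult_A\<close>: each factor \<open>- h A\<close> turns into
  multiplication by \<open>h z\<close> at the cost of an entire function, and the costs accumulate
  in \<open>e\<close>.\<close>

lemma s_poly_mat:
  assumes w: "w \<in> carrier_vec N"
  shows "\<exists>e. e holomorphic_on UNIV \<and>
    (\<forall>z\<in>R. s (poly_mat p (complex_of_real (- h) \<cdot>\<^sub>m A) *\<^sub>v w) z = poly p (complex_of_real h * z) * s w z - e z)"
  using w
proof (induction p arbitrary: w)
  case 0
  have Y: "complex_of_real (- h) \<cdot>\<^sub>m A \<in> carrier_mat N N" using A by simp
  have "s (0\<^sub>m N N *\<^sub>v w) z = 0" if "z \<in> R" for z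
  proof -
    have "0\<^sub>m N N *\<^sub>v w = 0 \<cdot>\<^sub>v w" using 0 by auto
    thus ?thesis using s_smult[OF that 0, of 0] by simp
  qed
  thus ?case using Y by (intro exI[of _ "\<lambda>_. 0"]) auto
next
  case (pCons a p)
  let ?Y = "complex_of_real (- h) \<cdot>\<^sub>m A"
  have Y: "?Y \<in> carrier_mat N N" using A by simp
  have Yw: "?Y *\<^sub>v w \<in> carrier_vec N" by (rule mult_mat_vec_carrier[OF Y pCons.prems])
  obtain e where e: "e holomorphic_on UNIV"
    "\<And>z. z \<in> R \<Longrightarrow> s (poly_mat p ?Y *\<^sub>v (?Y *\<^sub>v w)) z = poly p (complex_of_real h * z) * s (?Y *\<^sub>v w) z - e z"
    using pCons.IH[OF Yw] by auto
  let ?e = "\<lambda>z. complex_of_real h * \<psi> w * poly p (complex_of_real h * z) + e z"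
  have hol: "?e holomorphic_on UNIV"
    by (intro holomorphic_intros e(1) holomorphic_on_poly_mult)
  have "s (poly_mat (pCons a p) ?Y *\<^sub>v w) z = poly (pCons a p) (complex_of_real h * z) * s w z - ?e z"
    if z: "z \<in> R" for z
  proof -
    have pY: "poly_mat p ?Y \<in> carrier_mat N N" using Y by simp
    have "poly_mat (pCons a p) ?Y *\<^sub>v w = (a \<cdot>\<^sub>m 1\<^sub>m N) *\<^sub>v w + (poly_mat p ?Y * ?Y) *\<^sub>v w"
      unfolding poly_mat_pCons[OF Y]
      by (rule add_mult_distrib_mat_vec[OF _ mult_carrier_mat[OF pY Y] pCons.prems]) auto
    also have "(a \<cdot>\<^sub>m 1\<^sub>m N) *\<^sub>v w = a \<cdot>\<^sub>v w"
      using smult_mult_mat_vec[OF one_carrier_mat pCons.prems] pCons.prems by simp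
    also have "(poly_mat p ?Y * ?Y) *\<^sub>v w = poly_mat p ?Y *\<^sub>v (?Y *\<^sub>v w)"
      by (rule assoc_mult_mat_vec[OF pY Y pCons.prems])
    finally have 1: "s (poly_mat (pCons a p) ?Y *\<^sub>v w) z = a * s w z + s (poly_mat p ?Y *\<^sub>v (?Y *\<^sub>v w)) z"
      using s_add[OF z _ mult_mat_vec_carrier[OF pY Yw], of "a \<cdot>\<^sub>v w"] s_smult[OF z pCons.prems] pCons.prems
      by simp
    have 2: "s (?Y *\<^sub>v w) z = - complex_of_real h * (\<psi> w - z * s w z)"
      unfolding smult_mult_mat_vec[OF A pCons.prems]
      using s_smult[OF z mult_mat_vec_carrier[OF A pCons.prems], of "complex_of_real (- h)"]
        s_mult_A[OF z pCons.prems] by simp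
    show ?thesis unfolding 1 e(2)[OF z] 2 by (simp add: algebra_simps)
  qed
  thus ?case using hol by (intro exI[of _ ?e]) auto
qed

text \<open>Encodes \<open>F = f(-A)\<close> on the level of scalar resolvents. The equation is
  demanded only on the resolvent set, whereas \<open>e\<close> has to be holomorphic on all of
  \<open>H\<close>, across any spectrum of \<open>- A\<close> inside it.\<close>

definition represents :: "complex set \<Rightarrow> (complex \<Rightarrow> complex) \<Rightarrow> complex mat \<Rightarrow> bool" where
  "represents H f F \<longleftrightarrow> F \<in> carrier_mat N N \<and>
     (\<forall>v\<in>carrier_vec N. \<exists>e. e holomorphic_on H \<and> (\<forall>z\<in>R \<inter> H. f z * s v z = s (F *\<^sub>v v) z + e z))"

lemma representsI:
  assumes "F \<in> carrier_mat N N"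
    and "\<And>v. v \<in> carrier_vec N \<Longrightarrow>
      \<exists>e. e holomorphic_on H \<and> (\<forall>z\<in>R \<inter> H. f z * s v z = s (F *\<^sub>v v) z + e z)"
  shows "represents H f F"
  using assms unfolding represents_def by simp

lemma representsE:
  assumes "represents H f F" "v \<in> carrier_vec N"
  obtains e where "e holomorphic_on H" "\<And>z. z \<in> R \<Longrightarrow> z \<in> H \<Longrightarrow> f z * s v z = s (F *\<^sub>v v) z + e z"
  using assms unfolding represents_def by auto

lemma represents_1: "represents H (\<lambda>_. 1) (1\<^sub>m N)"
  by (rule representsI) (auto intro!: exI[of _ "\<lambda>_. 0"])

text \<open>Treating \<open>g\<close> first and then \<open>f\<close> leaves the defect
  \<open>ef + f * eg\<close>, which is holomorphic because \<open>f\<close> is.\<close>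

lemma represents_mult:
  assumes f: "represents H f F" and g: "represents H g G" and hol: "f holomorphic_on H"
  shows "represents H (\<lambda>z. f z * g z) (F * G)"
proof (rule representsI)
  have c: "F \<in> carrier_mat N N" "G \<in> carrier_mat N N" using f g unfolding represents_def by auto
  show "F * G \<in> carrier_mat N N" by (rule mult_carrier_mat[OF c])
  fix v :: "complex vec" assume v: "v \<in> carrier_vec N"
  obtain eg where eg: "eg holomorphic_on H" "\<And>z. z \<in> R \<Longrightarrow> z \<in> H \<Longrightarrow> g z * s v z = s (G *\<^sub>v v) z + eg z"
    using representsE[OF g v] by metis
  obtain ef where ef: "ef holomorphic_on H"
    "\<And>z. z \<in> R \<Longrightarrow> z \<in> H \<Longrightarrow> f z * s (G *\<^sub>v v) z = s (F *\<^sub>v (G *\<^sub>v v)) z + ef z"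
    using representsE[OF f mult_mat_vec_carrier[OF c(2) v]] by metis
  have eq: "(F * G) *\<^sub>v v = F *\<^sub>v (G *\<^sub>v v)" by (rule assoc_mult_mat_vec[OF c v])
  show "\<exists>e. e holomorphic_on H \<and> (\<forall>z\<in>R \<inter> H. f z * g z * s v z = s ((F * G) *\<^sub>v v) z + e z)"
  proof (intro exI conjI ballI)
    show "(\<lambda>z. ef z + f z * eg z) holomorphic_on H" by (intro holomorphic_intros ef eg hol)
    fix z assume "z \<in> R \<inter> H"
    thus "f z * g z * s v z = s ((F * G) *\<^sub>v v) z + (ef z + f z * eg z)"
      using ef(2)[of z] eg(2)[of z] unfolding eq by (simp add: mult.assoc distrib_left)
  qed
qed

lemma represents_power:
  assumes f: "represents H f F" and hol: "f holomorphic_on H"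
  shows "represents H (\<lambda>z. f z ^ n) (F ^\<^sub>m n)"
proof (induction n)
  case 0
  have "dim_row F = N" using f unfolding represents_def by auto
  thus ?case using represents_1 by simp
next
  case (Suc n)
  have "(\<lambda>z. f z ^ n) holomorphic_on H" by (intro holomorphic_intros hol)
  from represents_mult[OF Suc.IH f this] show ?case by (simp add: mult.commute)
qed

text \<open>Write \<open>v = d(Y) w\<close> with \<open>Y = - h A\<close>. Modulo entire functions
  \<open>s v\<close> and \<open>s (p(Y) w)\<close> are polynomial multiples of the same
  \<open>s w\<close>; eliminating \<open>s w\<close> leaves a defect that is singular at most at
  zeros of \<open>d (h z)\<close>, and these avoid \<open>H\<close>. Such zeros lie in the resolvent
  set, which is what makes \<open>d(Y)\<close> invertible.\<close>

lemma represents_rational: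
  assumes N: "0 < N"
    and f: "\<And>z. poly d z \<noteq> 0 \<Longrightarrow> f z = poly p z / poly d z" and d0: "d \<noteq> 0"
    and H: "\<And>z. z \<in> H \<Longrightarrow> poly d (complex_of_real h * z) \<noteq> 0"
    and h: "h \<noteq> 0"
    and roots: "\<And>z. poly d (complex_of_real h * z) = 0 \<Longrightarrow> z \<in> R"
  shows "represents H (\<lambda>z. f (complex_of_real h * z)) (rat_fun_mat f (complex_of_real (- h) \<cdot>\<^sub>m A))"
proof -
  let ?Y = "complex_of_real (- h) \<cdot>\<^sub>m A"
  have Y: "?Y \<in> carrier_mat N N" using A by simp
  have inv: "invertible_mat (poly_mat d ?Y)"
  proof (rule invertible_poly_mat[OF Y d0])
    fix z assume "poly d z = 0"
    hence "z / complex_of_real h \<in> R" using roots[of "z / complex_of_real h"] h by simp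
    note r = resolvent_inverse[OF this]
    let ?S = "(z / complex_of_real h) \<cdot>\<^sub>m 1\<^sub>m N + A" and ?Q = "resolvent A (z / complex_of_real h)"
    have S: "?S \<in> carrier_mat N N" by (rule shift_carrier)
    have "- z \<cdot>\<^sub>m 1\<^sub>m N + ?Y = complex_of_real (- h) \<cdot>\<^sub>m ?S"
      using A h by (intro eq_matI) (auto simp: algebra_simps)
    moreover have "(complex_of_real (- h) \<cdot>\<^sub>m ?S) * ((1 / complex_of_real (- h)) \<cdot>\<^sub>m ?Q) = 1\<^sub>m N"
    proof -
      have "(complex_of_real (- h) \<cdot>\<^sub>m ?S) * ((1 / complex_of_real (- h)) \<cdot>\<^sub>m ?Q)
          = (1 / complex_of_real (- h)) \<cdot>\<^sub>m ((complex_of_real (- h) \<cdot>\<^sub>m ?S) * ?Q)"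
        by (rule mult_smult_distrib[OF smult_carrier_mat[OF S] r(1)])
      also have "(complex_of_real (- h) \<cdot>\<^sub>m ?S) * ?Q = complex_of_real (- h) \<cdot>\<^sub>m (?S * ?Q)"
        by (rule mult_smult_assoc_mat[OF S r(1)])
      also have "?S * ?Q = 1\<^sub>m N" by (rule r(2))
      finally show ?thesis using h by (auto intro!: eq_matI)
    qed
    ultimately show "invertible_mat (- z \<cdot>\<^sub>m 1\<^sub>m N + ?Y)"
      using invertible_matI[of "complex_of_real (- h) \<cdot>\<^sub>m ?S" N "(1 / complex_of_real (- h)) \<cdot>\<^sub>m ?Q"] S r(1)
      by simp
  qed
  have "{z. f z \<noteq> poly p z / poly d z} \<subseteq> {z. poly d z = 0}" using f by auto
  hence "finite {z. f z \<noteq> poly p z / poly d z}" using poly_roots_finite[OF d0] finite_subset by auto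
  hence eq: "rat_fun_mat f ?Y = poly_mat p ?Y * minv (poly_mat d ?Y)"
    by (rule rat_fun_mat_eq[OF Y N _ inv])
  have c: "poly_mat q ?Y \<in> carrier_mat N N" for q using Y by simp
  note I = minv_inverse[OF c inv]
  show ?thesis unfolding eq
  proof (rule representsI)
    show "poly_mat p ?Y * minv (poly_mat d ?Y) \<in> carrier_mat N N" by (rule mult_carrier_mat[OF c I(1)])
    fix v :: "complex vec" assume v: "v \<in> carrier_vec N"
    define w where "w = minv (poly_mat d ?Y) *\<^sub>v v"
    have w: "w \<in> carrier_vec N" unfolding w_def by (rule mult_mat_vec_carrier[OF I(1) v])
    have "(poly_mat d ?Y * minv (poly_mat d ?Y)) *\<^sub>v v = poly_mat d ?Y *\<^sub>v w"
      unfolding w_def by (rule assoc_mult_mat_vec[OF c I(1) v])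
    hence dw: "poly_mat d ?Y *\<^sub>v w = v" using I(2) v by simp
    have pw: "(poly_mat p ?Y * minv (poly_mat d ?Y)) *\<^sub>v v = poly_mat p ?Y *\<^sub>v w"
      unfolding w_def by (rule assoc_mult_mat_vec[OF c I(1) v])
    obtain e1 where e1: "e1 holomorphic_on UNIV"
      "\<And>z. z \<in> R \<Longrightarrow> s v z = poly d (complex_of_real h * z) * s w z - e1 z"
      using s_poly_mat[OF w, of d h] unfolding dw by auto
    obtain e2 where e2: "e2 holomorphic_on UNIV"
      "\<And>z. z \<in> R \<Longrightarrow> s (poly_mat p ?Y *\<^sub>v w) z = poly p (complex_of_real h * z) * s w z - e2 z"
      using s_poly_mat[OF w, of p h] by auto
    let ?e = "\<lambda>z. e2 z - poly p (complex_of_real h * z) / poly d (complex_of_real h * z) * e1 z"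
    have hp: "(\<lambda>z. poly q (complex_of_real h * z)) holomorphic_on H" for q
      by (rule holomorphic_on_poly_mult)
    show "\<exists>e. e holomorphic_on H \<and> (\<forall>z\<in>R \<inter> H. f (complex_of_real h * z) * s v z =
        s ((poly_mat p ?Y * minv (poly_mat d ?Y)) *\<^sub>v v) z + e z)"
    proof (intro exI[of _ ?e] conjI ballI)
      show "?e holomorphic_on H"
        by (intro holomorphic_intros hp holomorphic_on_subset[OF e1(1)] holomorphic_on_subset[OF e2(1)]) (use H in auto)
      fix z assume z: "z \<in> R \<inter> H"
      hence zR: "z \<in> R" by simp
      have nz: "poly d (complex_of_real h * z) \<noteq> 0" using H z by auto
      show "f (complex_of_real h * z) * s v z = s ((poly_mat p ?Y * minv (poly_mat d ?Y)) *\<^sub>v v) z + ?e z"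
        unfolding pw f[OF nz] e1(2)[OF zR] e2(2)[OF zR] using nz by (simp add: field_simps)
    qed
  qed
qed

text \<open>Neumann bound: when \<open>cmod z\<close> is at least twice a bound for
  \<open>A\<close>, the term \<open>A y\<close> in \<open>z y + A y = w\<close> is absorbed by half
  of \<open>z y\<close>. The case \<open>w = 0\<close> shows that the kernel is trivial.\<close>

lemma resolvent_large:
  "\<exists>C>0. \<forall>z. C \<le> cmod z \<longrightarrow> z \<in> R \<and> (\<forall>v\<in>carrier_vec N. cmod (s v z) \<le> 2 * \<nu> v / cmod z)"
proof -
  obtain C where C: "0 < C" "\<And>v. v \<in> carrier_vec N \<Longrightarrow> \<nu> (A *\<^sub>v v) \<le> C * \<nu> v"
    using mult_mat_vec_norm_bound[OF vec_norm A] by auto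
  have main: "\<nu> y \<le> 2 * \<nu> w / cmod z"
    if z: "2 * C \<le> cmod z" and y: "y \<in> carrier_vec N" and eq: "z \<cdot>\<^sub>v y + A *\<^sub>v y = w" for z y w
  proof -
    have zy: "z \<cdot>\<^sub>v y \<in> carrier_vec N" and Ay: "A *\<^sub>v y \<in> carrier_vec N"
      using y mult_mat_vec_carrier[OF A y] by auto
    have "\<bar>\<nu> (z \<cdot>\<^sub>v y) - \<nu> (- (A *\<^sub>v y))\<bar> \<le> \<nu> (z \<cdot>\<^sub>v y - (- (A *\<^sub>v y)))"
      by (rule vec_norm_diff_le[OF vec_norm zy]) (use Ay in simp)
    also have "z \<cdot>\<^sub>v y - (- (A *\<^sub>v y)) = w" using eq zy Ay by (auto simp: minus_add_uminus_vec)
    finally have "cmod z * \<nu> y \<le> \<nu> w + C * \<nu> y"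
      using vec_norm_smult[OF vec_norm y, of z] vec_norm_uminus[OF vec_norm Ay] C(2)[OF y] by simp
    moreover have "2 * C * \<nu> y \<le> cmod z * \<nu> y"
      using z vec_norm_nonneg[OF vec_norm y] by (rule mult_right_mono)
    ultimately have "cmod z * \<nu> y \<le> 2 * \<nu> w" by simp
    moreover have "0 < cmod z" using z C(1) by linarith
    ultimately show ?thesis by (simp add: field_simps)
  qed
  have "z \<in> R \<and> (\<forall>v\<in>carrier_vec N. cmod (s v z) \<le> 2 * \<nu> v / cmod z)" if z: "2 * C \<le> cmod z" for z
  proof -
    have zR: "z \<in> R" unfolding R_def mem_Collect_eq
    proof (rule invertible_mat_kernelI[OF shift_carrier])
      fix v :: "complex vec" assume v: "v \<in> carrier_vec N" "(z \<cdot>\<^sub>m 1\<^sub>m N + A) *\<^sub>v v = 0\<^sub>v N"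
      have "\<nu> v \<le> 2 * \<nu> (0\<^sub>v N) / cmod z"
        by (rule main[OF z v(1)]) (use v shift_mult_vec[OF v(1)] in simp)
      hence "\<nu> v \<le> 0" using vec_norm_zero[OF vec_norm] by simp
      thus "v = 0\<^sub>v N" using vec_norm_nonneg[OF vec_norm v(1)] vec_norm_eq_0[OF vec_norm v(1)] by simp
    qed
    have "cmod (s v z) \<le> 2 * \<nu> v / cmod z" if v: "v \<in> carrier_vec N" for v
      unfolding s_def
      using \<psi>_bound[OF resolvent_vec(1)[OF zR v]] main[OF z resolvent_vec[OF zR v]] by simp
    thus ?thesis using zR by simp
  qed
  thus ?thesis using C(1) by (intro exI[of _ "2 * C"]) auto
qed

text \<open>By the resolvent identity the difference quotient of \<open>s w\<close> at
  \<open>z0\<close> is exactly \<open>- s (resolvent A z0 *\<^sub>v w) z\<close>. Differentiability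
  thus reduces to continuity at \<open>z0\<close>, and continuity to a local bound on resolvents
  applied to vectors.\<close>

lemma s_has_field_derivative:
  assumes S: "open S" "S \<subseteq> R" and z0: "z0 \<in> S" and w: "w \<in> carrier_vec N"
  shows "(s w has_field_derivative - s (resolvent A z0 *\<^sub>v w) z0) (at z0)"
proof -
  have z0R: "z0 \<in> R" using z0 S by auto
  obtain C where C: "0 < C" "\<And>v. v \<in> carrier_vec N \<Longrightarrow> \<nu> (resolvent A z0 *\<^sub>v v) \<le> C * \<nu> v"
    using mult_mat_vec_norm_bound[OF vec_norm resolvent_inverse(1)[OF z0R]] by auto
  have diff: "resolvent A z *\<^sub>v v = resolvent A z0 *\<^sub>v v + (z0 - z) \<cdot>\<^sub>v (resolvent A z *\<^sub>v (resolvent A z0 *\<^sub>v v))"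
    if z: "z \<in> R" and v: "v \<in> carrier_vec N" for z v
  proof -
    let ?y = "resolvent A z0 *\<^sub>v v" let ?x = "resolvent A z *\<^sub>v ?y"
    note y = resolvent_vec[OF z0R v] note x = resolvent_vec[OF z y(1)]
    show ?thesis
    proof (rule resolvent_vec_unique[OF z])
      show "?y + (z0 - z) \<cdot>\<^sub>v ?x \<in> carrier_vec N" using x y by simp
      have "z \<cdot>\<^sub>v (?y + (z0 - z) \<cdot>\<^sub>v ?x) + A *\<^sub>v (?y + (z0 - z) \<cdot>\<^sub>v ?x)
          = (z \<cdot>\<^sub>v ?y + A *\<^sub>v ?y) + (z0 - z) \<cdot>\<^sub>v (z \<cdot>\<^sub>v ?x + A *\<^sub>v ?x)"
      proof -
        have Ayx: "A *\<^sub>v ?y \<in> carrier_vec N" "A *\<^sub>v ?x \<in> carrier_vec N"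
          using mult_mat_vec_carrier[OF A] x(1) y(1) by auto
        have "A *\<^sub>v (?y + (z0 - z) \<cdot>\<^sub>v ?x) = A *\<^sub>v ?y + (z0 - z) \<cdot>\<^sub>v (A *\<^sub>v ?x)"
          using mult_add_distrib_mat_vec[OF A y(1), of "(z0 - z) \<cdot>\<^sub>v ?x"] mult_mat_vec[OF A x(1)] x(1) by simp
        moreover have "z \<cdot>\<^sub>v (y' + k \<cdot>\<^sub>v x') + (a + k \<cdot>\<^sub>v b) = (z \<cdot>\<^sub>v y' + a) + k \<cdot>\<^sub>v (z \<cdot>\<^sub>v x' + b)"
          if "y' \<in> carrier_vec N" "x' \<in> carrier_vec N" "a \<in> carrier_vec N" "b \<in> carrier_vec N"
          for y' x' a b :: "complex vec" and k
          using that by (intro eq_vecI) (auto simp: algebra_simps)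
        ultimately show ?thesis using x(1) y(1) Ayx by simp
      qed
      also have "\<dots> = (z \<cdot>\<^sub>v ?y + A *\<^sub>v ?y) + (z0 - z) \<cdot>\<^sub>v ?y" using x(2) by simp
      also have "\<dots> = z0 \<cdot>\<^sub>v ?y + A *\<^sub>v ?y"
      proof -
        have "(z \<cdot>\<^sub>v y' + a) + (z0 - z) \<cdot>\<^sub>v y' = z0 \<cdot>\<^sub>v y' + a"
          if "y' \<in> carrier_vec N" "a \<in> carrier_vec N" for y' a :: "complex vec"
          using that by (intro eq_vecI) (auto simp: algebra_simps)
        thus ?thesis using y(1) mult_mat_vec_carrier[OF A y(1)] by simp
      qed
      finally show "z \<cdot>\<^sub>v (?y + (z0 - z) \<cdot>\<^sub>v ?x) + A *\<^sub>v (?y + (z0 - z) \<cdot>\<^sub>v ?x) = v" using y(2) by simp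
    qed
  qed
  \<comment> \<open>Commuting the two resolvents puts the one at \<open>z0\<close> outermost, where
    the constant \<open>C\<close> is available.\<close>
  have comm: "resolvent A z *\<^sub>v (resolvent A z0 *\<^sub>v v) = resolvent A z0 *\<^sub>v (resolvent A z *\<^sub>v v)"
    if z: "z \<in> R" and v: "v \<in> carrier_vec N" for z v
  proof (rule resolvent_vec_unique[OF z])
    let ?y = "resolvent A z *\<^sub>v v" let ?x = "resolvent A z0 *\<^sub>v ?y"
    note y = resolvent_vec[OF z v] note x = resolvent_vec[OF z0R y(1)]
    note Q = resolvent_inverse[OF z0R]
    show "?x \<in> carrier_vec N" by (rule x(1))
    have Ay: "A *\<^sub>v ?y \<in> carrier_vec N" by (rule mult_mat_vec_carrier[OF A y(1)])
    have "resolvent A z0 *\<^sub>v (A *\<^sub>v ?y) = A *\<^sub>v ?x"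
    proof (rule resolvent_vec_unique[OF z0R mult_mat_vec_carrier[OF A x(1)]])
      have "z0 \<cdot>\<^sub>v (A *\<^sub>v ?x) + A *\<^sub>v (A *\<^sub>v ?x) = A *\<^sub>v (z0 \<cdot>\<^sub>v ?x + A *\<^sub>v ?x)"
        using mult_add_distrib_mat_vec[OF A _ mult_mat_vec_carrier[OF A x(1)], of "z0 \<cdot>\<^sub>v ?x"]
          mult_mat_vec[OF A x(1)] x(1) by simp
      thus "z0 \<cdot>\<^sub>v (A *\<^sub>v ?x) + A *\<^sub>v (A *\<^sub>v ?x) = A *\<^sub>v ?y" using x(2) by simp
    qed
    hence "z \<cdot>\<^sub>v ?x + A *\<^sub>v ?x = resolvent A z0 *\<^sub>v (z \<cdot>\<^sub>v ?y + A *\<^sub>v ?y)"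
      using mult_add_distrib_mat_vec[OF Q(1) _ Ay, of "z \<cdot>\<^sub>v ?y"] mult_mat_vec[OF Q(1) y(1)] y(1) by simp
    thus "z \<cdot>\<^sub>v ?x + A *\<^sub>v ?x = resolvent A z0 *\<^sub>v v" using y(2) by simp
  qed
  have sdiff: "s v z - s v z0 = (z0 - z) * s (resolvent A z0 *\<^sub>v v) z"
    if z: "z \<in> R" and v: "v \<in> carrier_vec N" for z v
  proof -
    have y: "resolvent A z0 *\<^sub>v v \<in> carrier_vec N" by (rule resolvent_vec(1)[OF z0R v])
    have x: "resolvent A z *\<^sub>v (resolvent A z0 *\<^sub>v v) \<in> carrier_vec N" by (rule resolvent_vec(1)[OF z y])
    have "\<psi> (resolvent A z *\<^sub>v v)
        = \<psi> (resolvent A z0 *\<^sub>v v + (z0 - z) \<cdot>\<^sub>v (resolvent A z *\<^sub>v (resolvent A z0 *\<^sub>v v)))"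
      by (rule arg_cong[OF diff[OF z v]])
    also have "\<dots> = \<psi> (resolvent A z0 *\<^sub>v v) + (z0 - z) * \<psi> (resolvent A z *\<^sub>v (resolvent A z0 *\<^sub>v v))"
      using \<psi>_add[OF y, of "(z0 - z) \<cdot>\<^sub>v (resolvent A z *\<^sub>v (resolvent A z0 *\<^sub>v v))"] \<psi>_smult[OF x] x by simp
    finally show ?thesis unfolding s_def by simp
  qed
  \<comment> \<open>Close to \<open>z0\<close> the perturbation term is at most half of the
    left-hand side and is absorbed, which doubles the constant.\<close>
  have bnd: "\<nu> (resolvent A z *\<^sub>v v) \<le> 2 * C * \<nu> v"
    if z: "z \<in> R" and v: "v \<in> carrier_vec N" and near: "cmod (z - z0) * C \<le> 1 / 2" for z v
  proof -
    let ?x = "resolvent A z *\<^sub>v v"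
    have x: "?x \<in> carrier_vec N" by (rule resolvent_vec(1)[OF z v])
    have "\<nu> ?x = \<nu> (resolvent A z0 *\<^sub>v v + (z0 - z) \<cdot>\<^sub>v (resolvent A z0 *\<^sub>v ?x))"
      using arg_cong[OF diff[OF z v], of \<nu>] comm[OF z v] by simp
    also have "\<dots> \<le> \<nu> (resolvent A z0 *\<^sub>v v) + cmod (z0 - z) * \<nu> (resolvent A z0 *\<^sub>v ?x)"
      using vec_norm_triangle[OF vec_norm resolvent_vec(1)[OF z0R v], of "(z0 - z) \<cdot>\<^sub>v (resolvent A z0 *\<^sub>v ?x)"]
        vec_norm_smult[OF vec_norm resolvent_vec(1)[OF z0R x]] resolvent_vec(1)[OF z0R x] by simp
    also have "\<dots> \<le> C * \<nu> v + cmod (z0 - z) * (C * \<nu> ?x)"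
      by (intro add_mono mult_left_mono C(2) v x) auto
    also have "\<dots> \<le> C * \<nu> v + (1 / 2) * \<nu> ?x"
      using mult_right_mono[OF near vec_norm_nonneg[OF vec_norm x]]
      by (simp add: norm_minus_commute algebra_simps)
    finally show ?thesis by simp
  qed
  let ?u = "resolvent A z0 *\<^sub>v w"
  have u: "?u \<in> carrier_vec N" by (rule resolvent_vec(1)[OF z0R w])
  have u2: "resolvent A z0 *\<^sub>v ?u \<in> carrier_vec N" by (rule resolvent_vec(1)[OF z0R u])
  have ev: "eventually (\<lambda>z. z \<in> R \<and> cmod (z - z0) * C \<le> 1 / 2 \<and> z \<noteq> z0) (at z0)"
  proof -
    have "eventually (\<lambda>z. z \<in> S) (at z0)" by (rule eventually_at_in_open'[OF S(1) z0])
    moreover have "eventually (\<lambda>z. dist z z0 < 1 / (2 * C)) (at z0)"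
      using C(1) by (auto simp: eventually_at intro!: exI[of _ "1 / (2 * C)"])
    moreover have "eventually (\<lambda>z. z \<noteq> z0) (at z0)" by (rule eventually_neq_at_within)
    ultimately show ?thesis
    proof eventually_elim
      case (elim z)
      have "cmod (z - z0) * C \<le> 1 / (2 * C) * C"
        by (rule mult_right_mono) (use elim C(1) in \<open>auto simp: dist_norm\<close>)
      thus ?case using elim S C(1) by auto
    qed
  qed
  have "((\<lambda>z. s ?u z - s ?u z0) \<longlongrightarrow> 0) (at z0)"
  proof (rule Lim_null_comparison)
    show "\<forall>\<^sub>F z in at z0. norm (s ?u z - s ?u z0) \<le> cmod (z0 - z) * (2 * C * \<nu> (resolvent A z0 *\<^sub>v ?u))"
      using ev
    proof eventually_elim
      case (elim z)
      have "cmod (s (resolvent A z0 *\<^sub>v ?u) z) \<le> \<nu> (resolvent A z *\<^sub>v (resolvent A z0 *\<^sub>v ?u))"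
        unfolding s_def by (rule \<psi>_bound[OF resolvent_vec(1)]) (use elim u2 in auto)
      also have "\<dots> \<le> 2 * C * \<nu> (resolvent A z0 *\<^sub>v ?u)" by (rule bnd) (use elim u2 in auto)
      finally show ?case using sdiff[of z ?u] elim u by (auto simp: norm_mult intro!: mult_left_mono)
    qed
    have "((\<lambda>z. cmod (z0 - z) * (2 * C * \<nu> (resolvent A z0 *\<^sub>v ?u)))
        \<longlongrightarrow> cmod (z0 - z0) * (2 * C * \<nu> (resolvent A z0 *\<^sub>v ?u))) (at z0)"
      by (intro tendsto_intros)
    thus "((\<lambda>z. cmod (z0 - z) * (2 * C * \<nu> (resolvent A z0 *\<^sub>v ?u))) \<longlongrightarrow> 0) (at z0)" by simp
  qed
  hence lim: "((\<lambda>z. - s ?u z) \<longlongrightarrow> - s ?u z0) (at z0)"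
    by (intro tendsto_minus) (simp add: LIM_zero_iff)
  have "((\<lambda>z. (s w z - s w z0) / (z - z0)) \<longlongrightarrow> - s ?u z0) (at z0)"
  proof (rule Lim_transform_eventually[OF lim])
    show "\<forall>\<^sub>F z in at z0. - s ?u z = (s w z - s w z0) / (z - z0)"
      using ev
    proof eventually_elim
      case (elim z)
      thus ?case using sdiff[of z w] w by (simp add: field_simps)
    qed
  qed
  thus ?thesis by (simp add: has_field_derivative_iff)
qed

lemma s_holomorphic:
  assumes S: "open S" "S \<subseteq> R" and w: "w \<in> carrier_vec N"
  shows "s w holomorphic_on S"
  unfolding holomorphic_on_open[OF S(1)] using s_has_field_derivative[OF S _ w] by auto

end

section \<open>The stability function\<close>

text \<open>With \<open>x = cmod w\<close>, the square of the right-hand side is at least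
  \<open>1 - 2 * \<kappa> * x + x\<^sup>2\<close>, which bounds
  \<open>(cmod (1 + w))\<^sup>2\<close> in the sector.\<close>

lemma cmod_one_plus_le:
  assumes "Re w \<le> - \<kappa> * cmod w" "0 \<le> \<kappa>" "\<kappa> \<le> 1"
  shows "cmod (1 + w) \<le> 1 - \<kappa> * cmod w + (cmod w)\<^sup>2 / 2"
proof (rule power2_le_imp_le)
  have "(1 - \<kappa> * cmod w + (cmod w)\<^sup>2 / 2) * 2 = (1 - cmod w)\<^sup>2 + (1 - \<kappa>) * 2 * cmod w + 1"
    by (simp add: power2_eq_square algebra_simps)
  moreover have "0 \<le> (1 - \<kappa>) * 2 * cmod w" using assms by (intro mult_nonneg_nonneg) auto
  ultimately show "0 \<le> 1 - \<kappa> * cmod w + (cmod w)\<^sup>2 / 2" by (smt (verit) zero_le_power2)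
  have "(cmod (1 + w))\<^sup>2 = 1 + 2 * Re w + (cmod w)\<^sup>2"
    unfolding cmod_power2 by (simp add: power2_eq_square algebra_simps)
  also have "\<dots> \<le> 1 + 2 * (- \<kappa> * cmod w + (cmod w)\<^sup>2 / 2)" using assms by simp
  also have "\<dots> \<le> 1 + 2 * (- \<kappa> * cmod w + (cmod w)\<^sup>2 / 2) + (- \<kappa> * cmod w + (cmod w)\<^sup>2 / 2)\<^sup>2" by simp
  also have "\<dots> = (1 - \<kappa> * cmod w + (cmod w)\<^sup>2 / 2)\<^sup>2" by (simp add: power2_eq_square algebra_simps)
  finally show "(cmod (1 + w))\<^sup>2 \<le> (1 - \<kappa> * cmod w + (cmod w)\<^sup>2 / 2)\<^sup>2" .
qed

text \<open>Consistency enters here: \<open>r w = 1 + w + o(w)\<close>. Of the gain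
  \<open>\<kappa> * cmod w\<close> in the modulus of \<open>1 + w\<close>, a quarter pays for the
  quadratic term and a quarter for the remainder.\<close>

lemma stability_near_zero:
  assumes der: "(r has_field_derivative 1) (at 0)" and r0: "r 0 = 1" and \<kappa>: "0 < \<kappa>" "\<kappa> \<le> 1"
  shows "\<exists>\<rho>>0. \<forall>w. cmod w \<le> \<rho> \<and> Re w \<le> - \<kappa> * cmod w \<longrightarrow> cmod (r w) \<le> 1 - \<kappa> / 2 * cmod w"
proof -
  have "(r has_derivative (*) 1) (at 0)" using der unfolding has_field_derivative_def .
  then obtain \<rho> where \<rho>: "0 < \<rho>" "\<And>w. cmod w < \<rho> \<Longrightarrow> cmod (r w - r 0 - w) \<le> \<kappa> / 4 * cmod w"
    using \<kappa>(1) unfolding has_derivative_at_alt by (auto dest!: spec[of _ "\<kappa> / 4"])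
  have "cmod (r w) \<le> 1 - \<kappa> / 2 * cmod w" if w: "cmod w \<le> min (\<rho> / 2) (\<kappa> / 2)" "Re w \<le> - \<kappa> * cmod w" for w
  proof -
    have "(cmod w)\<^sup>2 / 2 \<le> \<kappa> / 4 * cmod w"
      using mult_right_mono[of "cmod w" "\<kappa> / 2" "cmod w"] w(1) by (simp add: power2_eq_square)
    moreover have "cmod (r w - 1 - w) \<le> \<kappa> / 4 * cmod w" using \<rho>(2)[of w] \<rho>(1) w(1) r0 by simp
    moreover have "cmod (1 + w) \<le> 1 - \<kappa> * cmod w + (cmod w)\<^sup>2 / 2"
      using cmod_one_plus_le[OF w(2)] \<kappa> by simp
    moreover have "cmod (r w) \<le> cmod (1 + w) + cmod (r w - 1 - w)"
      using norm_triangle_ineq[of "1 + w" "r w - 1 - w"] by simp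
    ultimately show ?thesis by (simp add: algebra_simps)
  qed
  thus ?thesis using \<rho>(1) \<kappa>(1) by (intro exI[of _ "min (\<rho> / 2) (\<kappa> / 2)"]) auto
qed

text \<open>A value of modulus \<open>1\<close> inside the half-plane would be a maximum, so
  \<open>r\<close> would be constant of modulus \<open>1\<close> there. The decay far out on the
  negative real axis contradicts this.\<close>

lemma stability_strict:
  assumes hol: "r holomorphic_on {z. Re z < 0}"
    and le1: "\<And>z. Re z \<le> 0 \<Longrightarrow> cmod (r z) \<le> 1"
    and dec: "\<And>z. R\<^sub>0 \<le> cmod z \<Longrightarrow> cmod (r z) \<le> C / cmod z"
    and w: "Re w < 0"
  shows "cmod (r w) < 1"
proof (rule ccontr)
  assume "\<not> cmod (r w) < 1"
  hence w1: "cmod (r w) = 1" using le1[of w] w by simp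
  have op: "open {z. Re z < 0}" by (rule open_halfspace_Re_lt)
  have "r constant_on {z. Re z < 0}"
    by (rule maximum_modulus_principle[OF hol op _ op order_refl, of w])
       (use w w1 le1 in \<open>auto intro!: convex_connected convex_halfspace_Re_lt\<close>)
  then obtain a where a: "\<And>z. Re z < 0 \<Longrightarrow> r z = a" unfolding constant_on_def by auto
  define x where "x = \<bar>R\<^sub>0\<bar> + \<bar>C\<bar> + 1"
  have x: "0 < x" "R\<^sub>0 \<le> x" "C < x" unfolding x_def by auto
  have "cmod (r (- complex_of_real x)) \<le> C / x" using dec[of "- complex_of_real x"] x by simp
  hence "cmod a < 1" using a[of "- complex_of_real x"] x by (simp add: pos_le_divide_eq)
      (smt (verit) mult_less_cancel_right2 mult.commute)
  thus False using a[OF w] w1 by simp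
qed

text \<open>On the sector itself three regimes are glued: consistency near \<open>0\<close>, strict
  stability with compactness on an annulus, and the decay \<open>C / cmod z\<close> far out. The
  shift by \<open>\<delta>\<close> reaches points right of the sector, where
  \<open>cmod (r z)\<close> may exceed \<open>1\<close>; a Lipschitz estimate turns this excess into
  the factor \<open>1 + C\<^sub>2 * \<delta>\<close>.\<close>

lemma sector_stability_bound:
  assumes hol: "r holomorphic_on {z. Re z < \<delta>\<^sub>1}" and \<delta>\<^sub>1: "0 < \<delta>\<^sub>1"
    and der: "(r has_field_derivative 1) (at 0)" and r0: "r 0 = 1"
    and le1: "\<And>z. Re z \<le> 0 \<Longrightarrow> cmod (r z) \<le> 1"
    and C: "0 < C" and R\<^sub>0: "0 < R\<^sub>0" and dec: "\<And>z. R\<^sub>0 \<le> cmod z \<Longrightarrow> cmod (r z) \<le> C / cmod z"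
    and \<kappa>: "0 < \<kappa>" "\<kappa> \<le> 1"
  shows "\<exists>C\<^sub>2\<ge>0. \<exists>c\<^sub>2>0. \<forall>w \<delta>. Re w \<le> - \<kappa> * cmod w \<and> 0 \<le> \<delta> \<and> \<delta> \<le> \<delta>\<^sub>1 / 2 \<longrightarrow>
    cmod (r (w + complex_of_real \<delta>)) \<le> (1 + C\<^sub>2 * \<delta>) / (1 + c\<^sub>2 * cmod w)"
proof -
  define \<delta>\<^sub>0 where "\<delta>\<^sub>0 = \<delta>\<^sub>1 / 2"
  have \<delta>\<^sub>0: "0 < \<delta>\<^sub>0" "\<delta>\<^sub>0 < \<delta>\<^sub>1" using \<delta>\<^sub>1 unfolding \<delta>\<^sub>0_def by auto
  obtain \<rho> where \<rho>: "0 < \<rho>" "\<And>w. cmod w \<le> \<rho> \<Longrightarrow> Re w \<le> - \<kappa> * cmod w \<Longrightarrow> cmod (r w) \<le> 1 - \<kappa> / 2 * cmod w"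
    using stability_near_zero[OF der r0 \<kappa>] by auto
  \<comment> \<open>The terms \<open>2 * R\<^sub>0\<close> and \<open>2 * \<delta>\<^sub>0\<close>
    keep \<open>w + \<delta>\<close> within reach of the decay estimate for \<open>w\<close> outside
    the disc. The term \<open>4 * C\<close> makes the decayed value fall below the claimed
    fraction.\<close>
  define R\<^sub>1 where "R\<^sub>1 = 2 * R\<^sub>0 + 4 * C + 2 * \<delta>\<^sub>0"
  have R\<^sub>1: "0 < R\<^sub>1" "2 * R\<^sub>0 \<le> R\<^sub>1" "4 * C \<le> R\<^sub>1" "2 * \<delta>\<^sub>0 \<le> R\<^sub>1"
    using R\<^sub>0 C \<delta>\<^sub>0 unfolding R\<^sub>1_def by auto
  have contr: "continuous_on {z. Re z < \<delta>\<^sub>1} r" by (rule holomorphic_on_imp_continuous_on[OF hol])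
  have "\<exists>\<xi>>0. \<forall>w. \<rho> \<le> cmod w \<and> cmod w \<le> R\<^sub>1 \<and> Re w \<le> - \<kappa> * cmod w \<longrightarrow> cmod (r w) \<le> 1 - \<xi>"
  proof -
    define K where "K = {w. \<rho> \<le> cmod w \<and> cmod w \<le> R\<^sub>1 \<and> Re w \<le> - \<kappa> * cmod w}"
    have "closed K" unfolding K_def
      by (intro closed_Collect_conj closed_Collect_le continuous_intros)
    moreover have "bounded K" unfolding K_def by (rule boundedI[of _ R\<^sub>1]) auto
    ultimately have cK: "compact K" by (simp add: compact_eq_bounded_closed)
    have neg: "Re w < 0" if "w \<in> K" for w
    proof -
      have "0 < \<kappa> * cmod w" using that \<rho>(1) \<kappa>(1) unfolding K_def by (intro mult_pos_pos) auto
      thus ?thesis using that unfolding K_def by auto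
    qed
    show ?thesis
    proof (cases "K = {}")
      case True
      thus ?thesis unfolding K_def by (intro exI[of _ 1]) auto
    next
      case False
      have "continuous_on K (\<lambda>w. cmod (r w))"
        by (intro continuous_intros continuous_on_subset[OF contr]) (use neg \<delta>\<^sub>1 in force)
      from continuous_attains_sup[OF cK False this] obtain x where
        x: "x \<in> K" "\<And>w. w \<in> K \<Longrightarrow> cmod (r w) \<le> cmod (r x)" by auto
      have "cmod (r x) < 1"
        by (rule stability_strict[OF holomorphic_on_subset[OF hol] le1 dec neg[OF x(1)]]) (use \<delta>\<^sub>1 in auto)
      thus ?thesis using x(2) unfolding K_def by (intro exI[of _ "1 - cmod (r x)"]) auto
    qed
  qed
  then obtain \<xi> where \<xi>: "0 < \<xi>" "\<And>w. \<rho> \<le> cmod w \<Longrightarrow> cmod w \<le> R\<^sub>1 \<Longrightarrow> Re w \<le> - \<kappa> * cmod w \<Longrightarrow> cmod (r w) \<le> 1 - \<xi>"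
    by auto
  \<comment> \<open>One constraint for each regime, in the order near zero, annulus, far
    out.\<close>
  define c\<^sub>2 where "c\<^sub>2 = min (\<kappa> / 2) (min (\<xi> / R\<^sub>1) (1 / (4 * C)))"
  have c\<^sub>2: "0 < c\<^sub>2" "c\<^sub>2 \<le> \<kappa> / 2" "c\<^sub>2 \<le> \<xi> / R\<^sub>1" "c\<^sub>2 \<le> 1 / (4 * C)"
    using \<kappa> \<xi>(1) R\<^sub>1(1) C divide_pos_pos[OF \<xi>(1) R\<^sub>1(1)] unfolding c\<^sub>2_def
    by (auto simp: min_def)
  have one_minus: "1 - x \<le> 1 / (1 + x)" if "0 \<le> x" for x :: real
  proof -
    have "(1 - x) * (1 + x) \<le> 1" by (simp add: algebra_simps)
    thus ?thesis using that by (simp add: pos_le_divide_eq)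
  qed
  have inner: "cmod (r w) \<le> 1 / (1 + c\<^sub>2 * cmod w)" if w: "cmod w \<le> R\<^sub>1" "Re w \<le> - \<kappa> * cmod w" for w
  proof (cases "cmod w \<le> \<rho>")
    case True
    have "cmod (r w) \<le> 1 - c\<^sub>2 * cmod w"
      using \<rho>(2)[OF True w(2)] mult_right_mono[OF c\<^sub>2(2), of "cmod w"] by simp
    also have "\<dots> \<le> 1 / (1 + c\<^sub>2 * cmod w)" using c\<^sub>2(1) by (intro one_minus) auto
    finally show ?thesis .
  next
    case False
    have "c\<^sub>2 * cmod w \<le> \<xi> / R\<^sub>1 * R\<^sub>1" using c\<^sub>2 w(1) \<xi>(1) R\<^sub>1(1) by (intro mult_mono) auto
    hence "c\<^sub>2 * cmod w \<le> \<xi>" using R\<^sub>1(1) by simp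
    hence "cmod (r w) \<le> 1 - c\<^sub>2 * cmod w" using \<xi>(2)[of w] False w by simp
    also have "\<dots> \<le> 1 / (1 + c\<^sub>2 * cmod w)" using c\<^sub>2(1) by (intro one_minus) auto
    finally show ?thesis .
  qed
  \<comment> \<open>Contains both \<open>w\<close> and \<open>w + \<delta>\<close>, is convex as the
    mean value estimate requires, and lies in the domain of holomorphy because
    \<open>\<delta>\<^sub>0 < \<delta>\<^sub>1\<close>.\<close>
  define S where "S = cball 0 (R\<^sub>1 + \<delta>\<^sub>0) \<inter> {z. Re z \<le> \<delta>\<^sub>0}"
  have cS: "compact S" "convex S"
    unfolding S_def by (auto intro!: compact_Int_closed closed_halfspace_Re_le convex_Int convex_halfspace_Re_le)
  have op: "open {z. Re z < \<delta>\<^sub>1}" by (rule open_halfspace_Re_lt)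
  have Ssub: "S \<subseteq> {z. Re z < \<delta>\<^sub>1}" using \<delta>\<^sub>0 unfolding S_def by auto
  have "continuous_on S (deriv r)"
    by (rule continuous_on_subset[OF holomorphic_on_imp_continuous_on[OF holomorphic_deriv[OF hol op]] Ssub])
  from compact_imp_bounded[OF compact_continuous_image[OF this cS(1)]]
  obtain L where L: "0 < L" "\<And>z. z \<in> S \<Longrightarrow> cmod (deriv r z) \<le> L" unfolding bounded_pos by auto
  have lip: "cmod (r y - r x) \<le> L * cmod (y - x)" if "x \<in> S" "y \<in> S" for x y
  proof (rule field_differentiable_bound[OF cS(2) _ L(2) that(2,1)])
    fix z assume "z \<in> S"
    hence dz: "r field_differentiable at z"
      using holomorphic_on_imp_differentiable_at[OF hol op] Ssub by auto
    show "(r has_field_derivative deriv r z) (at z within S)"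
      by (rule has_field_derivative_at_within[OF field_differentiable_derivI[OF dz]])
  qed
  define C\<^sub>2 where "C\<^sub>2 = L * (1 + c\<^sub>2 * R\<^sub>1)"
  have C\<^sub>2: "0 \<le> C\<^sub>2" using L c\<^sub>2 R\<^sub>1 unfolding C\<^sub>2_def by simp
  have "cmod (r (w + complex_of_real \<delta>)) \<le> (1 + C\<^sub>2 * \<delta>) / (1 + c\<^sub>2 * cmod w)"
    if w: "Re w \<le> - \<kappa> * cmod w" and \<delta>: "0 \<le> \<delta>" "\<delta> \<le> \<delta>\<^sub>1 / 2" for w \<delta>
  proof (cases "cmod w \<le> R\<^sub>1")
    case True
    have "0 \<le> \<kappa> * cmod w" using \<kappa> by simp
    hence wneg: "Re w \<le> 0" using w by linarith
    have wS: "w \<in> S" using True wneg \<delta>\<^sub>0 unfolding S_def by auto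
    have "cmod (w + complex_of_real \<delta>) \<le> cmod w + \<delta>"
      using norm_triangle_ineq[of w "complex_of_real \<delta>"] \<delta> by simp
    hence wS': "w + complex_of_real \<delta> \<in> S" using True wneg \<delta> unfolding S_def \<delta>\<^sub>0_def by auto
    have "cmod (r (w + complex_of_real \<delta>)) \<le> cmod (r w) + L * \<delta>"
      using lip[OF wS wS'] norm_triangle_sub[of "r (w + complex_of_real \<delta>)" "r w"] \<delta>(1) by simp
    also have "\<dots> \<le> 1 / (1 + c\<^sub>2 * cmod w) + L * \<delta>" using inner[OF True w] by simp
    also have "\<dots> = (1 + L * (1 + c\<^sub>2 * cmod w) * \<delta>) / (1 + c\<^sub>2 * cmod w)"
    proof -
      have "0 < 1 + c\<^sub>2 * cmod w" using c\<^sub>2(1) by (intro add_pos_nonneg) auto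
      thus ?thesis by (simp add: field_simps)
    qed
    also have "\<dots> \<le> (1 + C\<^sub>2 * \<delta>) / (1 + c\<^sub>2 * cmod w)"
      unfolding C\<^sub>2_def using True L c\<^sub>2 \<delta>
      by (intro divide_right_mono add_mono mult_right_mono mult_left_mono) auto
    finally show ?thesis .
  next
    case False
    have w0: "0 < cmod w" using False R\<^sub>1(1) by linarith
    have "cmod w - \<delta> \<le> cmod (w + complex_of_real \<delta>)"
      using norm_diff_ineq[of w "complex_of_real \<delta>"] \<delta> by simp
    moreover have "\<delta> \<le> cmod w / 2" using False R\<^sub>1(4) \<delta>(2) unfolding \<delta>\<^sub>0_def by simp
    ultimately have half: "cmod w / 2 \<le> cmod (w + complex_of_real \<delta>)" by simp
    hence big: "R\<^sub>0 \<le> cmod (w + complex_of_real \<delta>)" using False R\<^sub>1(2) by simp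
    have "cmod (r (w + complex_of_real \<delta>)) \<le> C / cmod (w + complex_of_real \<delta>)" by (rule dec[OF big])
    also have "\<dots> \<le> C / (cmod w / 2)" using half w0 C by (intro divide_left_mono mult_pos_pos) auto
    also have "\<dots> \<le> 1 / (1 + c\<^sub>2 * cmod w)"
    proof -
      have "2 * C * (c\<^sub>2 * cmod w) \<le> cmod w / 2"
        using mult_right_mono[OF c\<^sub>2(4), of "2 * C * cmod w"] C w0 by (simp add: field_simps)
      hence "2 * C * (1 + c\<^sub>2 * cmod w) \<le> cmod w" using False R\<^sub>1(3) by (simp add: algebra_simps)
      moreover have "0 < 1 + c\<^sub>2 * cmod w" using c\<^sub>2(1) w0 by (intro add_pos_pos) auto
      ultimately show ?thesis using w0 by (simp add: field_simps)
    qed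
    also have "\<dots> \<le> (1 + C\<^sub>2 * \<delta>) / (1 + c\<^sub>2 * cmod w)"
      using C\<^sub>2 \<delta>(1) c\<^sub>2(1) w0 by (intro divide_right_mono) auto
    finally show ?thesis .
  qed
  thus ?thesis using C\<^sub>2 c\<^sub>2(1) by (intro exI[of _ C\<^sub>2] conjI exI[of _ c\<^sub>2]) auto
qed

lemma half_plane_bounded:
  assumes cont: "continuous_on {z. Re z \<le> \<delta>} f" and dec: "\<And>z. R\<^sub>0 \<le> cmod z \<Longrightarrow> cmod (f z) \<le> C / cmod z"
    and C: "0 < C" "0 < R\<^sub>0"
  shows "\<exists>B>0. \<forall>z. Re z \<le> \<delta> \<longrightarrow> cmod (f z) \<le> B"
proof -
  let ?S = "cball 0 R\<^sub>0 \<inter> {z. Re z \<le> \<delta>}"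
  have cS: "compact ?S" by (intro compact_Int_closed closed_halfspace_Re_le) auto
  have "continuous_on ?S f" by (rule continuous_on_subset[OF cont]) auto
  from compact_imp_bounded[OF compact_continuous_image[OF this cS]]
  obtain B where B: "0 < B" "\<And>z. z \<in> ?S \<Longrightarrow> cmod (f z) \<le> B" unfolding bounded_pos by auto
  have "cmod (f z) \<le> B + C / R\<^sub>0" if z: "Re z \<le> \<delta>" for z
  proof (cases "cmod z \<le> R\<^sub>0")
    case True
    have "0 \<le> C / R\<^sub>0" using C by simp
    thus ?thesis using B(2)[of z] z True by simp
  next
    case False
    have "cmod (f z) \<le> C / cmod z" using dec[of z] False by simp
    also have "\<dots> \<le> C / R\<^sub>0" using False C by (intro divide_left_mono mult_pos_pos) auto
    finally show ?thesis using B(1) by simp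
  qed
  thus ?thesis using B(1) C by (intro exI[of _ "B + C / R\<^sub>0"]) (auto intro!: add_pos_pos)
qed

text \<open>Cramer's rule: determinant and adjugate of a pencil linear in \<open>w\<close> are
  polynomial in \<open>w\<close>. It serves twice, for \<open>1 - z \<O>'\<close> in the finite
  plane and for \<open>w - \<O>'\<close> with \<open>w = 1 / z\<close> near infinity.\<close>

lemma pencil_inverse:
  assumes U: "U \<in> carrier_mat m m" and V: "V \<in> carrier_mat m m"
  obtains E a where "\<And>w. poly E w = det (U + w \<cdot>\<^sub>m V)"
    "\<And>w. poly E w \<noteq> 0 \<Longrightarrow> (U + w \<cdot>\<^sub>m V) * minv (U + w \<cdot>\<^sub>m V) = 1\<^sub>m m"
    "\<And>w. poly E w \<noteq> 0 \<Longrightarrow> minv (U + w \<cdot>\<^sub>m V) \<in> carrier_mat m m"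
    "\<And>w i j. poly E w \<noteq> 0 \<Longrightarrow> i < m \<Longrightarrow> j < m \<Longrightarrow>
      minv (U + w \<cdot>\<^sub>m V) $$ (i, j) = poly (a i j) w / poly E w"
proof -
  define PM where "PM = mat m m (\<lambda>(i, j). [:U $$ (i, j), V $$ (i, j):])"
  have PM: "PM \<in> carrier_mat m m" unfolding PM_def by simp
  have S: "U + w \<cdot>\<^sub>m V \<in> carrier_mat m m" for w using U V by simp
  have ent: "poly (PM $$ (i, j)) w = (U + w \<cdot>\<^sub>m V) $$ (i, j)" if "i < m" "j < m" for i j w
    using that U V unfolding PM_def by simp
  have detE: "poly (det PM) w = det (U + w \<cdot>\<^sub>m V)" for w
    by (rule poly_det_cong[OF S PM]) (use ent in auto)
  have adj: "poly (adj_mat PM $$ (i, j)) w = adj_mat (U + w \<cdot>\<^sub>m V) $$ (i, j)" if ij: "i < m" "j < m" for i j w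
  proof -
    have "poly (det (mat_delete PM j i)) w = det (mat_delete (U + w \<cdot>\<^sub>m V) j i)"
    proof (rule poly_det_cong)
      show "mat_delete (U + w \<cdot>\<^sub>m V) j i \<in> carrier_mat (m - 1) (m - 1)"
        "mat_delete PM j i \<in> carrier_mat (m - 1) (m - 1)"
        by (rule mat_delete_carrier[OF S], rule mat_delete_carrier[OF PM])
      fix i' j' assume "i' < m - 1" "j' < m - 1"
      thus "poly (mat_delete PM j i $$ (i', j')) w = mat_delete (U + w \<cdot>\<^sub>m V) j i $$ (i', j')"
        using ij U V unfolding mat_delete_def PM_def by auto
    qed
    thus ?thesis using ij U V PM unfolding adj_mat_def cofactor_def by (simp add: poly_power)
  qed
  have "(U + w \<cdot>\<^sub>m V) * minv (U + w \<cdot>\<^sub>m V) = 1\<^sub>m m \<and> minv (U + w \<cdot>\<^sub>m V) \<in> carrier_mat m m \<and>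
    (\<forall>i<m. \<forall>j<m. minv (U + w \<cdot>\<^sub>m V) $$ (i, j) = poly (adj_mat PM $$ (i, j)) w / poly (det PM) w)"
    if nz: "poly (det PM) w \<noteq> 0" for w
  proof -
    let ?S = "U + w \<cdot>\<^sub>m V" and ?k = "1 / poly (det PM) w"
    note aS = adj_mat[OF S[of w]]
    have 1: "?S * (?k \<cdot>\<^sub>m adj_mat ?S) = 1\<^sub>m m"
      using mult_smult_distrib[OF S aS(1), of w ?k] aS(2) detE[of w] nz by (auto intro!: eq_matI)
    have 2: "minv ?S = ?k \<cdot>\<^sub>m adj_mat ?S" by (rule minv_eqI[OF S _ 1]) (use aS(1) in simp)
    have "minv ?S $$ (i, j) = poly (adj_mat PM $$ (i, j)) w / poly (det PM) w" if "i < m" "j < m" for i j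
      unfolding 2 using adj[OF that, of w] aS(1) that by simp
    thus ?thesis using 1 aS(1) unfolding 2 by simp
  qed
  thus ?thesis using that[of "det PM" "\<lambda>i j. adj_mat PM $$ (i, j)"] detE by simp
qed

locale runge_kutta =
  fixes m :: nat and \<O> :: "real mat" and b :: "real vec"
  assumes \<O>: "\<O> \<in> carrier_mat m m" and b: "b \<in> carrier_vec m"
    and ev: "\<And>z. eigenvalue (map_mat complex_of_real \<O>) z \<Longrightarrow> 0 < Re z"
    and L: "L_stable (rk_r \<O> b)"
    and der: "(rk_r \<O> b has_field_derivative 1) (at 0)"
begin

abbreviation \<O>' :: "complex mat" where "\<O>' \<equiv> map_mat complex_of_real \<O>"

lemma \<O>': "\<O>' \<in> carrier_mat m m" using \<O> by simp

lemma rk_q_sum: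
  assumes "minv (1\<^sub>m m - z \<cdot>\<^sub>m \<O>') \<in> carrier_mat m m" "j < m"
  shows "rk_q \<O> b j z = (\<Sum>i<m. complex_of_real (b $ i) * minv (1\<^sub>m m - z \<cdot>\<^sub>m \<O>') $$ (i, j))"
  using assms b \<O> unfolding rk_q_def Let_def
  by (auto simp: scalar_prod_def lessThan_atLeast0 mat_of_row_def intro!: sum.cong)

lemma rk_r_sum:
  assumes "minv (1\<^sub>m m - z \<cdot>\<^sub>m \<O>') \<in> carrier_mat m m"
  shows "rk_r \<O> b z = 1 + z * (\<Sum>j<m. rk_q \<O> b j z)"
proof -
  let ?I = "minv (1\<^sub>m m - z \<cdot>\<^sub>m \<O>')"
  have "scalar_prod (map_vec complex_of_real b) (?I *\<^sub>v Matrix.vec m (\<lambda>_. 1))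
      = (\<Sum>i<m. complex_of_real (b $ i) * (\<Sum>j<m. ?I $$ (i, j)))"
    using assms b by (auto simp: scalar_prod_def lessThan_atLeast0 intro!: sum.cong)
  also have "\<dots> = (\<Sum>i<m. \<Sum>j<m. complex_of_real (b $ i) * ?I $$ (i, j))" by (simp add: sum_distrib_left)
  also have "\<dots> = (\<Sum>j<m. \<Sum>i<m. complex_of_real (b $ i) * ?I $$ (i, j))" by (rule sum.swap)
  also have "\<dots> = (\<Sum>j<m. rk_q \<O> b j z)" using rk_q_sum[OF assms] by simp
  finally show ?thesis using \<O> unfolding rk_r_def Let_def by simp
qed

text \<open>The common denominator is \<open>det (1 - z \<O>')\<close>. Its zeros are reciprocals of
  eigenvalues, and the inversion \<open>z \<mapsto> 1 / z\<close> preserves the right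
  half-plane.\<close>

lemma rk_rational:
  "\<exists>D P Q. D \<noteq> 0 \<and> (\<forall>z. poly D z = 0 \<longrightarrow> 0 < Re z) \<and>
    (\<forall>z. poly D z \<noteq> 0 \<longrightarrow> rk_r \<O> b z = poly P z / poly D z \<and>
      (\<forall>j<m. rk_q \<O> b j z = poly (Q j) z / poly D z) \<and>
      minv (1\<^sub>m m - z \<cdot>\<^sub>m \<O>') \<in> carrier_mat m m)"
proof -
  have sh: "1\<^sub>m m + z \<cdot>\<^sub>m (- \<O>') = 1\<^sub>m m - z \<cdot>\<^sub>m \<O>'" for z using \<O>' by (intro eq_matI) auto
  obtain D a where D: "\<And>z. poly D z = det (1\<^sub>m m - z \<cdot>\<^sub>m \<O>')"
    "\<And>z. poly D z \<noteq> 0 \<Longrightarrow> (1\<^sub>m m - z \<cdot>\<^sub>m \<O>') * minv (1\<^sub>m m - z \<cdot>\<^sub>m \<O>') = 1\<^sub>m m"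
    "\<And>z. poly D z \<noteq> 0 \<Longrightarrow> minv (1\<^sub>m m - z \<cdot>\<^sub>m \<O>') \<in> carrier_mat m m"
    "\<And>z i j. poly D z \<noteq> 0 \<Longrightarrow> i < m \<Longrightarrow> j < m \<Longrightarrow> minv (1\<^sub>m m - z \<cdot>\<^sub>m \<O>') $$ (i, j) = poly (a i j) z / poly D z"
    by (rule pencil_inverse[OF one_carrier_mat uminus_carrier_mat[OF \<O>'], unfolded sh, OF that])
  define Q where "Q j = (\<Sum>i<m. Polynomial.smult (complex_of_real (b $ i)) (a i j))" for j
  define P where "P = D + pCons 0 (\<Sum>j<m. Q j)"
  have D0: "D \<noteq> 0"
  proof
    assume "D = 0"
    hence "det (1\<^sub>m m - 0 \<cdot>\<^sub>m \<O>') = 0" using D(1)[of 0] by simp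
    moreover have "1\<^sub>m m - 0 \<cdot>\<^sub>m \<O>' = 1\<^sub>m m" using \<O>' by auto
    ultimately show False by simp
  qed
  have pos: "0 < Re z" if z: "poly D z = 0" for z
  proof -
    have c: "1\<^sub>m m - z \<cdot>\<^sub>m \<O>' \<in> carrier_mat m m" by (rule minus_carrier_mat[OF smult_carrier_mat[OF \<O>']])
    have "det (1\<^sub>m m - z \<cdot>\<^sub>m \<O>') = 0" using D(1) z by simp
    then obtain v where v: "v \<in> carrier_vec m" "v \<noteq> 0\<^sub>v m" "(1\<^sub>m m - z \<cdot>\<^sub>m \<O>') *\<^sub>v v = 0\<^sub>v m"
      using det_0_iff_vec_prod_zero_field[OF c] by auto
    have Ov: "\<O>' *\<^sub>v v \<in> carrier_vec m" by (rule mult_mat_vec_carrier[OF \<O>' v(1)])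
    have "(1\<^sub>m m - z \<cdot>\<^sub>m \<O>') *\<^sub>v v = v - z \<cdot>\<^sub>v (\<O>' *\<^sub>v v)"
      using minus_mult_distrib_mat_vec[OF one_carrier_mat smult_carrier_mat[OF \<O>'] v(1)]
        smult_mult_mat_vec[OF \<O>' v(1)] v(1) by simp
    hence eq: "v - z \<cdot>\<^sub>v (\<O>' *\<^sub>v v) = 0\<^sub>v m" using v(3) by simp
    have zi: "v $ i = z * (\<O>' *\<^sub>v v) $ i" if "i < m" for i
    proof -
      have "(v - z \<cdot>\<^sub>v (\<O>' *\<^sub>v v)) $ i = 0" using eq that by simp
      moreover have "(v - z \<cdot>\<^sub>v (\<O>' *\<^sub>v v)) $ i = v $ i - z * (\<O>' *\<^sub>v v) $ i"
        using that carrier_vecD[OF Ov] by (simp del: index_mult_mat_vec dim_mult_mat_vec)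
      ultimately show ?thesis by simp
    qed
    have z0: "z \<noteq> 0"
    proof
      assume "z = 0"
      hence "v = 0\<^sub>v m" using zi v(1) by (intro eq_vecI) auto
      thus False using v(2) by simp
    qed
    have "\<O>' *\<^sub>v v = (1 / z) \<cdot>\<^sub>v v"
    proof (rule eq_vecI)
      fix i assume "i < dim_vec ((1 / z) \<cdot>\<^sub>v v)"
      hence "i < m" using v(1) by simp
      thus "(\<O>' *\<^sub>v v) $ i = ((1 / z) \<cdot>\<^sub>v v) $ i"
        using zi[of i] z0 v(1) by simp
    qed (use v(1) \<O> in simp)
    hence "eigenvalue \<O>' (1 / z)"
      unfolding eigenvalue_def eigenvector_def using v \<O> by (intro exI[of _ v]) auto
    hence "0 < Re (1 / z)" by (rule ev)
    moreover have "Re (1 / z) = Re z / (cmod z)\<^sup>2" by (simp add: Re_divide cmod_power2)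
    ultimately show ?thesis using z0 by (simp add: zero_less_divide_iff)
  qed
  have q: "rk_q \<O> b j z = poly (Q j) z / poly D z" if "poly D z \<noteq> 0" "j < m" for j z
    unfolding rk_q_sum[OF D(3)[OF that(1)] that(2)] Q_def poly_sum
    using D(4)[OF that(1)] that by (simp add: sum_divide_distrib)
  have r: "rk_r \<O> b z = poly P z / poly D z" if nz: "poly D z \<noteq> 0" for z
  proof -
    have "(\<Sum>j<m. rk_q \<O> b j z) = (\<Sum>j<m. poly (Q j) z) / poly D z"
      using q[OF nz] by (simp add: sum_divide_distrib)
    thus ?thesis unfolding rk_r_sum[OF D(3)[OF nz]] P_def using nz by (simp add: poly_sum field_simps)
  qed
  show ?thesis using D0 pos q r D(3) by (intro exI[of _ D] exI[of _ P] exI[of _ Q]) auto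
qed

end

context runge_kutta
begin

text \<open>Without stages \<open>r\<close> would be constantly \<open>1\<close>, against
  \<open>r(\<infinity>) = 0\<close>. The maximum in \<open>tuple_norm\<close> is thus over a
  nonempty set.\<close>

lemma m_pos: "0 < m"
proof (rule ccontr)
  assume "\<not> 0 < m"
  hence "rk_r \<O> b = (\<lambda>z. 1)" using \<O> b by (intro ext) (simp add: rk_r_def scalar_prod_def)
  hence "((\<lambda>z :: complex. 1 :: complex) \<longlongrightarrow> 0) at_infinity" using L unfolding L_stable_def by simp
  from tendsto_unique[OF trivial_limit_at_infinity tendsto_const this] show False by simp
qed

text \<open>With \<open>w = 1 / z\<close> one has \<open>1 - z \<O>' = z (w - \<O>')\<close>, and
  \<open>w - \<O>'\<close> is invertible at \<open>w = 0\<close> because \<open>0\<close> is no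
  eigenvalue. So \<open>q\<close> is \<open>w\<close> times a function regular at
  \<open>w = 0\<close>, while \<open>r\<close> is regular there and vanishes by L-stability.\<close>

lemma rk_at_infinity:
  "\<exists>C>0. \<exists>R\<^sub>0>0. \<forall>z. R\<^sub>0 \<le> cmod z \<longrightarrow> cmod (rk_r \<O> b z) \<le> C / cmod z \<and>
    (\<forall>j<m. cmod (rk_q \<O> b j z) \<le> C / cmod z)"
proof -
  have sh: "- \<O>' + w \<cdot>\<^sub>m 1\<^sub>m m = w \<cdot>\<^sub>m 1\<^sub>m m - \<O>'" for w using \<O>' by (intro eq_matI) auto
  obtain E a where E: "\<And>w. poly E w = det (w \<cdot>\<^sub>m 1\<^sub>m m - \<O>')"
    "\<And>w. poly E w \<noteq> 0 \<Longrightarrow> (w \<cdot>\<^sub>m 1\<^sub>m m - \<O>') * minv (w \<cdot>\<^sub>m 1\<^sub>m m - \<O>') = 1\<^sub>m m"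
    "\<And>w. poly E w \<noteq> 0 \<Longrightarrow> minv (w \<cdot>\<^sub>m 1\<^sub>m m - \<O>') \<in> carrier_mat m m"
    "\<And>w i j. poly E w \<noteq> 0 \<Longrightarrow> i < m \<Longrightarrow> j < m \<Longrightarrow> minv (w \<cdot>\<^sub>m 1\<^sub>m m - \<O>') $$ (i, j) = poly (a i j) w / poly E w"
    by (rule pencil_inverse[OF uminus_carrier_mat[OF \<O>'] one_carrier_mat, unfolded sh, OF that])
  have E0: "poly E 0 \<noteq> 0"
  proof
    assume "poly E 0 = 0"
    moreover have "0 \<cdot>\<^sub>m 1\<^sub>m m - \<O>' = - \<O>'" using \<O>' by (intro eq_matI) auto
    ultimately have "det (- \<O>') = 0" using E(1)[of 0] by simp
    then obtain v where v: "v \<in> carrier_vec m" "v \<noteq> 0\<^sub>v m" "(- \<O>') *\<^sub>v v = 0\<^sub>v m"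
      using det_0_iff_vec_prod_zero_field[OF uminus_carrier_mat[OF \<O>']] by auto
    have "- (\<O>' *\<^sub>v v) = 0\<^sub>v m" using v \<O>' by simp
    hence "\<O>' *\<^sub>v v = 0\<^sub>v m" using mult_mat_vec_carrier[OF \<O>' v(1)] by (metis uminus_uminus_vec uminus_zero_vec_eq)
    hence "eigenvalue \<O>' 0"
      unfolding eigenvalue_def eigenvector_def using v \<O> by (intro exI[of _ v]) auto
    from ev[OF this] show False by simp
  qed
  define Q where "Q j = (\<Sum>i<m. Polynomial.smult (complex_of_real (b $ i)) (a i j))" for j
  define \<rho> where "\<rho> w = 1 + (\<Sum>j<m. poly (Q j) w / poly E w)" for w
  have main: "rk_q \<O> b j z = (1 / z) * (poly (Q j) (1 / z) / poly E (1 / z))" "rk_r \<O> b z = \<rho> (1 / z)"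
    if z: "z \<noteq> 0" and nz: "poly E (1 / z) \<noteq> 0" and j: "j < m" for z j
  proof -
    let ?S = "(1 / z) \<cdot>\<^sub>m 1\<^sub>m m - \<O>'"
    let ?I = "minv ?S"
    have S: "?S \<in> carrier_mat m m" and M: "1\<^sub>m m - z \<cdot>\<^sub>m \<O>' \<in> carrier_mat m m" using \<O>' by auto
    have I: "?I \<in> carrier_mat m m" by (rule E(3)[OF nz])
    have Meq: "1\<^sub>m m - z \<cdot>\<^sub>m \<O>' = z \<cdot>\<^sub>m ?S" using z \<O>' by (intro eq_matI) (auto simp: algebra_simps)
    have "(z \<cdot>\<^sub>m ?S) * ((1 / z) \<cdot>\<^sub>m ?I) = (1 / z) \<cdot>\<^sub>m ((z \<cdot>\<^sub>m ?S) * ?I)"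
      by (rule mult_smult_distrib[OF smult_carrier_mat[OF S] I])
    also have "(z \<cdot>\<^sub>m ?S) * ?I = z \<cdot>\<^sub>m 1\<^sub>m m" using mult_smult_assoc_mat[OF S I] E(2)[OF nz] by simp
    also have "(1 / z) \<cdot>\<^sub>m (z \<cdot>\<^sub>m 1\<^sub>m m) = 1\<^sub>m m" using z by (intro eq_matI) auto
    finally have "minv (1\<^sub>m m - z \<cdot>\<^sub>m \<O>') = (1 / z) \<cdot>\<^sub>m ?I"
      unfolding Meq by (intro minv_eqI[of _ m]) (use S I in auto)
    note Mi = this
    have Mc: "minv (1\<^sub>m m - z \<cdot>\<^sub>m \<O>') \<in> carrier_mat m m" unfolding Mi using I by simp
    have q: "rk_q \<O> b j z = (1 / z) * (poly (Q j) (1 / z) / poly E (1 / z))" if "j < m" for j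
      unfolding rk_q_sum[OF Mc that] Mi Q_def poly_sum
      using E(4)[OF nz _ that] I that by (simp add: sum_divide_distrib sum_distrib_left mult.commute mult.left_commute)
    show "rk_q \<O> b j z = (1 / z) * (poly (Q j) (1 / z) / poly E (1 / z))" by (rule q[OF j])
    show "rk_r \<O> b z = \<rho> (1 / z)"
      unfolding rk_r_sum[OF Mc] \<rho>_def using q z by (simp add: sum_distrib_left)
  qed
  have lim_inv: "((\<lambda>w. 1 / w) \<longlongrightarrow> 0) (at_infinity :: complex filter)"
  proof -
    have "(\<lambda>w :: complex. 1 / w) = inverse" by (auto simp: inverse_eq_divide)
    thus ?thesis using tendsto_inverse_0 by metis
  qed
  have contE: "isCont (poly E) 0" and contQ: "isCont (\<lambda>w. poly (Q j) w / poly E w) 0" for j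
    using E0 by (auto intro!: continuous_intros)
  have evE: "\<forall>\<^sub>F z in at_infinity. poly E (1 / z) \<noteq> 0"
  proof -
    have "((\<lambda>z. poly E (1 / z)) \<longlongrightarrow> poly E 0) at_infinity" by (rule isCont_tendsto_compose[OF contE lim_inv])
    thus ?thesis using E0 by (rule tendsto_imp_eventually_ne)
  qed
  have evz: "\<forall>\<^sub>F z in at_infinity. (z :: complex) \<noteq> 0" by (rule eventually_not_equal_at_infinity)
  define B where "B j = cmod (poly (Q j) 0 / poly E 0) + 1" for j
  have evQ: "\<forall>\<^sub>F z in at_infinity. cmod (rk_q \<O> b j z) \<le> B j / cmod z" if j: "j < m" for j
  proof -
    have "((\<lambda>z. cmod (poly (Q j) (1 / z) / poly E (1 / z))) \<longlongrightarrow> cmod (poly (Q j) 0 / poly E 0)) at_infinity"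
      by (intro tendsto_norm isCont_tendsto_compose[OF contQ lim_inv])
    hence "\<forall>\<^sub>F z in at_infinity. cmod (poly (Q j) (1 / z) / poly E (1 / z)) < B j"
      by (rule order_tendstoD(2)) (simp add: B_def)
    with evE evz show ?thesis
    proof eventually_elim
      case (elim z)
      show ?case unfolding main(1)[OF elim(2,1) j] using divide_right_mono[OF less_imp_le[OF elim(3)], of "cmod z"]
        by (simp add: norm_mult norm_divide mult.commute)
    qed
  qed
  have derE: "(\<lambda>w. poly (Q j) w / poly E w) field_differentiable (at 0)" for j
  proof -
    have "poly p field_differentiable (at 0)" for p :: "complex poly"
      unfolding field_differentiable_def by (rule exI, rule poly_DERIV)
    thus ?thesis using E0 by (intro field_differentiable_divide)
  qed
  have "\<rho> field_differentiable (at 0)"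
    unfolding \<rho>_def by (intro field_differentiable_add field_differentiable_const field_differentiable_sum derE)
  then obtain \<rho>' where \<rho>': "(\<rho> has_field_derivative \<rho>') (at 0)" unfolding field_differentiable_def by auto
  have \<rho>0: "\<rho> 0 = 0"
  proof -
    have "((\<lambda>z. \<rho> (1 / z)) \<longlongrightarrow> \<rho> 0) at_infinity"
      by (rule isCont_tendsto_compose[OF DERIV_isCont[OF \<rho>'] lim_inv])
    moreover have "\<forall>\<^sub>F z in at_infinity. \<rho> (1 / z) = rk_r \<O> b z"
      using evE evz
    proof eventually_elim
      case (elim z)
      show ?case by (rule main(2)[OF elim(2,1) m_pos, symmetric])
    qed
    ultimately have 1: "(rk_r \<O> b \<longlongrightarrow> \<rho> 0) at_infinity" by (rule Lim_transform_eventually)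
    have 2: "(rk_r \<O> b \<longlongrightarrow> 0) at_infinity" using L unfolding L_stable_def by simp
    show ?thesis by (rule tendsto_unique[OF trivial_limit_at_infinity 1 2])
  qed
  have evR: "\<forall>\<^sub>F z in at_infinity. cmod (rk_r \<O> b z) \<le> (cmod \<rho>' + 1) / cmod z"
  proof -
    have "(\<lambda>w. \<rho> w / w) \<midarrow>0\<rightarrow> \<rho>'" using \<rho>' \<rho>0 by (simp add: has_field_derivative_iff)
    moreover have "filterlim (\<lambda>z. 1 / z) (at 0) (at_infinity :: complex filter)"
      using evz by (intro filterlim_atI[OF lim_inv]) simp
    ultimately have "((\<lambda>z. \<rho> (1 / z) / (1 / z)) \<longlongrightarrow> \<rho>') at_infinity" by (rule filterlim_compose)
    from tendsto_norm[OF this] have "\<forall>\<^sub>F z in at_infinity. cmod (\<rho> (1 / z) / (1 / z)) < cmod \<rho>' + 1"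
      by (rule order_tendstoD(2)) simp
    with evE evz show ?thesis
    proof eventually_elim
      case (elim z)
      show ?case unfolding main(2)[OF elim(2,1) m_pos] using elim(2,3) by (simp add: norm_mult field_simps)
    qed
  qed
  define C where "C = cmod \<rho>' + 1 + (\<Sum>j<m. B j)"
  have B0: "0 \<le> B j" for j unfolding B_def by simp
  have C: "0 < C" "cmod \<rho>' + 1 \<le> C" unfolding C_def using sum_nonneg[of "{..<m}" B] B0
    by (auto intro!: add_pos_nonneg[of "cmod \<rho>' + 1"] add_nonneg_pos[of "cmod \<rho>'"])
  have BC: "B j \<le> C" if "j < m" for j
  proof -
    have "B j \<le> (\<Sum>j<m. B j)" by (rule member_le_sum) (use that B0 in auto)
    thus ?thesis unfolding C_def by (simp add: add_increasing)
  qed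
  have "\<forall>\<^sub>F z in at_infinity. \<forall>j\<in>{..<m}. cmod (rk_q \<O> b j z) \<le> B j / cmod z"
    by (rule eventually_ball_finite) (use evQ in auto)
  with evR have "\<forall>\<^sub>F z in at_infinity. cmod (rk_r \<O> b z) \<le> C / cmod z \<and> (\<forall>j<m. cmod (rk_q \<O> b j z) \<le> C / cmod z)"
  proof eventually_elim
    case (elim z)
    have "x / cmod z \<le> C / cmod z" if "x \<le> C" for x using that by (intro divide_right_mono) auto
    thus ?case using elim C(2) BC by (meson lessThan_iff order_trans)
  qed
  then obtain R where R: "\<And>z. R \<le> cmod z \<Longrightarrow> cmod (rk_r \<O> b z) \<le> C / cmod z \<and> (\<forall>j<m. cmod (rk_q \<O> b j z) \<le> C / cmod z)"
    unfolding eventually_at_infinity by auto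
  show ?thesis using C(1) R by (intro exI[of _ C] conjI exI[of _ "max R 1"]) auto
qed

end

section \<open>The trapezoidal rule\<close>

lemma has_contour_integral_horizontal:
  assumes "a < b"
  shows "(f has_contour_integral I) (linepath (Complex a y) (Complex b y)) \<longleftrightarrow>
    ((\<lambda>x. f (Complex x y)) has_integral I) {a..b}"
proof -
  have "linepath (Complex a y) (Complex b y) x = linepath (complex_of_real a) (complex_of_real b) x + Complex 0 y" for x
    by (auto simp: linepath_def complex_eq_iff algebra_simps)
  moreover have "Complex b y - Complex a y = complex_of_real b - complex_of_real a"
    by (simp add: complex_eq_iff)
  ultimately have "(f has_contour_integral I) (linepath (Complex a y) (Complex b y)) \<longleftrightarrow>
      ((\<lambda>z. f (z + Complex 0 y)) has_contour_integral I) (linepath (complex_of_real a) (complex_of_real b))"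
    unfolding has_contour_integral_linepath by simp
  also have "\<dots> \<longleftrightarrow> ((\<lambda>x. f (complex_of_real x + Complex 0 y)) has_integral I) {a..b}"
    using assms by (subst has_contour_integral_linepath_Reals_iff) auto
  also have "(\<lambda>x. f (complex_of_real x + Complex 0 y)) = (\<lambda>x. f (Complex x y))"
    by (intro ext arg_cong[of _ _ f]) (simp add: complex_eq_iff)
  finally show ?thesis .
qed

lemma horizontal_tail_bound:
  assumes cont: "continuous_on (closed_segment (Complex a y) (Complex b y)) f" and ab: "a < b"
    and g: "(g has_integral J) {a..b}"
    and le: "\<And>x. a \<le> x \<Longrightarrow> x \<le> b \<Longrightarrow> cmod (f (Complex x y)) \<le> g x"
  shows "cmod (contour_integral (linepath (Complex a y) (Complex b y)) f) \<le> J"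
proof -
  have "(f has_contour_integral contour_integral (linepath (Complex a y) (Complex b y)) f) (linepath (Complex a y) (Complex b y))"
    by (rule has_contour_integral_integral[OF contour_integrable_continuous_linepath[OF cont]])
  hence I: "((\<lambda>x. f (Complex x y)) has_integral contour_integral (linepath (Complex a y) (Complex b y)) f) {a..b}"
    using has_contour_integral_horizontal[OF ab] by simp
  have "cmod (integral {a..b} (\<lambda>x. f (Complex x y))) \<le> integral {a..b} g"
    by (rule integral_norm_bound_integral) (use I g le in \<open>auto simp: integrable_on_def\<close>)
  thus ?thesis using integral_unique[OF I] integral_unique[OF g] by simp
qed

lemma exp_neg_has_integral:
  assumes "a \<le> (b :: real)"
  shows "((\<lambda>x. exp (- x)) has_integral (exp (- a) - exp (- b))) {a..b}"
proof -
  have "((\<lambda>x. exp (- x)) has_integral (- exp (- b) - (- exp (- a)))) {a..b}"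
    by (rule fundamental_theorem_of_calculus[OF assms])
       (auto intro!: derivative_eq_intros simp: has_real_derivative_iff_has_vector_derivative[symmetric])
  thus ?thesis by simp
qed

lemma exp_has_integral:
  assumes "a \<le> (b :: real)"
  shows "((\<lambda>x. exp x) has_integral (exp b - exp a)) {a..b}"
  by (rule fundamental_theorem_of_calculus[OF assms])
     (auto intro!: derivative_eq_intros simp: has_real_derivative_iff_has_vector_derivative[symmetric])

text \<open>Its zeros are exactly the nodes \<open>k * \<tau>\<close>, all simple with derivative
  \<open>2 * pi * \<i> / \<tau>\<close>. Dividing by it therefore produces the terms of the
  trapezoidal sum as residues.\<close>

definition trap_kernel :: "real \<Rightarrow> complex \<Rightarrow> complex" where
  "trap_kernel \<tau> z = 1 - exp (- (2 * complex_of_real pi * \<i> / complex_of_real \<tau>) * z)"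

lemma trap_kernel_eq_0:
  assumes "0 < \<tau>"
  shows "trap_kernel \<tau> z = 0 \<longleftrightarrow> (\<exists>k::int. z = complex_of_real (of_int k * \<tau>))"
proof -
  have "trap_kernel \<tau> z = 0 \<longleftrightarrow> exp ((2 * complex_of_real pi * \<i> / complex_of_real \<tau>) * z) = 1"
    unfolding trap_kernel_def by (simp add: exp_minus)
  also have "\<dots> \<longleftrightarrow> (\<exists>k::int. z = complex_of_real (of_int k * \<tau>))"
  proof
    assume "exp ((2 * complex_of_real pi * \<i> / complex_of_real \<tau>) * z) = 1"
    then obtain n :: int where n: "Re ((2 * complex_of_real pi * \<i> / complex_of_real \<tau>) * z) = 0"
      "Im ((2 * complex_of_real pi * \<i> / complex_of_real \<tau>) * z) = of_int (2 * n) * pi"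
      unfolding exp_eq_1 by auto
    have "Im z = 0" "Re z = of_int n * \<tau>" using n assms by (auto simp: field_simps)
    thus "\<exists>k::int. z = complex_of_real (of_int k * \<tau>)" by (intro exI[of _ n]) (simp add: complex_eq_iff)
  next
    assume "\<exists>k::int. z = complex_of_real (of_int k * \<tau>)"
    then obtain k :: int where "z = complex_of_real (of_int k * \<tau>)" by auto
    hence "(2 * complex_of_real pi * \<i> / complex_of_real \<tau>) * z = complex_of_real (2 * of_int k * pi) * \<i>"
      using assms by simp
    thus "exp ((2 * complex_of_real pi * \<i> / complex_of_real \<tau>) * z) = 1"
      unfolding exp_eq_1 by (auto intro!: exI[of _ k])
  qed
  finally show ?thesis .
qed

lemma trap_kernel_derivative:
  "(trap_kernel \<tau> has_field_derivative
    (2 * complex_of_real pi * \<i> / complex_of_real \<tau>) * exp (- (2 * complex_of_real pi * \<i> / complex_of_real \<tau>) * z)) (at z)"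
proof -
  have "((\<lambda>z. 1 - exp (- c * z)) has_field_derivative c * exp (- c * z)) (at z)" for c :: complex
    by (auto intro!: derivative_eq_intros)
  from this[of "2 * complex_of_real pi * \<i> / complex_of_real \<tau>"] show ?thesis
    unfolding trap_kernel_def .
qed

lemma trap_kernel_holomorphic: "trap_kernel \<tau> holomorphic_on S"
  unfolding trap_kernel_def by (intro holomorphic_intros)

lemma norm_trap_exp:
  "cmod (exp (- (2 * complex_of_real pi * \<i> / complex_of_real \<tau>) * z)) = exp (2 * pi * Im z / \<tau>)"
  by (simp add: norm_exp_eq_Re)

text \<open>Midway between two nodes the exponential is a negative real number, so nothing cancels.
  This is why the vertical sides sit at half-integer multiples of \<open>\<tau>\<close>.\<close>

lemma trap_kernel_half:
  fixes K :: int
  assumes "0 < \<tau>" and "Re z = (of_int K + 1 / 2) * \<tau>"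
  shows "1 \<le> cmod (trap_kernel \<tau> z)"
proof -
  have "- (2 * complex_of_real pi * \<i> / complex_of_real \<tau>) * z
      = complex_of_real (2 * pi * Im z / \<tau>) + complex_of_real (- (2 * of_int K + 1) * pi) * \<i>"
    using assms by (simp add: complex_eq_iff field_simps)
  hence "exp (- (2 * complex_of_real pi * \<i> / complex_of_real \<tau>) * z)
      = complex_of_real (exp (2 * pi * Im z / \<tau>)) * exp (complex_of_real (- (2 * of_int K + 1) * pi) * \<i>)"
    by (simp only: exp_add exp_of_real)
  also have "exp (complex_of_real (- (2 * of_int K + 1) * pi) * \<i>) = -1"
  proof -
    have "complex_of_real (- (2 * of_int K + 1) * pi) * \<i> = \<i> * complex_of_real pi + (2 * of_int (- K - 1) * pi) * \<i>"
      by (simp add: algebra_simps)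
    also have "exp \<dots> = exp (\<i> * complex_of_real pi)"
      unfolding exp_eq by (intro exI[of _ "- K - 1"]) (simp add: algebra_simps)
    finally show ?thesis by (simp add: exp_pi_i)
  qed
  finally have "trap_kernel \<tau> z = complex_of_real (1 + exp (2 * pi * Im z / \<tau>))"
    unfolding trap_kernel_def by simp
  hence "cmod (trap_kernel \<tau> z) = \<bar>1 + exp (2 * pi * Im z / \<tau>)\<bar>" by (simp only: norm_of_real)
  thus ?thesis by simp
qed

lemma trapezoid_residue:
  fixes k :: int
  assumes "0 < \<tau>" and S: "open S" "complex_of_real (of_int k * \<tau>) \<in> S" and \<Phi>: "\<Phi> holomorphic_on S"
    and S1: "\<And>j::int. complex_of_real (of_int j * \<tau>) \<in> S \<Longrightarrow> j = k"
  shows "residue (\<lambda>z. \<Phi> z / trap_kernel \<tau> z) (complex_of_real (of_int k * \<tau>))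
    = complex_of_real \<tau> / (2 * complex_of_real pi * \<i>) * \<Phi> (complex_of_real (of_int k * \<tau>))"
proof (rule residue_simple'[OF S])
  let ?z = "complex_of_real (of_int k * \<tau>)" and ?c = "2 * complex_of_real pi * \<i> / complex_of_real \<tau>"
  have k0: "trap_kernel \<tau> ?z = 0" using trap_kernel_eq_0[OF assms(1)] by auto
  show "(\<lambda>z. \<Phi> z / trap_kernel \<tau> z) holomorphic_on S - {?z}"
  proof (intro holomorphic_on_divide trap_kernel_holomorphic)
    show "\<Phi> holomorphic_on S - {?z}" by (rule holomorphic_on_subset[OF \<Phi>]) auto
    show "trap_kernel \<tau> z \<noteq> 0" if "z \<in> S - {?z}" for z
      using that S1 unfolding trap_kernel_eq_0[OF assms(1)] by auto
  qed
  have "exp (- ?c * ?z) = 1" using k0 unfolding trap_kernel_def by simp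
  hence "(trap_kernel \<tau> has_field_derivative ?c) (at ?z)"
    using trap_kernel_derivative[of \<tau> ?z] by simp
  hence t1: "((\<lambda>w. trap_kernel \<tau> w / (w - ?z)) \<longlongrightarrow> ?c) (at ?z)"
    using k0 by (simp add: has_field_derivative_iff)
  have t2: "?c \<noteq> 0" using assms(1) by simp
  have t3: "(\<Phi> \<longlongrightarrow> \<Phi> ?z) (at ?z)"
    using holomorphic_on_imp_continuous_on[OF \<Phi>] S by (simp add: continuous_on_eq_continuous_at isCont_def)
  have "((\<lambda>w. \<Phi> w / (trap_kernel \<tau> w / (w - ?z))) \<longlongrightarrow> \<Phi> ?z / ?c) (at ?z)"
    by (rule tendsto_divide[OF t3 t1 t2])
  moreover have "(\<lambda>w. \<Phi> w / (trap_kernel \<tau> w / (w - ?z))) = (\<lambda>w. \<Phi> w / trap_kernel \<tau> w * (w - ?z))"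
    by (simp add: fun_eq_iff)
  moreover have "\<Phi> ?z / ?c = complex_of_real \<tau> / (2 * complex_of_real pi * \<i>) * \<Phi> ?z" by simp
  ultimately show "((\<lambda>w. \<Phi> w / trap_kernel \<tau> w * (w - ?z)) \<longlongrightarrow>
      complex_of_real \<tau> / (2 * complex_of_real pi * \<i>) * \<Phi> ?z) (at ?z)" by argo
qed

text \<open>The kernel \<open>1 / (1 - exp (- 2 \<pi> \<i> z / \<tau>))\<close> is exponentially close to \<open>1\<close> on the lower side of the
  rectangle and exponentially small on the upper side.\<close>

lemma trapezoid_rectangle:
  fixes K :: nat and \<Phi> :: "complex \<Rightarrow> complex"
  assumes \<tau>: "0 < \<tau>" and d: "0 < d" "d < d'"
    and \<Phi>: "\<Phi> holomorphic_on {z. \<bar>Im z\<bar> < d'}"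
    and \<Theta>: "\<Theta> = (real K + 1 / 2) * \<tau>"
    and G: "\<And>x y. \<bar>x\<bar> \<le> \<Theta> \<Longrightarrow> \<bar>y\<bar> \<le> d \<Longrightarrow> cmod (\<Phi> (Complex x y)) \<le> G"
    and Gs: "\<And>y. \<bar>y\<bar> \<le> d \<Longrightarrow> cmod (\<Phi> (Complex \<Theta> y)) \<le> Gs"
      "\<And>y. \<bar>y\<bar> \<le> d \<Longrightarrow> cmod (\<Phi> (Complex (- \<Theta>) y)) \<le> Gs"
    and \<eta>: "\<eta> = exp (- (2 * pi * d / \<tau>))" "\<eta> \<le> 1 / 2"
  shows "cmod (complex_of_real \<tau> * (\<Sum>k\<in>{- int K..int K}. \<Phi> (complex_of_real (of_int k * \<tau>)))
      - contour_integral (linepath (Complex (- \<Theta>) (- d)) (Complex \<Theta> (- d))) \<Phi>)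
    \<le> 8 * \<Theta> * G * \<eta> + 4 * d * Gs"
proof -
  have \<Theta>0: "0 < \<Theta>" unfolding \<Theta> using \<tau> by (intro mult_pos_pos) auto
  have G0: "0 \<le> G" using G[of 0 0] \<Theta>0 d by (smt (verit) norm_ge_zero)
  have Gs0: "0 \<le> Gs" using Gs(1)[of 0] d by (smt (verit) norm_ge_zero)
  have \<eta>0: "0 < \<eta>" unfolding \<eta> by simp
  define F where "F z = \<Phi> z / trap_kernel \<tau> z" for z
  define pts where "pts = (\<lambda>k::int. complex_of_real (of_int k * \<tau>)) ` {- int K..int K}"
  \<comment> \<open>A quarter step of room: the open set \<open>S\<close> contains the closed
    rectangle but ends at \<open>(K + 3 / 4) * \<tau>\<close>, before the next node.\<close>
  define T where "T = \<Theta> + \<tau> / 4"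
  define S where "S = {z. - T < Re z} \<inter> {z. Re z < T} \<inter> {z. - d' < Im z} \<inter> {z. Im z < d'}"
  have openS: "open S" unfolding S_def
    by (intro open_Int open_halfspace_Re_lt open_halfspace_Re_gt open_halfspace_Im_lt open_halfspace_Im_gt)
  have "convex S" unfolding S_def
    by (intro convex_Int convex_halfspace_Re_lt convex_halfspace_Re_gt convex_halfspace_Im_lt convex_halfspace_Im_gt)
  hence connS: "connected S" by (rule convex_connected)
  have \<Phi>S: "\<Phi> holomorphic_on S" by (rule holomorphic_on_subset[OF \<Phi>]) (auto simp: S_def)
  have inS: "j \<in> {- int K..int K}" if "complex_of_real (of_int j * \<tau>) \<in> S" for j :: int
  proof -
    have "- T < of_int j * \<tau>" "of_int j * \<tau> < T" using that unfolding S_def by auto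
    hence "- (real K + 3 / 4) * \<tau> < of_int j * \<tau>" "of_int j * \<tau> < (real K + 3 / 4) * \<tau>"
      unfolding T_def \<Theta> by (simp_all add: algebra_simps)
    hence "- (real K + 3 / 4) < of_int j" "of_int j < real K + 3 / 4"
      using mult_less_cancel_right_pos[OF \<tau>] by blast+
    thus ?thesis by auto
  qed
  have Sin: "complex_of_real (of_int j * \<tau>) \<in> S" if "j \<in> {- int K..int K}" for j :: int
  proof -
    have jj: "- real K \<le> of_int j" "of_int j \<le> real K" using that by auto
    have "- real K * \<tau> \<le> of_int j * \<tau>" "of_int j * \<tau> \<le> real K * \<tau>"
      using mult_right_mono[OF jj(1), of \<tau>] mult_right_mono[OF jj(2), of \<tau>] \<tau> by auto
    hence "- T < of_int j * \<tau>" "of_int j * \<tau> < T" using \<tau> unfolding T_def \<Theta> distrib_right by linarith+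
    thus ?thesis using d unfolding S_def by auto
  qed
  define a where "a = Complex (- \<Theta>) (- d)"
  define b where "b = Complex \<Theta> d"
  let ?a2 = "Complex \<Theta> (- d)" and ?a4 = "Complex (- \<Theta>) d"
  have ab: "Re a < Re b" "Im a < Im b" unfolding a_def b_def using \<Theta>0 d by auto
  have kern_side: "1 \<le> cmod (trap_kernel \<tau> z)" if "\<bar>Re z\<bar> = \<Theta>" for z
  proof -
    have "Re z = \<Theta> \<or> Re z = - \<Theta>" using that by linarith
    then consider "Re z = \<Theta>" | "Re z = - \<Theta>" by auto
    thus ?thesis
    proof cases
      case 1
      thus ?thesis using trap_kernel_half[OF \<tau>, of z "int K"] \<Theta> by simp
    next
      case 2
      \<comment> \<open>The point \<open>- \<Theta>\<close> is a half-integer multiple as well,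
        namely with index \<open>- K - 1\<close>.\<close>
      thus ?thesis using trap_kernel_half[OF \<tau>, of z "- int K - 1"] \<Theta> by (simp add: algebra_simps)
    qed
  qed
  have kern_low: "trap_kernel \<tau> z = 1 - exp (- (2 * complex_of_real pi * \<i> / complex_of_real \<tau>) * z)"
    "cmod (exp (- (2 * complex_of_real pi * \<i> / complex_of_real \<tau>) * z)) = \<eta>"
    "1 / 2 \<le> cmod (trap_kernel \<tau> z)"
    if "Im z = - d" for z
  proof -
    show 1: "trap_kernel \<tau> z = 1 - exp (- (2 * complex_of_real pi * \<i> / complex_of_real \<tau>) * z)"
      unfolding trap_kernel_def ..
    show 2: "cmod (exp (- (2 * complex_of_real pi * \<i> / complex_of_real \<tau>) * z)) = \<eta>"
      unfolding norm_trap_exp \<eta> using that by simp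
    show "1 / 2 \<le> cmod (trap_kernel \<tau> z)"
      unfolding 1 using norm_triangle_ineq2[of 1 "exp (- (2 * complex_of_real pi * \<i> / complex_of_real \<tau>) * z)"]
        2 \<eta>(2) by (simp only: norm_one)
  qed
  have kern_up: "1 / (2 * \<eta>) \<le> cmod (trap_kernel \<tau> z)" if "Im z = d" for z
  proof -
    have 2: "cmod (exp (- (2 * complex_of_real pi * \<i> / complex_of_real \<tau>) * z)) = 1 / \<eta>"
      unfolding norm_trap_exp \<eta> using that by (simp add: exp_minus inverse_eq_divide)
    have "1 / \<eta> - 1 \<le> cmod (trap_kernel \<tau> z)"
      unfolding trap_kernel_def using norm_triangle_ineq2[of "exp (- (2 * complex_of_real pi * \<i> / complex_of_real \<tau>) * z)" 1] 2
      by (simp only: norm_one norm_minus_commute[of 1])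
    moreover have "1 / (2 * \<eta>) \<le> 1 / \<eta> - 1" using \<eta>0 \<eta>(2) by (simp add: field_simps)
    ultimately show ?thesis by linarith
  qed
  have kern_nz: "trap_kernel \<tau> z \<noteq> 0" if "\<bar>Re z\<bar> = \<Theta> \<or> \<bar>Im z\<bar> = d" for z
  proof -
    have "0 < 1 / (2 * \<eta>)" using \<eta>0 by simp
    moreover have "\<bar>Im z\<bar> = d \<Longrightarrow> Im z = d \<or> Im z = - d" by linarith
    ultimately show ?thesis using that kern_side[of z] kern_low(3)[of z] kern_up[of z] by force
  qed
  have seg: "closed_segment a ?a2 = {z. Im z = - d \<and> \<bar>Re z\<bar> \<le> \<Theta>}"
    "closed_segment ?a2 b = {z. Re z = \<Theta> \<and> \<bar>Im z\<bar> \<le> d}"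
    "closed_segment b ?a4 = {z. Im z = d \<and> \<bar>Re z\<bar> \<le> \<Theta>}"
    "closed_segment ?a4 a = {z. Re z = - \<Theta> \<and> \<bar>Im z\<bar> \<le> d}"
    unfolding a_def b_def using \<Theta>0 d
    by (auto simp: closed_segment_same_Im closed_segment_same_Re closed_segment_eq_real_ivl)
  have contF: "continuous_on X F" if "X \<subseteq> {z. (\<bar>Re z\<bar> = \<Theta> \<or> \<bar>Im z\<bar> = d) \<and> \<bar>Im z\<bar> \<le> d}" for X
    unfolding F_def
    by (intro continuous_intros continuous_on_subset[OF holomorphic_on_imp_continuous_on[OF \<Phi>]]
        holomorphic_on_imp_continuous_on[OF trap_kernel_holomorphic])
       (use that d kern_nz in auto)
  have ci: "F contour_integrable_on linepath a ?a2" "F contour_integrable_on linepath ?a2 b"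
    "F contour_integrable_on linepath b ?a4" "F contour_integrable_on linepath ?a4 a"
    by (intro contour_integrable_continuous_linepath contF; unfold seg; use d \<Theta>0 in force)+
  have split: "contour_integral (rectpath a b) F = contour_integral (linepath a ?a2) F + contour_integral (linepath ?a2 b) F
      + contour_integral (linepath b ?a4) F + contour_integral (linepath ?a4 a) F"
  proof -
    have "Complex (Re b) (Im a) = ?a2" "Complex (Re a) (Im b) = ?a4" unfolding a_def b_def by auto
    thus ?thesis unfolding rectpath_def Let_def using ci
      by (simp add: contour_integral_join contour_integrable_join valid_path_join)
  qed
  have "contour_integral (rectpath a b) F = 2 * pi * \<i> * (\<Sum>p\<in>pts. winding_number (rectpath a b) p * residue F p)"
  proof (rule Residue_theorem[OF openS connS])
    show "finite pts" unfolding pts_def by simp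
    show "F holomorphic_on S - pts" unfolding F_def
    proof (intro holomorphic_on_divide trap_kernel_holomorphic)
      show "\<Phi> holomorphic_on S - pts" by (rule holomorphic_on_subset[OF \<Phi>S]) auto
      show "trap_kernel \<tau> z \<noteq> 0" if "z \<in> S - pts" for z
        using that inS unfolding trap_kernel_eq_0[OF \<tau>] pts_def by auto
    qed
    have cb: "cbox a b \<subseteq> S"
      unfolding S_def T_def a_def b_def using \<tau> d by (auto simp: in_cbox_complex_iff)
    show "path_image (rectpath a b) \<subseteq> S - pts"
    proof
      fix z assume z: "z \<in> path_image (rectpath a b)"
      have zz: "z \<in> cbox a b - box a b" using z ab by (simp add: path_image_rectpath_cbox_minus_box)
      hence "\<bar>Re z\<bar> = \<Theta> \<or> \<bar>Im z\<bar> = d"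
        unfolding a_def b_def by (auto simp: in_cbox_complex_iff in_box_complex_iff)
      hence "z \<notin> pts" using kern_nz[of z] unfolding trap_kernel_eq_0[OF \<tau>] pts_def by auto
      thus "z \<in> S - pts" using zz cb by auto
    qed
    show "\<forall>z. z \<notin> S \<longrightarrow> winding_number (rectpath a b) z = 0"
      using winding_number_rectpath_outside[of a b] ab cb by (auto simp: less_imp_le)
  qed auto
  also have "(\<Sum>p\<in>pts. winding_number (rectpath a b) p * residue F p)
      = (\<Sum>k\<in>{- int K..int K}. complex_of_real \<tau> / (2 * complex_of_real pi * \<i>) * \<Phi> (complex_of_real (of_int k * \<tau>)))"
    unfolding pts_def
  proof (subst sum.reindex)
    show "inj_on (\<lambda>k::int. complex_of_real (of_int k * \<tau>)) {- int K..int K}"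
      using \<tau> by (auto simp: inj_on_def)
    show "sum ((\<lambda>p. winding_number (rectpath a b) p * residue F p) \<circ> (\<lambda>k::int. complex_of_real (of_int k * \<tau>))) {- int K..int K}
        = (\<Sum>k\<in>{- int K..int K}. complex_of_real \<tau> / (2 * complex_of_real pi * \<i>) * \<Phi> (complex_of_real (of_int k * \<tau>)))"
    proof (rule sum.cong[OF refl])
      fix k assume k: "k \<in> {- int K..int K}"
      let ?z = "complex_of_real (of_int k * \<tau>)"
      have kk: "- real K \<le> of_int k" "of_int k \<le> real K" using k by auto
      have "- real K * \<tau> \<le> of_int k * \<tau>" "of_int k * \<tau> \<le> real K * \<tau>"
        using mult_right_mono[OF kk(1), of \<tau>] mult_right_mono[OF kk(2), of \<tau>] \<tau> by auto
      hence "- \<Theta> < of_int k * \<tau>" "of_int k * \<tau> < \<Theta>" using \<tau> unfolding \<Theta> distrib_right by linarith+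
      hence "?z \<in> box a b" unfolding a_def b_def using d by (auto simp: in_box_complex_iff)
      hence w: "winding_number (rectpath a b) ?z = 1" by (rule winding_number_rectpath)
      \<comment> \<open>The radius equals the spacing of the nodes, so the ball isolates a single
        one.\<close>
      define S' where "S' = S \<inter> ball ?z \<tau>"
      have "residue F ?z = complex_of_real \<tau> / (2 * complex_of_real pi * \<i>) * \<Phi> ?z"
        unfolding F_def
      proof (rule trapezoid_residue[OF \<tau>])
        show "open S'" unfolding S'_def using openS by auto
        show "?z \<in> S'" unfolding S'_def using Sin[OF k] \<tau> by simp
        show "\<Phi> holomorphic_on S'" by (rule holomorphic_on_subset[OF \<Phi>S]) (auto simp: S'_def)
        fix j :: int assume "complex_of_real (of_int j * \<tau>) \<in> S'"
        hence "dist ?z (complex_of_real (of_int j * \<tau>)) < \<tau>" unfolding S'_def by simp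
        hence "\<bar>of_int k * \<tau> - of_int j * \<tau>\<bar> < \<tau>" by (simp only: dist_of_real dist_real_def)
        moreover have "\<bar>of_int k * \<tau> - of_int j * \<tau>\<bar> = \<bar>of_int (k - j)\<bar> * \<tau>"
          using \<tau> by (simp add: left_diff_distrib[symmetric] abs_mult)
        ultimately have "\<bar>real_of_int (k - j)\<bar> < 1" using \<tau> by simp
        thus "j = k" by linarith
      qed
      thus "((\<lambda>p. winding_number (rectpath a b) p * residue F p) \<circ> (\<lambda>k::int. complex_of_real (of_int k * \<tau>))) k
          = complex_of_real \<tau> / (2 * complex_of_real pi * \<i>) * \<Phi> ?z" using w by simp
    qed
  qed
  also have "2 * pi * \<i> * \<dots> = complex_of_real \<tau> * (\<Sum>k\<in>{- int K..int K}. \<Phi> (complex_of_real (of_int k * \<tau>)))"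
    by (simp add: sum_distrib_left)
  finally have sum: "complex_of_real \<tau> * (\<Sum>k\<in>{- int K..int K}. \<Phi> (complex_of_real (of_int k * \<tau>))) = contour_integral (rectpath a b) F" ..
  have len: "cmod (?a2 - a) = 2 * \<Theta>" "cmod (?a4 - b) = 2 * \<Theta>" "cmod (b - ?a2) = 2 * d" "cmod (a - ?a4) = 2 * d"
  proof -
    have "?a2 - a = complex_of_real (2 * \<Theta>)" "?a4 - b = complex_of_real (- 2 * \<Theta>)"
      "b - ?a2 = complex_of_real (2 * d) * \<i>" "a - ?a4 = complex_of_real (- 2 * d) * \<i>"
      unfolding a_def b_def by (auto simp: complex_eq_iff)
    thus "cmod (?a2 - a) = 2 * \<Theta>" "cmod (?a4 - b) = 2 * \<Theta>" "cmod (b - ?a2) = 2 * d" "cmod (a - ?a4) = 2 * d"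
      using \<Theta>0 d by (simp_all only: norm_mult norm_of_real norm_ii)
  qed
  have ci\<Phi>: "\<Phi> contour_integrable_on linepath a ?a2"
    by (intro contour_integrable_continuous_linepath continuous_on_subset[OF holomorphic_on_imp_continuous_on[OF \<Phi>]])
       (unfold seg, use d in auto)
  have "cmod (contour_integral (linepath a ?a2) (\<lambda>z. F z - \<Phi> z)) \<le> 2 * G * \<eta> * cmod (?a2 - a)"
  proof (rule contour_integral_bound_linepath)
    show "(\<lambda>z. F z - \<Phi> z) contour_integrable_on linepath a ?a2" by (rule contour_integrable_diff[OF ci(1) ci\<Phi>])
    fix z assume "z \<in> closed_segment a ?a2"
    hence z: "Im z = - d" "\<bar>Re z\<bar> \<le> \<Theta>" unfolding seg by auto
    let ?w = "exp (- (2 * complex_of_real pi * \<i> / complex_of_real \<tau>) * z)"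
    have "F z - \<Phi> z = \<Phi> z * ?w / trap_kernel \<tau> z"
      unfolding F_def kern_low(1)[OF z(1)] using kern_nz[of z] z(1) d kern_low(1)[OF z(1)] by (simp add: field_simps)
    hence "cmod (F z - \<Phi> z) = cmod (\<Phi> z) * \<eta> / cmod (trap_kernel \<tau> z)"
      using kern_low(2)[OF z(1)] by (simp add: norm_mult norm_divide del: exp_minus)
    also have "\<dots> \<le> cmod (\<Phi> z) * \<eta> / (1 / 2)"
      using kern_low(3)[OF z(1)] \<eta>0 by (intro divide_left_mono mult_pos_pos mult_nonneg_nonneg) auto
    also have "\<dots> \<le> G * \<eta> / (1 / 2)"
      using G[of "Re z" "Im z"] z d \<eta>0 unfolding complex_surj by (intro divide_right_mono mult_right_mono) auto
    finally show "cmod (F z - \<Phi> z) \<le> 2 * G * \<eta>" by simp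
  qed (use G0 \<eta>0 in auto)
  hence b1: "cmod (contour_integral (linepath a ?a2) F - contour_integral (linepath a ?a2) \<Phi>) \<le> 2 * G * \<eta> * (2 * \<Theta>)"
    unfolding contour_integral_diff[OF ci(1) ci\<Phi>] len .
  have b2: "cmod (contour_integral (linepath b ?a4) F) \<le> 2 * G * \<eta> * (2 * \<Theta>)"
  proof -
    have "cmod (contour_integral (linepath b ?a4) F) \<le> 2 * G * \<eta> * cmod (?a4 - b)"
    proof (rule contour_integral_bound_linepath[OF ci(3)])
      fix z assume "z \<in> closed_segment b ?a4"
      hence z: "Im z = d" "\<bar>Re z\<bar> \<le> \<Theta>" unfolding seg by auto
      have "cmod (F z) \<le> cmod (\<Phi> z) / (1 / (2 * \<eta>))"
        unfolding F_def norm_divide using kern_up[OF z(1)] \<eta>0 kern_nz[of z] z(1) d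
        by (intro divide_left_mono mult_pos_pos) auto
      also have "\<dots> \<le> G / (1 / (2 * \<eta>))"
        using G[of "Re z" "Im z"] z d \<eta>0 unfolding complex_surj by (intro divide_right_mono) auto
      finally show "cmod (F z) \<le> 2 * G * \<eta>" by (simp add: mult_ac)
    qed (use G0 \<eta>0 in auto)
    thus ?thesis unfolding len .
  qed
  have side: "cmod (F z) \<le> Gs" if "\<bar>Re z\<bar> = \<Theta>" "\<bar>Im z\<bar> \<le> d" for z
  proof -
    have "cmod (F z) \<le> cmod (\<Phi> z) / 1"
      unfolding F_def norm_divide using kern_side[OF that(1)] by (intro divide_left_mono) auto
    moreover have "z = Complex \<Theta> (Im z) \<or> z = Complex (- \<Theta>) (Im z)" using that(1) by (auto simp: complex_eq_iff)
    hence "cmod (\<Phi> z) \<le> Gs" using Gs[OF that(2)] by auto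
    ultimately show ?thesis by simp
  qed
  have b3: "cmod (contour_integral (linepath ?a2 b) F) \<le> Gs * (2 * d)"
  proof -
    have "cmod (contour_integral (linepath ?a2 b) F) \<le> Gs * cmod (b - ?a2)"
      by (rule contour_integral_bound_linepath[OF ci(2) Gs0 side]) (use \<Theta>0 in \<open>auto simp: seg\<close>)
    thus ?thesis unfolding len .
  qed
  have b4: "cmod (contour_integral (linepath ?a4 a) F) \<le> Gs * (2 * d)"
  proof -
    have "cmod (contour_integral (linepath ?a4 a) F) \<le> Gs * cmod (a - ?a4)"
      by (rule contour_integral_bound_linepath[OF ci(4) Gs0 side]) (use \<Theta>0 in \<open>auto simp: seg\<close>)
    thus ?thesis unfolding len .
  qed
  \<comment> \<open>Only the lower side carries the integral of \<open>\<Phi>\<close>, run from left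
    to right as the positive orientation requires; the other three sides are pure error.\<close>
  have "cmod (complex_of_real \<tau> * (\<Sum>k\<in>{- int K..int K}. \<Phi> (complex_of_real (of_int k * \<tau>))) - contour_integral (linepath a ?a2) \<Phi>)
      = cmod ((contour_integral (linepath a ?a2) F - contour_integral (linepath a ?a2) \<Phi>)
        + contour_integral (linepath ?a2 b) F + contour_integral (linepath b ?a4) F + contour_integral (linepath ?a4 a) F)"
    unfolding sum split by (simp add: algebra_simps)
  also have "\<dots> \<le> 2 * G * \<eta> * (2 * \<Theta>) + Gs * (2 * d) + 2 * G * \<eta> * (2 * \<Theta>) + Gs * (2 * d)"
    by (intro norm_triangle_mono b1 b2 b3 b4)
  also have "\<dots> = 8 * \<Theta> * G * \<eta> + 4 * d * Gs" by (simp add: algebra_simps)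
  finally show ?thesis unfolding a_def .
qed

section \<open>The hyperbola\<close>

lemma sin_Complex: "sin (Complex a \<theta>) = Complex (sin a * cosh \<theta>) (cos a * sinh \<theta>)"
  by (simp add: complex_eq_iff Re_sin Im_sin cosh_def sinh_def algebra_simps diff_divide_distrib add_divide_distrib)

lemma cos_Complex: "cos (Complex a \<theta>) = Complex (cos a * cosh \<theta>) (- (sin a * sinh \<theta>))"
  by (simp add: complex_eq_iff Re_cos Im_cos cosh_def sinh_def algebra_simps diff_divide_distrib add_divide_distrib)

text \<open>A focal distance formula: \<open>\<theta> \<mapsto> sin (a + \<i> * \<theta>)\<close>
  runs on a hyperbola with foci \<open>1\<close> and \<open>- 1\<close>, and its distance to the
  focus \<open>1\<close> is \<open>cosh \<theta>\<close> up to a constant.\<close>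

lemma cmod_one_minus_sin: "cmod (1 - sin (Complex a \<theta>)) = cosh \<theta> - sin a"
proof (rule power2_eq_imp_eq[OF _ norm_ge_zero])
  have c: "(sinh \<theta>)\<^sup>2 = (cosh \<theta>)\<^sup>2 - 1" by (simp add: cosh_square_eq)
  have k: "(cos a)\<^sup>2 = 1 - (sin a)\<^sup>2" by (simp add: cos_squared_eq)
  have "(cmod (1 - sin (Complex a \<theta>)))\<^sup>2 = (1 - sin a * cosh \<theta>)\<^sup>2 + (cos a)\<^sup>2 * (sinh \<theta>)\<^sup>2"
    by (simp add: cmod_power2 sin_Complex power_mult_distrib)
  also have "\<dots> = (cosh \<theta> - sin a)\<^sup>2"
    unfolding k c by (simp add: power2_eq_square algebra_simps)
  finally show "(cmod (1 - sin (Complex a \<theta>)))\<^sup>2 = (cosh \<theta> - sin a)\<^sup>2" .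
  show "0 \<le> cosh \<theta> - sin a" using cosh_real_ge_1[of \<theta>] sin_le_one[of a] by linarith
qed

lemma cmod_sin_le: "cmod (sin (Complex a \<theta>)) \<le> cosh \<theta>"
proof (rule power2_le_imp_le)
  have c: "(sinh \<theta>)\<^sup>2 \<le> (cosh \<theta>)\<^sup>2" unfolding cosh_square_eq by simp
  have "(cmod (sin (Complex a \<theta>)))\<^sup>2 = (sin a)\<^sup>2 * (cosh \<theta>)\<^sup>2 + (cos a)\<^sup>2 * (sinh \<theta>)\<^sup>2"
    by (simp add: cmod_power2 sin_Complex power_mult_distrib)
  also have "\<dots> \<le> (sin a)\<^sup>2 * (cosh \<theta>)\<^sup>2 + (cos a)\<^sup>2 * (cosh \<theta>)\<^sup>2"
    by (intro add_left_mono mult_left_mono c) auto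
  finally show "(cmod (sin (Complex a \<theta>)))\<^sup>2 \<le> (cosh \<theta>)\<^sup>2" by (simp add: distrib_right[symmetric])
qed simp

lemma cmod_cos_le: "cmod (cos (Complex a \<theta>)) \<le> cosh \<theta>"
proof (rule power2_le_imp_le)
  have c: "(sinh \<theta>)\<^sup>2 \<le> (cosh \<theta>)\<^sup>2" unfolding cosh_square_eq by simp
  have "(cmod (cos (Complex a \<theta>)))\<^sup>2 = (cos a)\<^sup>2 * (cosh \<theta>)\<^sup>2 + (sin a)\<^sup>2 * (sinh \<theta>)\<^sup>2"
    by (simp add: cmod_power2 cos_Complex power_mult_distrib)
  also have "\<dots> \<le> (cos a)\<^sup>2 * (cosh \<theta>)\<^sup>2 + (sin a)\<^sup>2 * (cosh \<theta>)\<^sup>2"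
    by (intro add_left_mono mult_left_mono c) auto
  finally show "(cmod (cos (Complex a \<theta>)))\<^sup>2 \<le> (cosh \<theta>)\<^sup>2" by (simp add: distrib_right[symmetric])
qed simp

text \<open>The hyperbola with complex parameter. On the line \<open>Im z = y\<close> it is the
  hyperbola with angle \<open>\<alpha> - y\<close>, so a strip of parameters sweeps a family of
  confocal hyperbolas.\<close>

definition hyp :: "real \<Rightarrow> real \<Rightarrow> real \<Rightarrow> complex \<Rightarrow> complex" where
  "hyp \<alpha> \<sigma> \<mu> z = complex_of_real \<mu> * (1 - sin (complex_of_real \<alpha> + \<i> * z)) + complex_of_real \<sigma>"

definition hyp' :: "real \<Rightarrow> real \<Rightarrow> complex \<Rightarrow> complex" where
  "hyp' \<alpha> \<mu> z = - (\<i> * complex_of_real \<mu> * cos (complex_of_real \<alpha> + \<i> * z))"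

lemma hyp_of_real: "hyp \<alpha> \<sigma> \<mu> (complex_of_real \<theta>) = hyperbola \<alpha> \<sigma> \<mu> \<theta>"
  unfolding hyp_def hyperbola_def ..

lemma hyp_derivative: "(hyp \<alpha> \<sigma> \<mu> has_field_derivative hyp' \<alpha> \<mu> z) (at z)"
  unfolding hyp_def hyp'_def by (auto intro!: derivative_eq_intros)

lemma hyp'_holomorphic: "hyp' \<alpha> \<mu> holomorphic_on S"
  unfolding hyp'_def by (intro holomorphic_intros)

lemma hyp_holomorphic: "hyp \<alpha> \<sigma> \<mu> holomorphic_on S"
  unfolding hyp_def by (intro holomorphic_intros)

lemma hyperbola_derivative:
  "vector_derivative (hyperbola \<alpha> \<sigma> \<mu>) (at \<theta>) = hyp' \<alpha> \<mu> (complex_of_real \<theta>)"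
proof (rule vector_derivative_at)
  have "((\<lambda>\<theta>. hyp \<alpha> \<sigma> \<mu> (complex_of_real \<theta>)) has_vector_derivative hyp' \<alpha> \<mu> (complex_of_real \<theta>)) (at \<theta>)"
    by (rule has_vector_derivative_real_field[OF hyp_derivative])
  thus "(hyperbola \<alpha> \<sigma> \<mu> has_vector_derivative hyp' \<alpha> \<mu> (complex_of_real \<theta>)) (at \<theta>)"
    unfolding hyp_of_real .
qed

lemma hyp_arg: "complex_of_real \<alpha> + \<i> * Complex x y = Complex (\<alpha> - y) x"
  by (simp add: complex_eq_iff)

text \<open>The open sector in which the argument of \<open>z - \<sigma>\<close> is below
  \<open>pi - \<phi>\<close> in modulus, written through the cosine so that openness is immediate;
  the strict inequality excludes the vertex.\<close>

definition sector :: "real \<Rightarrow> real \<Rightarrow> complex set" where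
  "sector \<sigma> \<phi> = {z. - cos \<phi> * cmod (z - complex_of_real \<sigma>) < Re (z - complex_of_real \<sigma>)}"

lemma open_sector: "open (sector \<sigma> \<phi>)"
  unfolding sector_def by (intro open_Collect_less continuous_intros)

text \<open>The opening angle exceeds \<open>pi\<close>, so the sector is not convex; it is
  star-shaped about \<open>\<sigma> + 1\<close>, which suffices for primitives.\<close>

lemma starlike_sector:
  assumes "0 < \<phi>" "\<phi> < pi / 2"
  shows "starlike (sector \<sigma> \<phi>)"
  unfolding starlike_def
proof (intro bexI ballI subsetI)
  have c: "0 < cos \<phi>" using assms by (intro cos_gt_zero_pi) auto
  show "complex_of_real \<sigma> + 1 \<in> sector \<sigma> \<phi>" using c unfolding sector_def by simp
  fix x y assume x: "x \<in> sector \<sigma> \<phi>" and "y \<in> closed_segment (complex_of_real \<sigma> + 1) x"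
  then obtain u where u: "0 \<le> u" "u \<le> 1" "y = (1 - u) *\<^sub>R (complex_of_real \<sigma> + 1) + u *\<^sub>R x"
    unfolding closed_segment_def by auto
  define w where "w = x - complex_of_real \<sigma>"
  have w: "- cos \<phi> * cmod w < Re w" using x unfolding sector_def w_def by simp
  have y: "y - complex_of_real \<sigma> = complex_of_real (1 - u) + complex_of_real u * w"
    unfolding u(3) w_def by (simp add: scaleR_conv_of_real algebra_simps)
  have "cmod (complex_of_real u * w) - cmod (complex_of_real (1 - u)) \<le> cmod (y - complex_of_real \<sigma>)"
    unfolding y using norm_diff_ineq[of "complex_of_real u * w" "complex_of_real (1 - u)"] by (simp add: add.commute)
  hence "u * cmod w - (1 - u) \<le> cmod (y - complex_of_real \<sigma>)" using u by (simp only: norm_mult norm_of_real)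
  hence 1: "- cos \<phi> * cmod (y - complex_of_real \<sigma>) \<le> - cos \<phi> * (u * cmod w - (1 - u))" using c by simp
  have "- cos \<phi> * (u * cmod w - (1 - u)) < (1 - u) + u * Re w"
  proof (cases "u = 0")
    case True
    thus ?thesis using cos_le_one[of \<phi>] assms cos_monotone_0_pi[of 0 \<phi>] by simp
  next
    case False
    have "u * (- cos \<phi> * cmod w) < u * Re w" using False u by (intro mult_strict_left_mono[OF w]) auto
    moreover have "cos \<phi> * (1 - u) \<le> 1 * (1 - u)" using u by (intro mult_right_mono) auto
    ultimately show ?thesis by (simp add: algebra_simps)
  qed
  with 1 have "- cos \<phi> * cmod (y - complex_of_real \<sigma>) < Re (y - complex_of_real \<sigma>)" unfolding y by simp
  thus "y \<in> sector \<sigma> \<phi>" unfolding sector_def by simp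
qed

lemma hyp_diff:
  "hyp \<alpha> \<sigma> \<mu> (Complex x y) - complex_of_real \<sigma> = complex_of_real \<mu> * (1 - sin (Complex (\<alpha> - y) x))"
  unfolding hyp_def hyp_arg by simp

lemma hyp_dist:
  assumes "0 \<le> \<mu>"
  shows "cmod (hyp \<alpha> \<sigma> \<mu> (Complex x y) - complex_of_real \<sigma>) = \<mu> * (cosh x - sin (\<alpha> - y))"
  unfolding hyp_diff using assms by (simp add: norm_mult cmod_one_minus_sin)

text \<open>With \<open>a = \<alpha> - y\<close> the two sides of the sector inequality differ, up
  to the factor \<open>\<mu>\<close>, by
  \<open>(1 - sin a * cos \<phi>) + cosh x * (cos \<phi> - sin a)\<close>. The angle condition says
  \<open>sin a < cos \<phi>\<close>.\<close>

lemma hyp_in_sector: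
  assumes \<mu>: "0 < \<mu>" and a: "0 < \<alpha> - y" "\<alpha> - y < pi / 2 - \<phi>" and \<phi>: "0 < \<phi>" "\<phi> < pi / 2"
  shows "hyp \<alpha> \<sigma> \<mu> (Complex x y) \<in> sector \<sigma> \<phi>"
proof -
  define a where "a = \<alpha> - y"
  have c: "0 < cos \<phi>" using \<phi> by (intro cos_gt_zero_pi) auto
  have "sin a < sin (pi / 2 - \<phi>)" unfolding a_def using a \<phi> by (intro sin_monotone_2pi) auto
  hence s: "sin a < cos \<phi>" by (simp add: sin_cos_eq)
  have "sin a * cos \<phi> \<le> 1" using mult_mono[of "sin a" 1 "cos \<phi>" 1] c by simp
  hence "0 \<le> 1 - sin a * cos \<phi>" by simp
  moreover have "0 < cosh x * (cos \<phi> - sin a)" using s by (intro mult_pos_pos) auto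
  moreover have "1 - sin a * cosh x - (- cos \<phi> * (cosh x - sin a)) = (1 - sin a * cos \<phi>) + cosh x * (cos \<phi> - sin a)"
    by (simp add: algebra_simps)
  ultimately have "- cos \<phi> * (cosh x - sin a) < 1 - sin a * cosh x" by linarith
  hence "\<mu> * (- cos \<phi> * (cosh x - sin a)) < \<mu> * (1 - sin a * cosh x)" by (rule mult_strict_left_mono[OF _ \<mu>])
  moreover have "Re (hyp \<alpha> \<sigma> \<mu> (Complex x y) - complex_of_real \<sigma>) = \<mu> * (1 - sin a * cosh x)"
    unfolding hyp_diff a_def by (simp add: sin_Complex)
  ultimately show ?thesis
    unfolding sector_def mem_Collect_eq hyp_dist[OF less_imp_le[OF \<mu>]] a_def by (simp add: mult_ac)
qed

text \<open>The bound depends neither on \<open>x\<close> nor on the angle, so one condition on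
  \<open>\<sigma> + \<mu>\<close> keeps a whole strip of hyperbolas left of the poles.\<close>

lemma hyp_Re_le:
  assumes "0 \<le> \<mu>" "0 \<le> sin (\<alpha> - y)"
  shows "Re (hyp \<alpha> \<sigma> \<mu> (Complex x y)) \<le> \<sigma> + \<mu>"
proof -
  have "Re (hyp \<alpha> \<sigma> \<mu> (Complex x y) - complex_of_real \<sigma>) = \<mu> * (1 - sin (\<alpha> - y) * cosh x)"
    unfolding hyp_diff by (simp add: sin_Complex)
  also have "\<dots> \<le> \<mu> * 1" using assms cosh_real_ge_1[of x] by (intro mult_left_mono) auto
  finally show ?thesis by simp
qed

lemma arc_point:
  assumes "s \<le> t" "z \<in> path_image (part_circlepath c \<rho> s t)"
  shows "\<exists>u. s \<le> u \<and> u \<le> t \<and> z = c + \<rho> * cis u"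
  using assms(2) unfolding path_image_part_circlepath[OF assms(1)] cis_conv_exp by auto

text \<open>The principal part \<open>p / (z - c)\<close> contributes \<open>\<i> * p\<close> times
  the opening angle exactly; the remainder is bounded by \<open>B\<close> times the arc
  length.\<close>

lemma arc_integral_close:
  assumes ci: "continuous_on (path_image (part_circlepath c \<rho> s t)) g" and \<rho>: "0 < \<rho>" and st: "s < t"
    and close: "\<And>z. z \<in> path_image (part_circlepath c \<rho> s t) \<Longrightarrow> cmod (g z - p / (z - c)) \<le> B" and B: "0 \<le> B"
  shows "cmod (contour_integral (part_circlepath c \<rho> s t) g - \<i> * p * complex_of_real (t - s)) \<le> B * \<rho> * (t - s)"
proof -
  have on: "cmod (z - c) = \<rho>" if "z \<in> path_image (part_circlepath c \<rho> s t)" for z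
    using that \<rho> by (auto simp: path_image_part_circlepath[OF less_imp_le[OF st]] norm_mult)
  have "((\<lambda>u. (p / (c + \<rho> * cis u - c)) * \<rho> * \<i> * cis u) has_integral (\<i> * p * complex_of_real (t - s))) {s..t}"
  proof -
    have "(\<lambda>u. (p / (c + \<rho> * cis u - c)) * \<rho> * \<i> * cis u) = (\<lambda>u. \<i> * p)"
      using \<rho> by (simp add: fun_eq_iff)
    moreover have "((\<lambda>u. \<i> * p) has_integral ((t - s) *\<^sub>R (\<i> * p))) {s..t}"
      using has_integral_const_real[of "\<i> * p" s t] st by simp
    ultimately show ?thesis by (simp add: scaleR_conv_of_real mult_ac)
  qed
  hence "((\<lambda>z. p / (z - c)) has_contour_integral (\<i> * p * complex_of_real (t - s))) (part_circlepath c \<rho> s t)"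
    by (rule iffD2[OF has_contour_integral_part_circlepath_iff[OF st]])
  moreover have "(g has_contour_integral contour_integral (part_circlepath c \<rho> s t) g) (part_circlepath c \<rho> s t)"
    by (rule has_contour_integral_integral[OF contour_integrable_continuous_part_circlepath[OF ci]])
  ultimately have "((\<lambda>z. g z - p / (z - c)) has_contour_integral
      (contour_integral (part_circlepath c \<rho> s t) g - \<i> * p * complex_of_real (t - s))) (part_circlepath c \<rho> s t)"
    by (intro has_contour_integral_diff)
  from has_contour_integral_bound_part_circlepath[OF this B \<rho> less_imp_le[OF st] close] show ?thesis by simp
qed

text \<open>The part of the hyperbola up to \<open>\<plusminus>R\<close> is deformed, for the two summands \<open>su\<close> and \<open>e\<close>
  separately, into the right and the left arc of a circle about \<open>\<sigma>\<close>; together the arcs give a full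
  circle, on which only the residue \<open>p\<close> at infinity survives.\<close>

lemma hyperbola_contour_limit:
  assumes \<mu>: "0 < \<mu>" and a: "0 < \<alpha> + d" "\<alpha> + d < pi / 2 - \<phi>" and \<phi>: "0 < \<phi>" "\<phi> < pi / 2"
    and x0: "\<sigma> + \<mu> < x0"
    and su: "su holomorphic_on sector \<sigma> \<phi>" and e: "e holomorphic_on {z. Re z < x0}"
    and F: "\<And>z. z \<in> sector \<sigma> \<phi> \<Longrightarrow> Re z < x0 \<Longrightarrow> F z = su z + e z"
    and far_su: "\<And>z. z \<in> sector \<sigma> \<phi> \<Longrightarrow> C0 \<le> cmod z \<Longrightarrow> cmod (su z - p / (z - complex_of_real \<sigma>)) \<le> C1 / (cmod z)\<^sup>2"
    and far_e: "\<And>z. Re z < x0 \<Longrightarrow> C0 \<le> cmod z \<Longrightarrow> cmod (e z + p / (z - complex_of_real \<sigma>)) \<le> C1 / (cmod z)\<^sup>2"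
    and C1: "0 < C1" and \<epsilon>: "0 < \<epsilon>"
  shows "\<exists>R0. \<forall>R\<ge>R0. cmod (contour_integral (linepath (Complex (- R) (- d)) (Complex R (- d)))
      (\<lambda>z. \<i> / (2 * complex_of_real pi) * hyp' \<alpha> \<mu> z * F (hyp \<alpha> \<sigma> \<mu> z)) - p) \<le> \<epsilon>"
proof -
  let ?\<sigma> = "complex_of_real \<sigma>" and ?H = "{z. Re z < x0}" and ?\<gamma> = "hyp \<alpha> \<sigma> \<mu>"
  define a1 where "a1 = \<alpha> + d"
  have sa: "0 < sin a1" "0 < cos a1" unfolding a1_def using a \<phi> by (auto intro!: sin_gt_zero cos_gt_zero_pi)
  have openH: "open ?H" by (rule open_halfspace_Re_lt)
  \<comment> \<open>Primitives on the sector and on the half-plane replace homotopies: each integral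
    depends only on its end points.\<close>
  obtain G where G: "\<And>z. z \<in> sector \<sigma> \<phi> \<Longrightarrow> (G has_field_derivative su z) (at z)"
    using holomorphic_starlike_primitive[OF holomorphic_on_imp_continuous_on[OF su] starlike_sector[OF \<phi>] open_sector finite.emptyI]
      holomorphic_on_imp_differentiable_at[OF su open_sector] by auto
  obtain E where E: "\<And>z. z \<in> ?H \<Longrightarrow> (E has_field_derivative e z) (at z within ?H)"
    using holomorphic_convex_primitive'[OF convex_halfspace_Re_lt openH e] by auto
  have E': "(E has_field_derivative e z) (at z)" if "z \<in> ?H" for z
    using E[OF that] at_within_open[OF that openH] by simp
  define Kc where "Kc = \<bar>\<sigma>\<bar> + \<bar>C0\<bar>"
  define Q where "Q = 4 * C1 / \<epsilon>"
  have KQ: "\<bar>\<sigma>\<bar> \<le> Kc" "C0 \<le> Kc" "0 \<le> Kc" "0 \<le> Q" unfolding Kc_def Q_def using C1 \<epsilon> by auto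
  \<comment> \<open>Chosen so that the circle has radius \<open>\<rho> \<ge> 2 * Kc + Q + 1\<close>.
    Here \<open>Kc\<close> moves both arcs into the far region, and \<open>Q\<close> makes the final
    error \<open>4 * C1 / \<rho>\<close> at most \<open>\<epsilon>\<close>.\<close>
  define R0 where "R0 = (2 * Kc + Q + 1) / \<mu> + 1"
  have main: "cmod (contour_integral (linepath (Complex (- R) (- d)) (Complex R (- d)))
      (\<lambda>z. \<i> / (2 * complex_of_real pi) * hyp' \<alpha> \<mu> z * F (?\<gamma> z)) - p) \<le> \<epsilon>" if R: "R0 \<le> R" for R
  proof -
    define \<rho> where "\<rho> = \<mu> * (cosh R - sin a1)"
    have R0pos: "0 < R0" unfolding R0_def using \<mu> KQ by (intro add_nonneg_pos divide_nonneg_pos) auto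
    have Rpos: "0 < R" using R R0pos by linarith
    have "R \<le> cosh R"
    proof -
      have "2 * R \<le> 1 + R + R\<^sup>2 / 2" using zero_le_power2[of "1 - R"] by (simp add: power2_diff)
      also have "\<dots> \<le> exp R" by (rule exp_lower_Taylor_quadratic) (use Rpos in simp)
      also have "\<dots> \<le> 2 * cosh R" by (simp add: cosh_field_def)
      finally show ?thesis by simp
    qed
    hence "R0 - 1 \<le> cosh R - sin a1" using R sin_le_one[of a1] by linarith
    hence "\<mu> * (R0 - 1) \<le> \<rho>" unfolding \<rho>_def using \<mu> by (intro mult_left_mono) auto
    hence \<rho>: "2 * Kc + Q + 1 \<le> \<rho>" unfolding R0_def using \<mu> by simp
    have \<rho>0: "0 < \<rho>" using \<rho> KQ by linarith
    define zp where "zp = ?\<gamma> (Complex R (- d))"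
    define zm where "zm = ?\<gamma> (Complex (- R) (- d))"
    define \<beta> where "\<beta> = Arg (zm - ?\<sigma>)"
    have zm_eq: "zm - ?\<sigma> = Complex (\<mu> * (1 - sin a1 * cosh R)) (\<mu> * (cos a1 * sinh R))"
      unfolding zm_def hyp_diff a1_def by (simp add: sin_Complex complex_eq_iff)
    \<comment> \<open>The end points are mirror images in the real axis, so both lie on one circle
      about \<open>\<sigma>\<close>, at the angles \<open>- \<beta>\<close> and
      \<open>\<beta>\<close>.\<close>
    have zp_eq: "zp - ?\<sigma> = cnj (zm - ?\<sigma>)"
      unfolding zm_eq unfolding zp_def hyp_diff a1_def by (simp add: sin_Complex complex_eq_iff)
    have zm_mod: "cmod (zm - ?\<sigma>) = \<rho>"
      unfolding zm_def hyp_dist[OF less_imp_le[OF \<mu>]] \<rho>_def a1_def by simp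
    have zm0: "zm - ?\<sigma> \<noteq> 0" using zm_mod \<rho>0 by auto
    have zm\<beta>: "zm - ?\<sigma> = \<rho> * cis \<beta>"
      using rcis_cmod_Arg[of "zm - ?\<sigma>"] unfolding \<beta>_def rcis_def zm_mod by simp
    have "0 < Im (zm - ?\<sigma>)" unfolding zm_eq using \<mu> sa Rpos by simp
    hence \<beta>: "0 < \<beta>" "\<beta> < pi" unfolding \<beta>_def using Arg_lt_pi[of "zm - ?\<sigma>"] by auto
    have zp\<beta>: "zp - ?\<sigma> = \<rho> * cis (- \<beta>)" unfolding zp_eq zm\<beta> by (simp add: cis_cnj)
    have line: "?\<gamma> z \<in> sector \<sigma> \<phi> \<and> Re (?\<gamma> z) < x0" if "Im z = - d" for z
    proof -
      have z: "z = Complex (Re z) (- d)" using that by (simp add: complex_eq_iff)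
      have "?\<gamma> z \<in> sector \<sigma> \<phi>" by (subst z, rule hyp_in_sector[OF \<mu> _ _ \<phi>]) (use a in auto)
      moreover have "Re (?\<gamma> z) \<le> \<sigma> + \<mu>" by (subst z, rule hyp_Re_le) (use \<mu> sa in \<open>auto simp: a1_def\<close>)
      ultimately show ?thesis using x0 by simp
    qed
    have zmS: "zm \<in> sector \<sigma> \<phi>" "Re zm < x0" unfolding zm_def using line[of "Complex (- R) (- d)"] by auto
    have cos\<beta>: "- cos \<phi> < cos \<beta>"
    proof -
      have "- cos \<phi> * \<rho> < Re (zm - ?\<sigma>)" using zmS(1) unfolding sector_def mem_Collect_eq zm_mod .
      hence "- cos \<phi> * \<rho> < \<rho> * cos \<beta>" unfolding zm\<beta> by simp
      hence "\<rho> * (- cos \<phi>) < \<rho> * cos \<beta>" by (simp add: mult.commute)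
      thus ?thesis using \<rho>0 by (simp only: mult_less_cancel_left_pos)
    qed
    let ?rarc = "part_circlepath ?\<sigma> \<rho> (- \<beta>) \<beta>" and ?larc = "part_circlepath ?\<sigma> \<rho> \<beta> (2 * pi - \<beta>)"
    \<comment> \<open>On the right arc \<open>cos t \<ge> cos \<beta>\<close>, so it stays in the
      sector with its end points; on the left arc \<open>cos t \<le> cos \<beta>\<close>, so that
      one stays in the half-plane.\<close>
    have rimg: "z \<in> sector \<sigma> \<phi> \<and> \<rho> / 2 \<le> cmod z" if zr: "z \<in> path_image ?rarc" for z
    proof -
      obtain t where t: "- \<beta> \<le> t" "t \<le> \<beta>" "z = ?\<sigma> + \<rho> * cis t"
        using arc_point[OF _ zr] \<beta> by auto
      have "cos \<beta> \<le> cos \<bar>t\<bar>" using t \<beta> by (intro cos_monotone_0_pi_le) auto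
      hence "cos \<beta> \<le> cos t" by simp
      hence "\<rho> * (- cos \<phi>) < \<rho> * cos t" using cos\<beta> \<rho>0 by (intro mult_strict_left_mono) auto
      hence 1: "z \<in> sector \<sigma> \<phi>" unfolding sector_def t(3) using \<rho>0 by (simp add: norm_mult mult.commute)
      have "\<rho> - \<bar>\<sigma>\<bar> \<le> cmod z"
        unfolding t(3) using norm_diff_ineq[of "\<rho> * cis t" ?\<sigma>] \<rho>0 by (simp add: norm_mult add.commute)
      thus ?thesis using 1 \<rho> KQ by auto
    qed
    have limg: "Re z < x0 \<and> \<rho> / 2 \<le> cmod z" if zr: "z \<in> path_image ?larc" for z
    proof -
      obtain t where t: "\<beta> \<le> t" "t \<le> 2 * pi - \<beta>" "z = ?\<sigma> + \<rho> * cis t"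
        using arc_point[OF _ zr] \<beta> by auto
      have "cos t \<le> cos \<beta>"
      proof (cases "t \<le> pi")
        case True
        thus ?thesis using t \<beta> by (intro cos_monotone_0_pi_le) auto
      next
        case False
        have "cos (2 * pi - t) \<le> cos \<beta>" using False t \<beta> by (intro cos_monotone_0_pi_le) auto
        thus ?thesis by simp
      qed
      hence "\<rho> * cos t \<le> \<rho> * cos \<beta>" using \<rho>0 by simp
      moreover have "Re zm = \<sigma> + \<rho> * cos \<beta>" using arg_cong[OF zm\<beta>, of Re] by simp
      ultimately have 1: "Re z < x0" unfolding t(3) using zmS(2) by simp
      have "\<rho> - \<bar>\<sigma>\<bar> \<le> cmod z"
        unfolding t(3) using norm_diff_ineq[of "\<rho> * cis t" ?\<sigma>] \<rho>0 by (simp add: norm_mult add.commute)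
      thus ?thesis using 1 \<rho> KQ by auto
    qed
    define B where "B = 4 * C1 / \<rho>\<^sup>2"
    have B0: "0 \<le> B" unfolding B_def using C1 by simp
    have far: "C0 \<le> cmod z" "C1 / (cmod z)\<^sup>2 \<le> B" if "\<rho> / 2 \<le> cmod z" for z
    proof -
      show "C0 \<le> cmod z" using that \<rho> KQ by linarith
      have "(\<rho> / 2)\<^sup>2 \<le> (cmod z)\<^sup>2" using that \<rho>0 by (intro power_mono) auto
      hence "C1 / (cmod z)\<^sup>2 \<le> C1 / (\<rho> / 2)\<^sup>2" using C1 \<rho>0 by (intro divide_left_mono mult_pos_pos) auto
      thus "C1 / (cmod z)\<^sup>2 \<le> B" unfolding B_def by (simp add: power_divide mult.commute)
    qed
    have r1: "contour_integral ?rarc su = G zm - G zp"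
    proof (rule contour_integral_unique)
      have "(su has_contour_integral (G (pathfinish ?rarc) - G (pathstart ?rarc))) ?rarc"
        by (rule contour_integral_primitive[of "sector \<sigma> \<phi>"])
           (use G rimg in \<open>auto intro: has_field_derivative_at_within\<close>)
      moreover have "pathfinish ?rarc = zm" "pathstart ?rarc = zp"
        using zm\<beta> zp\<beta> by (auto simp: cis_conv_exp algebra_simps)
      ultimately show "(su has_contour_integral (G zm - G zp)) ?rarc" by simp
    qed
    have l1: "contour_integral ?larc e = E zp - E zm"
    proof (rule contour_integral_unique)
      have "(e has_contour_integral (E (pathfinish ?larc) - E (pathstart ?larc))) ?larc"
        by (rule contour_integral_primitive[of ?H]) (use E limg in auto)
      moreover have "pathstart ?larc = zm" using zm\<beta> by (auto simp: cis_conv_exp algebra_simps)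
      moreover have "pathfinish ?larc = zp"
      proof -
        have "cis (2 * pi - \<beta>) = cis (- \<beta>)" by (simp add: complex_eq_iff)
        thus ?thesis using zp\<beta> by (simp add: cis_conv_exp algebra_simps)
      qed
      ultimately show "(e has_contour_integral (E zp - E zm)) ?larc" by simp
    qed
    have rb: "cmod (contour_integral ?rarc su - \<i> * p * complex_of_real (\<beta> - (- \<beta>))) \<le> B * \<rho> * (\<beta> - (- \<beta>))"
    proof (rule arc_integral_close[OF _ \<rho>0 _ _ B0])
      show "continuous_on (path_image ?rarc) su"
        by (rule continuous_on_subset[OF holomorphic_on_imp_continuous_on[OF su]]) (use rimg in auto)
      show "cmod (su z - p / (z - ?\<sigma>)) \<le> B" if "z \<in> path_image ?rarc" for z
        using far_su[of z] far[of z] rimg[OF that] by force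
    qed (use \<beta> in auto)
    have lb: "cmod (contour_integral ?larc e - \<i> * (- p) * complex_of_real ((2 * pi - \<beta>) - \<beta>)) \<le> B * \<rho> * ((2 * pi - \<beta>) - \<beta>)"
    proof (rule arc_integral_close[OF _ \<rho>0 _ _ B0])
      show "continuous_on (path_image ?larc) e"
        by (rule continuous_on_subset[OF holomorphic_on_imp_continuous_on[OF e]]) (use limg in auto)
      show "cmod (e z - (- p) / (z - ?\<sigma>)) \<le> B" if "z \<in> path_image ?larc" for z
        using far_e[of z] far[of z] limg[OF that] by force
    qed (use \<beta> in auto)
    let ?\<Phi> = "\<lambda>z. \<i> / (2 * complex_of_real pi) * hyp' \<alpha> \<mu> z * F (?\<gamma> z)"
    \<comment> \<open>The parameter runs from the upper end \<open>zm\<close> to the lower end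
      \<open>zp\<close>. This downward orientation is the reason for the prefactor
      \<open>\<i> / (2 * pi)\<close> in place of \<open>1 / (2 * pi * \<i>)\<close>.\<close>
    let ?P = "\<lambda>z. \<i> / (2 * complex_of_real pi) * (G (?\<gamma> z) + E (?\<gamma> z))"
    have "(?\<Phi> has_contour_integral (?P (pathfinish (linepath (Complex (- R) (- d)) (Complex R (- d))))
        - ?P (pathstart (linepath (Complex (- R) (- d)) (Complex R (- d)))))) (linepath (Complex (- R) (- d)) (Complex R (- d)))"
    proof (rule contour_integral_primitive[of "{z. Im z = - d}"])
      fix z assume "z \<in> {z. Im z = - d}"
      hence z: "?\<gamma> z \<in> sector \<sigma> \<phi>" "Re (?\<gamma> z) < x0" using line[of z] by auto
      have "((\<lambda>z. G (?\<gamma> z)) has_field_derivative su (?\<gamma> z) * hyp' \<alpha> \<mu> z) (at z)"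
        by (rule DERIV_chain2[OF G[OF z(1)] hyp_derivative])
      moreover have "((\<lambda>z. E (?\<gamma> z)) has_field_derivative e (?\<gamma> z) * hyp' \<alpha> \<mu> z) (at z)"
        by (rule DERIV_chain2[OF E' hyp_derivative]) (use z in auto)
      ultimately have "(?P has_field_derivative (\<i> / (2 * complex_of_real pi) * (su (?\<gamma> z) * hyp' \<alpha> \<mu> z + e (?\<gamma> z) * hyp' \<alpha> \<mu> z))) (at z)"
        by (intro DERIV_cmult DERIV_add)
      moreover have "\<i> / (2 * complex_of_real pi) * (su (?\<gamma> z) * hyp' \<alpha> \<mu> z + e (?\<gamma> z) * hyp' \<alpha> \<mu> z) = ?\<Phi> z"
        unfolding F[OF z] by (simp add: algebra_simps add_divide_distrib)
      ultimately show "(?P has_field_derivative ?\<Phi> z) (at z within {z. Im z = - d})"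
        by (simp only: has_field_derivative_at_within)
    qed (auto simp: closed_segment_same_Im)
    hence I: "contour_integral (linepath (Complex (- R) (- d)) (Complex R (- d))) ?\<Phi>
        = \<i> / (2 * complex_of_real pi) * ((G zp + E zp) - (G zm + E zm))"
      unfolding zp_def zm_def by (intro contour_integral_unique) (simp add: right_diff_distrib)
    define X where "X = contour_integral ?rarc su - \<i> * p * complex_of_real (\<beta> - (- \<beta>))"
    define Y where "Y = contour_integral ?larc e - \<i> * (- p) * complex_of_real ((2 * pi - \<beta>) - \<beta>)"
    \<comment> \<open>The right arc is traversed against its orientation. The opening angles
      \<open>2 * \<beta>\<close> and \<open>2 * pi - 2 * \<beta>\<close> add up to a full turn, so
      \<open>\<beta>\<close> drops out.\<close>
    have "(G zp + E zp) - (G zm + E zm) = contour_integral ?larc e - contour_integral ?rarc su"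
      unfolding r1 l1 by simp
    also have "\<dots> = Y - X - 2 * complex_of_real pi * \<i> * p" unfolding X_def Y_def by (simp add: algebra_simps)
    finally have D: "(G zp + E zp) - (G zm + E zm) = Y - X - 2 * complex_of_real pi * \<i> * p" .
    have "contour_integral (linepath (Complex (- R) (- d)) (Complex R (- d))) ?\<Phi> - p
        = \<i> / (2 * complex_of_real pi) * (Y - X)"
      unfolding I D by (simp add: field_simps)
    hence "cmod (contour_integral (linepath (Complex (- R) (- d)) (Complex R (- d))) ?\<Phi> - p)
        = cmod (Y - X) / (2 * pi)" by (simp add: norm_mult norm_divide)
    also have "\<dots> \<le> (cmod Y + cmod X) / (2 * pi)" by (intro divide_right_mono norm_triangle_ineq4) auto
    also have "\<dots> \<le> (B * \<rho> * ((2 * pi - \<beta>) - \<beta>) + B * \<rho> * (\<beta> - (- \<beta>))) / (2 * pi)"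
      using rb lb unfolding X_def Y_def by (intro divide_right_mono add_mono) auto
    also have "\<dots> = B * \<rho>" by (simp add: field_simps)
    also have "\<dots> = 4 * C1 / \<rho>" unfolding B_def using \<rho>0 by (simp add: power2_eq_square)
    also have "\<dots> \<le> \<epsilon>"
    proof -
      have "4 * C1 / \<epsilon> \<le> \<rho>" using \<rho> KQ unfolding Q_def[symmetric] by linarith
      thus ?thesis using \<epsilon> \<rho>0 by (simp add: field_simps)
    qed
    finally show ?thesis .
  qed
  thus ?thesis by auto
qed

section \<open>Quadrature on the hyperbola\<close>

text \<open>The rectangle compares the sum with the integral over its lower line
  \<open>Im z = - d\<close>. That line is mapped to another hyperbola of the family, so the full
  integral along it is already \<open>p\<close>. The term \<open>4 * d * Gt\<close> comes from the
  vertical sides, \<open>2 * Gt\<close> from the tails beyond \<open>\<Theta>\<close>.\<close>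

lemma hyperbola_quadrature:
  assumes \<mu>: "0 < \<mu>" and d: "0 < d" "d < d'" and a: "0 < \<alpha> - d'" "\<alpha> + d' < pi / 2 - \<phi>"
    and \<phi>: "0 < \<phi>" "\<phi> < pi / 2" and x0: "\<sigma> + \<mu> < x0"
    and su: "su holomorphic_on sector \<sigma> \<phi>" and e: "e holomorphic_on {z. Re z < x0}"
    and F: "\<And>z. z \<in> sector \<sigma> \<phi> \<Longrightarrow> Re z < x0 \<Longrightarrow> F z = su z + e z"
    and far_su: "\<And>z. z \<in> sector \<sigma> \<phi> \<Longrightarrow> C0 \<le> cmod z \<Longrightarrow> cmod (su z - p / (z - complex_of_real \<sigma>)) \<le> C1 / (cmod z)\<^sup>2"
    and far_e: "\<And>z. Re z < x0 \<Longrightarrow> C0 \<le> cmod z \<Longrightarrow> cmod (e z + p / (z - complex_of_real \<sigma>)) \<le> C1 / (cmod z)\<^sup>2"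
    and C1: "0 < C1"
    and \<Phi>_def: "\<And>z. \<Phi> z = \<i> / (2 * complex_of_real pi) * hyp' \<alpha> \<mu> z * F (hyp \<alpha> \<sigma> \<mu> z)"
    and \<tau>: "0 < \<tau>" and \<Theta>: "\<Theta> = (real K + 1 / 2) * \<tau>"
    and G: "\<And>x y. \<bar>y\<bar> \<le> d \<Longrightarrow> cmod (\<Phi> (Complex x y)) \<le> G"
    and Gt: "\<And>x y. \<bar>y\<bar> \<le> d \<Longrightarrow> \<Theta> \<le> \<bar>x\<bar> \<Longrightarrow> cmod (\<Phi> (Complex x y)) \<le> Gt * exp (- \<bar>x\<bar>)"
    and \<eta>: "\<eta> = exp (- (2 * pi * d / \<tau>))" "\<eta> \<le> 1 / 2"
  shows "cmod (p - complex_of_real \<tau> * (\<Sum>k\<in>{- int K..int K}. \<Phi> (complex_of_real (of_int k * \<tau>))))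
    \<le> 8 * \<Theta> * G * \<eta> + 4 * d * Gt + 2 * Gt"
proof -
  have \<Theta>0: "0 < \<Theta>" unfolding \<Theta> using \<tau> by (intro mult_pos_pos) auto
  have Gt0: "0 \<le> Gt"
  proof -
    have "0 \<le> Gt * exp (- \<bar>\<Theta>\<bar>)" by (rule order_trans[OF norm_ge_zero Gt[of 0 \<Theta>]]) (use d \<Theta>0 in auto)
    thus ?thesis by (simp add: zero_le_mult_iff)
  qed
  have strip: "hyp \<alpha> \<sigma> \<mu> z \<in> sector \<sigma> \<phi> \<and> Re (hyp \<alpha> \<sigma> \<mu> z) < x0" if "\<bar>Im z\<bar> < d'" for z
  proof -
    have z: "z = Complex (Re z) (Im z)" by simp
    have y: "0 < \<alpha> - Im z" "\<alpha> - Im z < pi / 2 - \<phi>" using that a by auto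
    have "hyp \<alpha> \<sigma> \<mu> z \<in> sector \<sigma> \<phi>" by (subst z, rule hyp_in_sector[OF \<mu> y \<phi>])
    moreover have "0 \<le> sin (\<alpha> - Im z)" using y \<phi> by (intro sin_ge_zero) auto
    hence "Re (hyp \<alpha> \<sigma> \<mu> z) \<le> \<sigma> + \<mu>" by (subst z, intro hyp_Re_le less_imp_le[OF \<mu>])
    ultimately show ?thesis using x0 by auto
  qed
  have hol: "\<Phi> holomorphic_on {z. \<bar>Im z\<bar> < d'}"
  proof -
    have "(\<lambda>z. \<i> / (2 * complex_of_real pi) * hyp' \<alpha> \<mu> z * ((su \<circ> hyp \<alpha> \<sigma> \<mu>) z + (e \<circ> hyp \<alpha> \<sigma> \<mu>) z)) holomorphic_on {z. \<bar>Im z\<bar> < d'}"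
      by (intro holomorphic_on_mult holomorphic_on_const holomorphic_on_add hyp'_holomorphic
          holomorphic_on_compose_gen[OF hyp_holomorphic su] holomorphic_on_compose_gen[OF hyp_holomorphic e])
         (use strip in auto)
    thus ?thesis by (rule holomorphic_transform) (use strip F in \<open>auto simp: \<Phi>_def\<close>)
  qed
  have cont: "continuous_on (closed_segment (Complex x (- d)) (Complex x' (- d))) \<Phi>" for x x'
    by (rule continuous_on_subset[OF holomorphic_on_imp_continuous_on[OF hol]])
       (use d in \<open>auto simp: closed_segment_same_Im\<close>)
  let ?I = "\<lambda>x x'. contour_integral (linepath (Complex x (- d)) (Complex x' (- d))) \<Phi>"
  let ?S = "complex_of_real \<tau> * (\<Sum>k\<in>{- int K..int K}. \<Phi> (complex_of_real (of_int k * \<tau>)))"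
  have "cmod (?S - ?I (- \<Theta>) \<Theta>) \<le> 8 * \<Theta> * G * \<eta> + 4 * d * Gt"
  proof (rule trapezoid_rectangle[OF \<tau> d hol \<Theta> _ _ _ \<eta>])
    have "Gt * exp (- \<Theta>) \<le> Gt * 1" using \<Theta>0 Gt0 by (intro mult_left_mono) auto
    hence 1: "Gt * exp (- \<bar>\<Theta>\<bar>) \<le> Gt" using \<Theta>0 by simp
    show "cmod (\<Phi> (Complex \<Theta> y)) \<le> Gt" if "\<bar>y\<bar> \<le> d" for y using Gt[OF that, of \<Theta>] \<Theta>0 1 by simp
    show "cmod (\<Phi> (Complex (- \<Theta>) y)) \<le> Gt" if "\<bar>y\<bar> \<le> d" for y using Gt[OF that, of "- \<Theta>"] \<Theta>0 1 by simp
  qed (use G in auto)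
  note trap = this
  \<comment> \<open>An arbitrary additional \<open>\<epsilon>\<close> stands in for the limit of the
    truncated integrals.\<close>
  have "cmod (p - ?S) \<le> (8 * \<Theta> * G * \<eta> + 4 * d * Gt + 2 * Gt) + \<epsilon>" if \<epsilon>: "0 < \<epsilon>" for \<epsilon>
  proof -
    have lim: "\<exists>R0. \<forall>R\<ge>R0. cmod (?I (- R) R - p) \<le> \<epsilon>"
    proof -
      have "\<Phi> = (\<lambda>z. \<i> / (2 * complex_of_real pi) * hyp' \<alpha> \<mu> z * F (hyp \<alpha> \<sigma> \<mu> z))" using \<Phi>_def by (simp add: fun_eq_iff)
      thus ?thesis
        using hyperbola_contour_limit[OF \<mu> _ _ \<phi> x0 su e F far_su far_e C1 \<epsilon>, of \<alpha> d] a d by simp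
    qed
    then obtain R0 where R0: "\<And>R. R0 \<le> R \<Longrightarrow> cmod (?I (- R) R - p) \<le> \<epsilon>" by auto
    define R where "R = max R0 (\<Theta> + 1)"
    have R: "R0 \<le> R" "\<Theta> < R" unfolding R_def by auto
    have "?I (- R) R = ?I (- R) (- \<Theta>) + ?I (- \<Theta>) R"
      by (rule contour_integral_split_linepath[OF cont])
         (use R \<Theta>0 in \<open>auto simp: closed_segment_same_Im closed_segment_eq_real_ivl\<close>)
    also have "?I (- \<Theta>) R = ?I (- \<Theta>) \<Theta> + ?I \<Theta> R"
      by (rule contour_integral_split_linepath[OF cont])
         (use R \<Theta>0 in \<open>auto simp: closed_segment_same_Im closed_segment_eq_real_ivl\<close>)
    finally have split: "?I (- R) R = ?I (- R) (- \<Theta>) + (?I (- \<Theta>) \<Theta> + ?I \<Theta> R)" .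
    have t1: "cmod (?I \<Theta> R) \<le> Gt"
    proof -
      have "cmod (?I \<Theta> R) \<le> Gt * (exp (- \<Theta>) - exp (- R))"
      proof (rule horizontal_tail_bound[OF cont R(2)])
        show "((\<lambda>x. Gt * exp (- x)) has_integral Gt * (exp (- \<Theta>) - exp (- R))) {\<Theta>..R}"
          by (intro has_integral_mult_right exp_neg_has_integral) (use R in auto)
        show "cmod (\<Phi> (Complex x (- d))) \<le> Gt * exp (- x)" if "\<Theta> \<le> x" "x \<le> R" for x
          using Gt[of "- d" x] that \<Theta>0 d by simp
      qed
      also have "\<dots> \<le> Gt * 1" using Gt0 \<Theta>0 by (intro mult_left_mono) (auto intro: order_trans[of _ "exp (- \<Theta>)"])
      finally show ?thesis by simp
    qed
    have t2: "cmod (?I (- R) (- \<Theta>)) \<le> Gt"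
    proof -
      have "cmod (?I (- R) (- \<Theta>)) \<le> Gt * (exp (- \<Theta>) - exp (- R))"
      proof (rule horizontal_tail_bound[OF cont])
        show "((\<lambda>x. Gt * exp x) has_integral Gt * (exp (- \<Theta>) - exp (- R))) {- R..- \<Theta>}"
          by (intro has_integral_mult_right exp_has_integral) (use R in auto)
        show "cmod (\<Phi> (Complex x (- d))) \<le> Gt * exp x" if "- R \<le> x" "x \<le> - \<Theta>" for x
          using Gt[of "- d" x] that \<Theta>0 d by simp
      qed (use R in auto)
      also have "\<dots> \<le> Gt * 1" using Gt0 \<Theta>0 by (intro mult_left_mono) (auto intro: order_trans[of _ "exp (- \<Theta>)"])
      finally show ?thesis by simp
    qed
    have "p - ?S = - (?I (- R) R - p) + ?I (- R) (- \<Theta>) + ?I \<Theta> R + - (?S - ?I (- \<Theta>) \<Theta>)"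
      unfolding split by (simp add: algebra_simps)
    also have "cmod \<dots> \<le> \<epsilon> + Gt + Gt + (8 * \<Theta> * G * \<eta> + 4 * d * Gt)"
      by (intro norm_triangle_mono t1 t2) (use R0[OF R(1)] trap in \<open>simp_all only: norm_minus_cancel\<close>)
    finally show ?thesis by simp
  qed
  thus ?thesis by (rule field_le_epsilon)
qed

text \<open>Monotonicity of \<open>(1 + y / m)\<^sup>m\<close> in \<open>m\<close>, which for real
  exponents follows from concavity of the logarithm. It lets \<open>n\<close> be replaced by the
  real number \<open>c * L\<close>.\<close>

lemma bernoulli_exp_ln:
  assumes m: "0 < m" "m \<le> real n" and y: "0 \<le> y" "y \<le> real n * x" and x: "0 \<le> x"
  shows "exp (m * ln (1 + y / m)) \<le> (1 + x) ^ n"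
proof -
  define t where "t = m / real n"
  define u where "u = y / m"
  have n: "0 < real n" using m by linarith
  have t: "0 < t" "t \<le> 1" unfolding t_def using m n by auto
  have u: "0 \<le> u" unfolding u_def using y m by simp
  have tu: "t * u \<le> x" unfolding t_def u_def using m n y by (simp add: field_simps)
  have "t * ln (1 + u) \<le> ln (1 + t * u)"
  proof -
    have "ln ((1 - t) * 1 + t * (1 + u)) \<ge> (1 - t) * ln 1 + t * ln (1 + u)"
      using concave_onD[OF ln_concave, of t 1 "1 + u"] t u by simp
    moreover have eq: "(1 - t) * 1 + t * (1 + u) = 1 + t * u" by (simp add: algebra_simps)
    ultimately show ?thesis unfolding eq by simp
  qed
  also have "\<dots> \<le> ln (1 + x)" using tu t u by (intro ln_mono add_pos_nonneg) auto
  finally have "real n * (t * ln (1 + u)) \<le> real n * ln (1 + x)" using n by simp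
  hence "m * ln (1 + y / m) \<le> real n * ln (1 + x)" unfolding t_def u_def using n by simp
  hence "exp (m * ln (1 + y / m)) \<le> exp (real n * ln (1 + x))" by simp
  also have "\<dots> = (1 + x) ^ n" using x by (simp add: exp_of_nat_mult)
  finally show ?thesis .
qed

text \<open>For large \<open>\<theta>\<close> the right-hand side grows like
  \<open>c * \<theta>\<close>; since \<open>c \<ge> 3\<close>, one whole \<open>\<theta>\<close> is
  left to absorb \<open>p\<close> and the offset \<open>c * w\<close>.\<close>

lemma log_cosh_dominates:
  assumes c: "3 \<le> c" and c\<^sub>4: "0 < c\<^sub>4"
  shows "\<exists>\<Theta>>0. \<forall>\<theta>\<ge>\<Theta>. p + 2 * \<theta> \<le> c * ln (1 + c\<^sub>4 * cosh \<theta> / (c :: real))"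
proof -
  define w where "w = ln (c\<^sub>4 / (2 * c))"
  define \<Theta> where "\<Theta> = \<bar>p\<bar> + c * \<bar>w\<bar> + 1"
  have "p + 2 * \<theta> \<le> c * ln (1 + c\<^sub>4 * cosh \<theta> / c)" if \<theta>: "\<Theta> \<le> \<theta>" for \<theta>
  proof -
    have "exp \<theta> / 2 \<le> cosh \<theta>" by (simp add: cosh_field_def)
    hence "c\<^sub>4 * (exp \<theta> / 2) / c \<le> c\<^sub>4 * cosh \<theta> / c" using c c\<^sub>4 by (intro divide_right_mono mult_left_mono) auto
    hence "c\<^sub>4 / (2 * c) * exp \<theta> \<le> 1 + c\<^sub>4 * cosh \<theta> / c" by simp
    hence "ln (c\<^sub>4 / (2 * c) * exp \<theta>) \<le> ln (1 + c\<^sub>4 * cosh \<theta> / c)" using c c\<^sub>4 by (intro ln_mono) auto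
    moreover have "ln (c\<^sub>4 / (2 * c) * exp \<theta>) = w + \<theta>" unfolding w_def using c c\<^sub>4 by (subst ln_mult) auto
    ultimately have 1: "c * (w + \<theta>) \<le> c * ln (1 + c\<^sub>4 * cosh \<theta> / c)" using c by simp
    have "0 \<le> c * \<bar>w\<bar>" using c by simp
    hence \<theta>0: "0 \<le> \<theta>" using \<theta> unfolding \<Theta>_def by linarith
    have "3 * \<theta> \<le> c * \<theta>" using c \<theta>0 by (rule mult_right_mono)
    moreover have "- (c * \<bar>w\<bar>) \<le> c * w" using c abs_le_iff[of w "\<bar>w\<bar>"] mult_left_mono[of "- \<bar>w\<bar>" w c] by simp
    moreover have "\<bar>p\<bar> + c * \<bar>w\<bar> \<le> \<theta>" using \<theta> unfolding \<Theta>_def by simp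
    moreover have "p \<le> \<bar>p\<bar>" by simp
    ultimately have "p + 2 * \<theta> \<le> c * w + c * \<theta>" by linarith
    thus ?thesis using 1 by (simp add: distrib_left)
  qed
  moreover have "0 < \<Theta>" unfolding \<Theta>_def using c by (intro add_nonneg_pos) auto
  ultimately show ?thesis by auto
qed

text \<open>Multiplies the inequality for exponent \<open>c\<close> by \<open>L\<close>. Because
  \<open>L \<ge> 1 / 2\<close>, the margin \<open>2 * \<theta>\<close> still yields one
  \<open>\<theta>\<close>, which becomes the integrable factor on the tails.\<close>

lemma decay_bound:
  assumes dom: "\<And>\<theta>. \<Theta> \<le> \<theta> \<Longrightarrow> p + 2 * \<theta> \<le> c * ln (1 + c\<^sub>4 * cosh \<theta> / c)"
    and L: "1 / 2 \<le> L" and c: "0 < c" and c\<^sub>4: "0 < c\<^sub>4" and \<Theta>: "0 < \<Theta>"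
    and n: "c * L \<le> real n" and X: "c\<^sub>4 * L * cosh \<theta> \<le> real n * X" and X0: "0 \<le> X"
    and \<theta>: "\<Theta> \<le> \<bar>\<theta>\<bar>"
  shows "exp (p * L + \<bar>\<theta>\<bar>) \<le> (1 + X) ^ n"
proof -
  have cL: "0 < c * L" using c L by (intro mult_pos_pos) auto
  have "p * L + \<bar>\<theta>\<bar> \<le> L * (p + 2 * \<bar>\<theta>\<bar>)"
    using mult_right_mono[OF L, of "2 * \<bar>\<theta>\<bar>"] by (simp add: algebra_simps)
  also have "\<dots> \<le> L * (c * ln (1 + c\<^sub>4 * cosh \<bar>\<theta>\<bar> / c))" using dom[OF \<theta>] L by (intro mult_left_mono) auto
  also have "\<dots> = (c * L) * ln (1 + (c\<^sub>4 * L * cosh \<theta>) / (c * L))" using L by (simp add: mult_ac)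
  finally have "exp (p * L + \<bar>\<theta>\<bar>) \<le> exp ((c * L) * ln (1 + (c\<^sub>4 * L * cosh \<theta>) / (c * L)))" by simp
  also have "\<dots> \<le> (1 + X) ^ n"
    by (rule bernoulli_exp_ln[OF cL n _ X X0]) (use c\<^sub>4 L in auto)
  finally show ?thesis .
qed

section \<open>From the hypotheses on \<open>A\<close> and on the method to scalar constants\<close>

lemma sectorial_sector:
  assumes sec: "sectorial N \<nu> M \<sigma> \<phi> A" and \<phi>: "0 < \<phi>" "\<phi> < pi / 2" and z: "z \<in> sector \<sigma> \<phi>"
  shows "invertible_mat (z \<cdot>\<^sub>m 1\<^sub>m N + A)" "op_norm N \<nu> (resolvent A z) \<le> M / cmod (z - complex_of_real \<sigma>)"
proof -
  let ?w = "z - complex_of_real \<sigma>"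
  have w: "- cos \<phi> * cmod ?w < Re ?w" using z unfolding sector_def by simp
  have w0: "?w \<noteq> 0" using w by auto
  have "Re ?w = cmod ?w * cos (Arg ?w)"
    using arg_cong[OF rcis_cmod_Arg[of ?w], of Re] by simp
  hence "cmod ?w * (- cos \<phi>) < cmod ?w * cos (Arg ?w)" using w by (simp add: mult.commute)
  moreover have wp: "0 < cmod ?w" using w0 by simp
  ultimately have "- cos \<phi> < cos (Arg ?w)" by (simp only: mult_less_cancel_left_pos[OF wp])
  hence cos: "cos (pi - \<phi>) < cos \<bar>Arg ?w\<bar>" by simp
  have "\<bar>Arg ?w\<bar> \<le> pi - \<phi>"
  proof (rule ccontr)
    assume "\<not> \<bar>Arg ?w\<bar> \<le> pi - \<phi>"
    hence "cos \<bar>Arg ?w\<bar> \<le> cos (pi - \<phi>)"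
      using \<phi> Arg_le_pi[of ?w] mpi_less_Arg[of ?w] by (intro cos_monotone_0_pi_le) auto
    thus False using cos by simp
  qed
  moreover have "z \<noteq> complex_of_real \<sigma>" using w0 by auto
  ultimately show "invertible_mat (z \<cdot>\<^sub>m 1\<^sub>m N + A)" "op_norm N \<nu> (resolvent A z) \<le> M / cmod (z - complex_of_real \<sigma>)"
    using sec unfolding sectorial_def by auto
qed

context runge_kutta
begin

lemma rk_constants:
  assumes \<kappa>: "0 < \<kappa>" "\<kappa> \<le> 1"
  obtains D P Q \<delta>\<^sub>1 C\<^sub>2 c\<^sub>2 C\<^sub>3 C R\<^sub>0 where
    "D \<noteq> 0" "0 < \<delta>\<^sub>1" "\<And>z. Re z < \<delta>\<^sub>1 \<Longrightarrow> poly D z \<noteq> 0"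
    "\<And>z. poly D z \<noteq> 0 \<Longrightarrow> rk_r \<O> b z = poly P z / poly D z"
    "\<And>z j. poly D z \<noteq> 0 \<Longrightarrow> j < m \<Longrightarrow> rk_q \<O> b j z = poly (Q j) z / poly D z"
    "rk_r \<O> b holomorphic_on {z. Re z < \<delta>\<^sub>1}"
    "0 \<le> C\<^sub>2" "0 < c\<^sub>2"
    "\<And>w \<delta>. Re w \<le> - \<kappa> * cmod w \<Longrightarrow> 0 \<le> \<delta> \<Longrightarrow> \<delta> \<le> \<delta>\<^sub>1 / 2 \<Longrightarrow>
      cmod (rk_r \<O> b (w + complex_of_real \<delta>)) \<le> (1 + C\<^sub>2 * \<delta>) / (1 + c\<^sub>2 * cmod w)"
    "0 < C\<^sub>3" "\<And>j z. j < m \<Longrightarrow> Re z \<le> \<delta>\<^sub>1 / 2 \<Longrightarrow> cmod (rk_q \<O> b j z) \<le> C\<^sub>3"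
    "0 < C" "0 < R\<^sub>0" "\<And>z. R\<^sub>0 \<le> cmod z \<Longrightarrow> cmod (rk_r \<O> b z) \<le> C / cmod z"
    "\<And>j z. j < m \<Longrightarrow> R\<^sub>0 \<le> cmod z \<Longrightarrow> cmod (rk_q \<O> b j z) \<le> C / cmod z"
proof -
  obtain D P Q where D: "D \<noteq> 0" "\<And>z. poly D z = 0 \<Longrightarrow> 0 < Re z"
    and rP: "\<And>z. poly D z \<noteq> 0 \<Longrightarrow> rk_r \<O> b z = poly P z / poly D z"
    and qQ: "\<And>z j. poly D z \<noteq> 0 \<Longrightarrow> j < m \<Longrightarrow> rk_q \<O> b j z = poly (Q j) z / poly D z"
    and Ic: "\<And>z. poly D z \<noteq> 0 \<Longrightarrow> minv (1\<^sub>m m - z \<cdot>\<^sub>m \<O>') \<in> carrier_mat m m"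
    using rk_rational by auto
  \<comment> \<open>The inserted \<open>1\<close> makes the set nonempty, so its minimum is
    meaningful before anything is known about the existence of zeros.\<close>
  define Z where "Z = insert 1 (Re ` {z. poly D z = 0})"
  have fZ: "finite Z" unfolding Z_def using poly_roots_finite[OF D(1)] by auto
  define \<delta>\<^sub>1 where "\<delta>\<^sub>1 = Min Z"
  have \<delta>\<^sub>1: "0 < \<delta>\<^sub>1" unfolding \<delta>\<^sub>1_def using fZ D(2) by (subst Min_gr_iff) (auto simp: Z_def)
  have nz: "poly D z \<noteq> 0" if "Re z < \<delta>\<^sub>1" for z
  proof
    assume "poly D z = 0"
    hence "\<delta>\<^sub>1 \<le> Re z" unfolding \<delta>\<^sub>1_def using fZ by (intro Min_le) (auto simp: Z_def)
    thus False using that by simp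
  qed
  have rat_hol: "(\<lambda>z. poly p z / poly D z) holomorphic_on {z. Re z < \<delta>\<^sub>1}" for p
    using nz holomorphic_on_poly_mult[of _ 1] by (intro holomorphic_on_divide) auto
  have rhol: "rk_r \<O> b holomorphic_on {z. Re z < \<delta>\<^sub>1}"
    by (rule holomorphic_transform[OF rat_hol[of P]]) (use rP nz in auto)
  have qhol: "rk_q \<O> b j holomorphic_on {z. Re z < \<delta>\<^sub>1}" if "j < m" for j
    by (rule holomorphic_transform[OF rat_hol[of "Q j"]]) (use qQ nz that in auto)
  obtain C R\<^sub>0 where C: "0 < C" "0 < R\<^sub>0"
    "\<And>z. R\<^sub>0 \<le> cmod z \<Longrightarrow> cmod (rk_r \<O> b z) \<le> C / cmod z"
    "\<And>j z. j < m \<Longrightarrow> R\<^sub>0 \<le> cmod z \<Longrightarrow> cmod (rk_q \<O> b j z) \<le> C / cmod z"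
    using rk_at_infinity by auto
  have r0: "rk_r \<O> b 0 = 1" using rk_r_sum[OF Ic[OF nz[of 0]]] \<delta>\<^sub>1 by simp
  have le1: "cmod (rk_r \<O> b z) \<le> 1" if "Re z \<le> 0" for z using L that unfolding L_stable_def by auto
  obtain C\<^sub>2 c\<^sub>2 where C\<^sub>2: "0 \<le> C\<^sub>2" "0 < c\<^sub>2"
    "\<And>w \<delta>. Re w \<le> - \<kappa> * cmod w \<Longrightarrow> 0 \<le> \<delta> \<Longrightarrow> \<delta> \<le> \<delta>\<^sub>1 / 2 \<Longrightarrow>
      cmod (rk_r \<O> b (w + complex_of_real \<delta>)) \<le> (1 + C\<^sub>2 * \<delta>) / (1 + c\<^sub>2 * cmod w)"
    using sector_stability_bound[OF rhol \<delta>\<^sub>1 der r0 le1 C(1,2,3) \<kappa>] by auto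
  have "\<exists>B>0. \<forall>z. Re z \<le> \<delta>\<^sub>1 / 2 \<longrightarrow> cmod (rk_q \<O> b j z) \<le> B" if j: "j < m" for j
    by (rule half_plane_bounded[OF continuous_on_subset[OF holomorphic_on_imp_continuous_on[OF qhol[OF j]]] C(4)[OF j] C(1,2)])
       (use \<delta>\<^sub>1 in auto)
  then obtain B where B: "\<And>j. j < m \<Longrightarrow> 0 < B j" "\<And>j z. j < m \<Longrightarrow> Re z \<le> \<delta>\<^sub>1 / 2 \<Longrightarrow> cmod (rk_q \<O> b j z) \<le> B j"
    by metis
  define C\<^sub>3 where "C\<^sub>3 = (\<Sum>j<m. B j) + 1"
  have C\<^sub>3: "0 < C\<^sub>3" unfolding C\<^sub>3_def using B(1) by (intro add_nonneg_pos sum_nonneg) (auto intro: less_imp_le)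
  have qb: "cmod (rk_q \<O> b j z) \<le> C\<^sub>3" if "j < m" "Re z \<le> \<delta>\<^sub>1 / 2" for j z
  proof -
    have "B j \<le> (\<Sum>j<m. B j)" by (rule member_le_sum) (use that B(1) in \<open>auto intro: less_imp_le\<close>)
    thus ?thesis unfolding C\<^sub>3_def using B(2)[OF that] by simp
  qed
  show ?thesis by (rule that[OF D(1) \<delta>\<^sub>1 nz rP qQ rhol C\<^sub>2 C\<^sub>3 qb C])
qed

end

lemma quad_error_functional:
  assumes \<psi>: "resolvent_functional N \<nu> A \<psi>" and v: "v \<in> carrier_vec N"
    and F: "(rat_fun_mat (rk_r \<O> b) (complex_of_real (- h) \<cdot>\<^sub>m A)) ^\<^sub>m n *
       rat_fun_mat (rk_q \<O> b j) (complex_of_real (- h) \<cdot>\<^sub>m A) \<in> carrier_mat N N" (is "?F \<in> _")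
    and pts: "\<And>k. quad_point \<alpha> \<sigma> \<mu> \<tau> k \<in> resolvent_functional.R N A"
  shows "quad_error \<O> b \<alpha> \<sigma> \<mu> \<tau> K h n A j \<in> carrier_mat N N" (is ?A)
    "\<psi> (quad_error \<O> b \<alpha> \<sigma> \<mu> \<tau> K h n A j *\<^sub>v v) = \<psi> (?F *\<^sub>v v) -
      complex_of_real \<tau> * (\<Sum>k\<in>{- int K..int K}. \<i> / (2 * complex_of_real pi) * hyp' \<alpha> \<mu> (complex_of_real (of_int k * \<tau>)) *
        (rk_r \<O> b (complex_of_real h * hyp \<alpha> \<sigma> \<mu> (complex_of_real (of_int k * \<tau>))) ^ n *
         rk_q \<O> b j (complex_of_real h * hyp \<alpha> \<sigma> \<mu> (complex_of_real (of_int k * \<tau>))) *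
         resolvent_functional.s A \<psi> v (hyp \<alpha> \<sigma> \<mu> (complex_of_real (of_int k * \<tau>)))))" (is ?B)
proof -
  interpret resolvent_functional N \<nu> A \<psi> by (rule \<psi>)
  have dim: "dim_row A = N" using A by simp
  have pt: "quad_point \<alpha> \<sigma> \<mu> \<tau> k = hyp \<alpha> \<sigma> \<mu> (complex_of_real (of_int k * \<tau>))" for k
    unfolding quad_point_def hyp_of_real ..
  have wt: "quad_weight \<alpha> \<sigma> \<mu> \<tau> k = complex_of_real \<tau> * (\<i> / (2 * complex_of_real pi) * hyp' \<alpha> \<mu> (complex_of_real (of_int k * \<tau>)))" for k
    unfolding quad_weight_def hyperbola_derivative by simp
  define c where "c k = quad_weight \<alpha> \<sigma> \<mu> \<tau> k * rk_r \<O> b (complex_of_real h * quad_point \<alpha> \<sigma> \<mu> \<tau> k) ^ n *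
      rk_q \<O> b j (complex_of_real h * quad_point \<alpha> \<sigma> \<mu> \<tau> k)" for k
  define S where "S = mat_sum N (\<lambda>k. c k \<cdot>\<^sub>m resolvent A (quad_point \<alpha> \<sigma> \<mu> \<tau> k)) {- int K..int K}"
  have E: "quad_error \<O> b \<alpha> \<sigma> \<mu> \<tau> K h n A j = ?F - S"
    unfolding quad_error_def Let_def dim S_def c_def ..
  have tc: "c k \<cdot>\<^sub>m resolvent A (quad_point \<alpha> \<sigma> \<mu> \<tau> k) \<in> carrier_mat N N" for k
    using resolvent_inverse(1)[OF pts] by simp
  have S: "S \<in> carrier_mat N N" unfolding S_def by (rule mat_sum_closed) (use tc in auto)
  show ?A unfolding E by (rule minus_carrier_mat[OF S])
  have Sv: "S *\<^sub>v v \<in> carrier_vec N" and Fv: "?F *\<^sub>v v \<in> carrier_vec N"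
    using mult_mat_vec_carrier[OF S v] mult_mat_vec_carrier[OF F v] .
  have "(?F - S) *\<^sub>v v = ?F *\<^sub>v v - S *\<^sub>v v" by (rule minus_mult_distrib_mat_vec[OF F S v])
  also have "\<dots> = ?F *\<^sub>v v + (- 1) \<cdot>\<^sub>v (S *\<^sub>v v)" using Sv Fv by (intro eq_vecI) auto
  finally have "(?F - S) *\<^sub>v v = ?F *\<^sub>v v + (- 1) \<cdot>\<^sub>v (S *\<^sub>v v)" .
  hence "\<psi> ((?F - S) *\<^sub>v v) = \<psi> (?F *\<^sub>v v) - \<psi> (S *\<^sub>v v)"
    using \<psi>_add[OF Fv, of "(- 1) \<cdot>\<^sub>v (S *\<^sub>v v)"] \<psi>_smult[OF Sv, of "- 1"] Sv by simp
  also have "\<psi> (S *\<^sub>v v) = (\<Sum>k\<in>{- int K..int K}. \<psi> ((c k \<cdot>\<^sub>m resolvent A (quad_point \<alpha> \<sigma> \<mu> \<tau> k)) *\<^sub>v v))"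
    unfolding S_def by (rule mat_sum_mult_vec[OF _ tc v \<psi>_add]) auto
  also have "\<dots> = (\<Sum>k\<in>{- int K..int K}. c k * s v (quad_point \<alpha> \<sigma> \<mu> \<tau> k))"
    by (intro sum.cong refl)
       (simp add: s_def smult_mult_mat_vec[OF resolvent_inverse(1)[OF pts] v] \<psi>_smult resolvent_vec(1)[OF pts v])
  finally show ?B unfolding E c_def wt pt by (simp add: sum_distrib_left mult_ac)
qed

section \<open>The quadrature error\<close>

text \<open>A negative \<open>\<sigma>\<close> only moves the hyperbola deeper into the left sector, which is why the
  stability bound does not deteriorate with \<open>T\<close> when \<open>\<sigma> \<le> 0\<close>.\<close>

lemma hyp_stability:
  assumes stab: "\<And>w \<delta>. Re w \<le> - sin (\<alpha> - d) * cmod w \<Longrightarrow> 0 \<le> \<delta> \<Longrightarrow> \<delta> \<le> \<delta>\<^sub>0 \<Longrightarrow>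
      cmod (r (w + complex_of_real \<delta>)) \<le> (1 + C\<^sub>2 * \<delta>) / (1 + c\<^sub>2 * cmod w)"
    and C\<^sub>2: "0 \<le> C\<^sub>2" and c\<^sub>2: "0 < c\<^sub>2" and \<alpha>: "0 < \<alpha> - d" "\<alpha> + d < pi / 2"
    and h: "0 < h" and \<mu>: "0 < \<mu>" and \<delta>: "h * \<mu> + h * max \<sigma> 0 \<le> \<delta>\<^sub>0" and y: "\<bar>y\<bar> \<le> d"
  shows "cmod (r (complex_of_real h * hyp \<alpha> \<sigma> \<mu> (Complex x y)))
      \<le> (1 + C\<^sub>2 * (h * \<mu> + h * max \<sigma> 0)) / (1 + c\<^sub>2 * sin (\<alpha> - d) * (h * \<mu> * cosh x))" (is ?A)
    "Re (complex_of_real h * hyp \<alpha> \<sigma> \<mu> (Complex x y)) \<le> \<delta>\<^sub>0" (is ?B)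
proof -
  define a where "a = \<alpha> - y"
  define s0 where "s0 = sin (\<alpha> - d)"
  define \<delta> where "\<delta> = h * \<mu> + h * max \<sigma> 0"
  \<comment> \<open>Here \<open>w\<close> takes the sine and the negative part of
    \<open>\<sigma>\<close>, both leading into the left sector, while \<open>\<delta>\<close> takes
    the constant term of the hyperbola and the positive part of \<open>\<sigma>\<close>.\<close>
  define w where "w = - complex_of_real (h * \<mu>) * sin (Complex a x) + complex_of_real (h * min \<sigma> 0)"
  have s0: "0 < s0" "s0 \<le> 1" unfolding s0_def using \<alpha> y by (auto intro!: sin_gt_zero)
  have s0a: "s0 \<le> sin a" unfolding s0_def a_def using \<alpha> y by (intro sin_monotone_2pi_le) auto
  have hm: "0 < h * \<mu>" using h \<mu> by simp
  have neg: "h * min \<sigma> 0 \<le> 0" using h by (simp add: mult_le_0_iff)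
  have eq: "complex_of_real h * hyp \<alpha> \<sigma> \<mu> (Complex x y) = w + complex_of_real \<delta>"
  proof -
    have 1: "complex_of_real \<sigma> = complex_of_real (min \<sigma> 0) + complex_of_real (max \<sigma> 0)"
      by (cases "\<sigma> \<le> 0") auto
    have 2: "hyp \<alpha> \<sigma> \<mu> (Complex x y) = complex_of_real \<mu> * (1 - sin (Complex a x)) + complex_of_real \<sigma>"
      unfolding hyp_def hyp_arg a_def ..
    show ?thesis unfolding w_def \<delta>_def 2 by (subst 1) (simp add: algebra_simps)
  qed
  have Rew: "Re w = - (h * \<mu> * (sin a * cosh x)) + h * min \<sigma> 0"
    unfolding w_def by (simp add: sin_Complex)
  have c1: "h * \<mu> * (s0 * cosh x) \<le> h * \<mu> * (sin a * cosh x)"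
    using s0a hm by (intro mult_left_mono mult_right_mono) auto
  have "cmod w \<le> h * \<mu> * cosh x - h * min \<sigma> 0"
  proof -
    have "cmod w \<le> cmod (- complex_of_real (h * \<mu>) * sin (Complex a x)) + cmod (complex_of_real (h * min \<sigma> 0))"
      unfolding w_def by (rule norm_triangle_ineq)
    also have "cmod (complex_of_real (h * min \<sigma> 0)) = - (h * min \<sigma> 0)" using neg by (simp only: norm_of_real)
    also have "cmod (- complex_of_real (h * \<mu>) * sin (Complex a x)) = h * \<mu> * cmod (sin (Complex a x))"
      using hm by (simp only: norm_mult norm_minus_cancel norm_of_real abs_of_pos)
    also have "\<dots> \<le> h * \<mu> * cosh x" by (rule mult_left_mono[OF cmod_sin_le]) (use hm in simp)
    finally show ?thesis by simp
  qed
  hence "s0 * cmod w \<le> s0 * (h * \<mu> * cosh x - h * min \<sigma> 0)" using s0(1) by simp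
  also have "\<dots> \<le> h * \<mu> * (s0 * cosh x) - h * min \<sigma> 0"
    using mult_right_mono[OF s0(2), of "- (h * min \<sigma> 0)"] neg by (simp add: algebra_simps)
  finally have sec: "Re w \<le> - sin (\<alpha> - d) * cmod w" using c1 unfolding Rew s0_def by simp
  have \<delta>0: "0 \<le> \<delta>" unfolding \<delta>_def using h \<mu> by auto
  have low: "h * \<mu> * (s0 * cosh x) \<le> cmod w"
    using abs_Re_le_cmod[of w] c1 neg unfolding Rew by linarith
  have "cmod (r (w + complex_of_real \<delta>)) \<le> (1 + C\<^sub>2 * \<delta>) / (1 + c\<^sub>2 * cmod w)"
    by (rule stab[OF sec \<delta>0]) (use \<delta> in \<open>simp add: \<delta>_def\<close>)
  also have "\<dots> \<le> (1 + C\<^sub>2 * \<delta>) / (1 + c\<^sub>2 * s0 * (h * \<mu> * cosh x))"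
  proof (rule divide_left_mono)
    show "1 + c\<^sub>2 * s0 * (h * \<mu> * cosh x) \<le> 1 + c\<^sub>2 * cmod w"
      using mult_left_mono[OF low, of c\<^sub>2] c\<^sub>2 by (simp add: mult_ac)
    show "0 \<le> 1 + C\<^sub>2 * \<delta>" using C\<^sub>2 \<delta>0 by simp
    show "0 < (1 + c\<^sub>2 * cmod w) * (1 + c\<^sub>2 * s0 * (h * \<mu> * cosh x))"
      using c\<^sub>2 s0 h \<mu> by (intro mult_pos_pos add_pos_nonneg mult_nonneg_nonneg) auto
  qed
  finally show ?A unfolding eq \<delta>_def s0_def .
  have "0 \<le> h * \<mu> * (s0 * cosh x)" using hm s0 by simp
  hence "Re w \<le> 0" using c1 neg unfolding Rew by linarith
  thus ?B unfolding eq using \<delta> unfolding \<delta>_def by simp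
qed

context resolvent_functional
begin

text \<open>The leading term at infinity, expanded about \<open>\<sigma>\<close>, comes from
  \<open>(z - \<sigma>) * s v z = \<psi> v - s u z\<close> with \<open>u = A v + \<sigma> v\<close>.
  The Neumann bound for \<open>u\<close> then gives the second order remainder.\<close>

lemma s_far:
  obtains C where "0 < C" "\<And>z. C \<le> cmod z \<Longrightarrow> z \<in> R"
    "\<And>z v. v \<in> carrier_vec N \<Longrightarrow> C \<le> cmod z \<Longrightarrow> cmod (s v z) \<le> 2 * \<nu> v / cmod z"
    "\<And>z v. v \<in> carrier_vec N \<Longrightarrow> C \<le> cmod z \<Longrightarrow> 2 * \<bar>\<sigma>\<bar> \<le> cmod z \<Longrightarrow> cmod (s v z - \<psi> v / (z - complex_of_real \<sigma>))
      \<le> 4 * \<nu> (A *\<^sub>v v + complex_of_real \<sigma> \<cdot>\<^sub>v v) / (cmod z)\<^sup>2"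
proof -
  obtain C where C: "0 < C" "\<And>z. C \<le> cmod z \<Longrightarrow> z \<in> R"
    "\<And>z v. C \<le> cmod z \<Longrightarrow> v \<in> carrier_vec N \<Longrightarrow> cmod (s v z) \<le> 2 * \<nu> v / cmod z"
    using resolvent_large by auto
  have "cmod (s v z - \<psi> v / (z - complex_of_real \<sigma>)) \<le> 4 * \<nu> (A *\<^sub>v v + complex_of_real \<sigma> \<cdot>\<^sub>v v) / (cmod z)\<^sup>2"
    if v: "v \<in> carrier_vec N" and z: "C \<le> cmod z" "2 * \<bar>\<sigma>\<bar> \<le> cmod z" for z v
  proof -
    let ?u = "A *\<^sub>v v + complex_of_real \<sigma> \<cdot>\<^sub>v v"
    have Av: "A *\<^sub>v v \<in> carrier_vec N" by (rule mult_mat_vec_carrier[OF A v])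
    have u: "?u \<in> carrier_vec N" using Av v by simp
    have zR: "z \<in> R" by (rule C(2)[OF z(1)])
    have z0: "0 < cmod z" using z C(1) by linarith
    have half: "cmod z / 2 \<le> cmod (z - complex_of_real \<sigma>)"
      using norm_triangle_ineq2[of z "complex_of_real \<sigma>"] z(2) by simp
    hence nz: "z - complex_of_real \<sigma> \<noteq> 0" using z0 by auto
    have "s ?u z = \<psi> v - z * s v z + complex_of_real \<sigma> * s v z"
      using s_add[OF zR Av, of "complex_of_real \<sigma> \<cdot>\<^sub>v v"] s_mult_A[OF zR v] s_smult[OF zR v] v by simp
    hence "s v z * (z - complex_of_real \<sigma>) = \<psi> v - s ?u z" by (simp add: algebra_simps)
    hence "s v z = (\<psi> v - s ?u z) / (z - complex_of_real \<sigma>)" using nz by (simp add: eq_divide_eq)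
    hence "s v z - \<psi> v / (z - complex_of_real \<sigma>) = - s ?u z / (z - complex_of_real \<sigma>)"
      by (simp add: diff_divide_distrib)
    hence "cmod (s v z - \<psi> v / (z - complex_of_real \<sigma>)) = cmod (s ?u z) / cmod (z - complex_of_real \<sigma>)"
      by (simp add: norm_divide)
    also have "\<dots> \<le> (2 * \<nu> ?u / cmod z) / (cmod z / 2)"
      using C(3)[OF z(1) u] half z0 vec_norm_nonneg[OF vec_norm u] by (intro frac_le) auto
    also have "\<dots> = 4 * \<nu> ?u / (cmod z)\<^sup>2" by (simp add: power2_eq_square)
    finally show ?thesis .
  qed
  thus ?thesis using that[OF C(1,2)] C(3) by auto
qed

end

context runge_kutta
begin

text \<open>The far-field constants \<open>C0\<close> and \<open>C1\<close> depend on
  \<open>A\<close> and \<open>v\<close>, but they serve a limit only and leave no trace in the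
  bound. There \<open>A\<close> is felt through the resolvent constant \<open>M\<close>
  alone.\<close>

lemma quad_error_bound:
  assumes D: "D \<noteq> 0" and \<delta>\<^sub>1: "0 < \<delta>\<^sub>1" and nz: "\<And>z. Re z < \<delta>\<^sub>1 \<Longrightarrow> poly D z \<noteq> 0"
    and rP: "\<And>z. poly D z \<noteq> 0 \<Longrightarrow> rk_r \<O> b z = poly P z / poly D z"
    and qQ: "\<And>z j. poly D z \<noteq> 0 \<Longrightarrow> j < m \<Longrightarrow> rk_q \<O> b j z = poly (Q j) z / poly D z"
    and rhol: "rk_r \<O> b holomorphic_on {z. Re z < \<delta>\<^sub>1}"
    and C\<^sub>2: "0 \<le> C\<^sub>2" and c\<^sub>2: "0 < c\<^sub>2"
    and stab: "\<And>w \<delta>. Re w \<le> - sin (\<alpha> - d) * cmod w \<Longrightarrow> 0 \<le> \<delta> \<Longrightarrow> \<delta> \<le> \<delta>\<^sub>1 / 2 \<Longrightarrow>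
      cmod (rk_r \<O> b (w + complex_of_real \<delta>)) \<le> (1 + C\<^sub>2 * \<delta>) / (1 + c\<^sub>2 * cmod w)"
    and C\<^sub>3: "0 < C\<^sub>3" and qb: "\<And>j z. j < m \<Longrightarrow> Re z \<le> \<delta>\<^sub>1 / 2 \<Longrightarrow> cmod (rk_q \<O> b j z) \<le> C\<^sub>3"
    and C: "0 < C" "0 < R\<^sub>0" and rdec: "\<And>z. R\<^sub>0 \<le> cmod z \<Longrightarrow> cmod (rk_r \<O> b z) \<le> C / cmod z"
    and qdec: "\<And>j z. j < m \<Longrightarrow> R\<^sub>0 \<le> cmod z \<Longrightarrow> cmod (rk_q \<O> b j z) \<le> C / cmod z"
    and N: "0 < N" and \<nu>: "is_vec_norm N \<nu>" and A: "A \<in> carrier_mat N N" and sec: "sectorial N \<nu> M \<sigma> \<phi> A"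
    and M: "0 < M" and \<phi>: "0 < \<phi>" "\<phi> < pi / 2"
    and d: "0 < d" "d < d'" "0 < \<alpha> - d'" "\<alpha> + d' < pi / 2 - \<phi>"
    and h: "0 < h" and \<mu>: "0 < \<mu>" and \<delta>: "h * \<mu> + h * max \<sigma> 0 \<le> \<delta>\<^sub>1 / 2"
    and \<tau>: "0 < \<tau>" and \<Theta>: "\<Theta> = (real K + 1 / 2) * \<tau>"
    and \<eta>: "\<eta> = exp (- (2 * pi * d / \<tau>))" "\<eta> \<le> 1 / 2"
    and Gr: "(1 + C\<^sub>2 * (h * \<mu> + h * max \<sigma> 0)) ^ n \<le> Gr"
    and tail: "\<And>x. \<Theta> \<le> \<bar>x\<bar> \<Longrightarrow> exp (p * L + \<bar>x\<bar>) \<le> (1 + c\<^sub>2 * sin (\<alpha> - d) * (h * \<mu> * cosh x)) ^ n"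
    and j: "j < m"
  shows "op_norm N \<nu> (quad_error \<O> b \<alpha> \<sigma> \<mu> \<tau> K h n A j)
    \<le> M * C\<^sub>3 / (2 * pi * (1 - sin (\<alpha> + d))) * Gr * (8 * \<Theta> * \<eta> + (4 * d + 2) * exp (- (p * L)))"
proof -
  let ?E = "quad_error \<O> b \<alpha> \<sigma> \<mu> \<tau> K h n A j"
  let ?F = "(rat_fun_mat (rk_r \<O> b) (complex_of_real (- h) \<cdot>\<^sub>m A)) ^\<^sub>m n *
       rat_fun_mat (rk_q \<O> b j) (complex_of_real (- h) \<cdot>\<^sub>m A)"
  define H where "H = {z :: complex. Re z < \<delta>\<^sub>1 / h}"
  have Hh: "Re (complex_of_real h * z) < \<delta>\<^sub>1 \<longleftrightarrow> z \<in> H" for z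
    unfolding H_def using h by (simp add: field_simps)
  have \<sigma>h: "h * \<sigma> + h * \<mu> \<le> \<delta>\<^sub>1 / 2"
  proof -
    have "h * \<sigma> \<le> h * max \<sigma> 0" using h by (intro mult_left_mono) auto
    thus ?thesis using \<delta> by simp
  qed
  have hm: "0 < h * \<mu>" using h \<mu> by simp
  have x0: "\<sigma> + \<mu> < \<delta>\<^sub>1 / h" using \<sigma>h \<delta>\<^sub>1 h by (simp add: field_simps)
  define f where "f z = rk_r \<O> b (complex_of_real h * z) ^ n * rk_q \<O> b j (complex_of_real h * z)" for z
  have Fc_and_bound: "?E \<in> carrier_mat N N \<and> cmod (\<psi> (?E *\<^sub>v v))
    \<le> (M * C\<^sub>3 / (2 * pi * (1 - sin (\<alpha> + d))) * Gr * (8 * \<Theta> * \<eta> + (4 * d + 2) * exp (- (p * L)))) * \<nu> v"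
    if psi: "resolvent_functional N \<nu> A \<psi>" and v: "v \<in> carrier_vec N" for \<psi> v
  proof -
    interpret resolvent_functional N \<nu> A \<psi> by (rule psi)
    have secR: "sector \<sigma> \<phi> \<subseteq> R" unfolding R_def using sectorial_sector(1)[OF sec \<phi>] by auto
    \<comment> \<open>Poles of \<open>f\<close> lie right of the hyperbola and of
      \<open>\<sigma>\<close>, hence in the sector, where sectoriality supplies the
      resolvent.\<close>
    have roots: "z \<in> R" if "poly D (complex_of_real h * z) = 0" for z
    proof -
      have "\<not> Re (complex_of_real h * z) < \<delta>\<^sub>1" using nz that by auto
      hence "\<delta>\<^sub>1 / h \<le> Re z" using h by (simp add: field_simps)
      hence "0 < Re (z - complex_of_real \<sigma>)" using x0 \<mu> by simp
      moreover have "- cos \<phi> * cmod (z - complex_of_real \<sigma>) \<le> 0" using \<phi> by (simp add: cos_gt_zero_pi less_imp_le)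
      ultimately have "z \<in> sector \<sigma> \<phi>" unfolding sector_def by simp
      thus ?thesis using secR by auto
    qed
    have hne: "h \<noteq> 0" using h by simp
    have Hnz: "poly D (complex_of_real h * z) \<noteq> 0" if "z \<in> H" for z using nz Hh that by auto
    have rep_r: "represents H (\<lambda>z. rk_r \<O> b (complex_of_real h * z)) (rat_fun_mat (rk_r \<O> b) (complex_of_real (- h) \<cdot>\<^sub>m A))"
      by (rule represents_rational[OF N rP D Hnz hne roots])
    have rep_q: "represents H (\<lambda>z. rk_q \<O> b j (complex_of_real h * z)) (rat_fun_mat (rk_q \<O> b j) (complex_of_real (- h) \<cdot>\<^sub>m A))"
      by (rule represents_rational[OF N qQ[OF _ j] D Hnz hne roots])
    have hol_r: "(\<lambda>z. rk_r \<O> b (complex_of_real h * z)) holomorphic_on H"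
    proof -
      have "(rk_r \<O> b \<circ> (\<lambda>z. complex_of_real h * z)) holomorphic_on H"
        by (rule holomorphic_on_compose_gen[OF _ rhol]) (use Hh in \<open>auto intro!: holomorphic_intros\<close>)
      thus ?thesis by (simp add: o_def)
    qed
    have "represents H (\<lambda>z. rk_r \<O> b (complex_of_real h * z) ^ n * rk_q \<O> b j (complex_of_real h * z)) ?F"
      by (rule represents_mult[OF represents_power[OF rep_r hol_r] rep_q]) (intro holomorphic_intros hol_r)
    hence rep: "represents H f ?F" unfolding f_def .
    have Fc: "?F \<in> carrier_mat N N" using rep unfolding represents_def by simp
    obtain e where e: "e holomorphic_on H" "\<And>z. z \<in> R \<Longrightarrow> z \<in> H \<Longrightarrow> f z * s v z = s (?F *\<^sub>v v) z + e z"
      using representsE[OF rep v] by metis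
    let ?u = "?F *\<^sub>v v"
    have u: "?u \<in> carrier_vec N" by (rule mult_mat_vec_carrier[OF Fc v])
    \<comment> \<open>Far out \<open>r\<close> has modulus at most \<open>1\<close>, so the decay of
      \<open>f\<close> is that of \<open>q\<close>, uniformly in \<open>n\<close>, also for
      \<open>n = 0\<close>.\<close>
    have fb: "cmod (f z) \<le> C / (h * cmod z)" if "R\<^sub>0 + C \<le> h * cmod z" for z
    proof -
      have hz: "cmod (complex_of_real h * z) = h * cmod z" using h by (simp add: norm_mult)
      have big: "R\<^sub>0 \<le> cmod (complex_of_real h * z)" "0 < h * cmod z" using that C unfolding hz by auto
      have "cmod (rk_r \<O> b (complex_of_real h * z)) \<le> C / (h * cmod z)" using rdec[OF big(1)] unfolding hz .
      also have "\<dots> \<le> 1" using that C big(2) by simp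
      finally have "cmod (rk_r \<O> b (complex_of_real h * z)) ^ n \<le> 1" by (intro power_le_one) auto
      hence "cmod (f z) \<le> 1 * (C / (h * cmod z))"
        unfolding f_def norm_mult norm_power using qdec[OF j big(1)] unfolding hz by (intro mult_mono) auto
      thus ?thesis by simp
    qed
    obtain Cs where Cs: "0 < Cs" "\<And>z. Cs \<le> cmod z \<Longrightarrow> z \<in> R"
      "\<And>z v. v \<in> carrier_vec N \<Longrightarrow> Cs \<le> cmod z \<Longrightarrow> cmod (s v z) \<le> 2 * \<nu> v / cmod z"
      "\<And>z v. v \<in> carrier_vec N \<Longrightarrow> Cs \<le> cmod z \<Longrightarrow> 2 * \<bar>\<sigma>\<bar> \<le> cmod z \<Longrightarrow> cmod (s v z - \<psi> v / (z - complex_of_real \<sigma>))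
        \<le> 4 * \<nu> (A *\<^sub>v v + complex_of_real \<sigma> \<cdot>\<^sub>v v) / (cmod z)\<^sup>2"
      using s_far[of \<sigma>] by auto
    define C0 where "C0 = Cs + 2 * \<bar>\<sigma>\<bar> + (R\<^sub>0 + C) / h"
    define Cu where "Cu = 4 * \<nu> (A *\<^sub>v ?u + complex_of_real \<sigma> \<cdot>\<^sub>v ?u)"
    define C1 where "C1 = Cu + 2 * \<nu> v * C / h + 1"
    have RC: "0 \<le> (R\<^sub>0 + C) / h" using C h by simp
    have big: "Cs \<le> cmod z" "2 * \<bar>\<sigma>\<bar> \<le> cmod z" "R\<^sub>0 + C \<le> h * cmod z" if "C0 \<le> cmod z" for z
    proof -
      show "Cs \<le> cmod z" "2 * \<bar>\<sigma>\<bar> \<le> cmod z" using that RC Cs(1) abs_ge_zero[of \<sigma>] unfolding C0_def by linarith+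
      have "(R\<^sub>0 + C) / h \<le> cmod z" using that Cs(1) abs_ge_zero[of \<sigma>] unfolding C0_def by linarith
      thus "R\<^sub>0 + C \<le> h * cmod z" using h by (simp add: field_simps)
    qed
    have Cu0: "0 \<le> Cu" unfolding Cu_def
      using vec_norm_nonneg[OF \<nu>, of "A *\<^sub>v ?u + complex_of_real \<sigma> \<cdot>\<^sub>v ?u"] mult_mat_vec_carrier[OF A u] u by simp
    have vC0: "0 \<le> 2 * \<nu> v * C / h" using vec_norm_nonneg[OF \<nu> v] C h by simp
    have C1: "0 < C1" unfolding C1_def using Cu0 vC0 by simp
    have su_far: "cmod (s ?u z - \<psi> ?u / (z - complex_of_real \<sigma>)) \<le> Cu / (cmod z)\<^sup>2" if "C0 \<le> cmod z" for z
      unfolding Cu_def by (rule Cs(4)[OF u big(1)[OF that] big(2)[OF that]])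
    have far_su: "cmod (s ?u z - \<psi> ?u / (z - complex_of_real \<sigma>)) \<le> C1 / (cmod z)\<^sup>2" if "C0 \<le> cmod z" for z
    proof -
      have "Cu / (cmod z)\<^sup>2 \<le> C1 / (cmod z)\<^sup>2" unfolding C1_def using vC0 by (intro divide_right_mono) auto
      thus ?thesis using su_far[OF that] by simp
    qed
    \<comment> \<open>The product \<open>f \<cdot> s v\<close> is of second order at infinity, so
      the leading term of \<open>e\<close> must be the negative of that of
      \<open>s ?u\<close>.\<close>
    have far_e: "cmod (e z + \<psi> ?u / (z - complex_of_real \<sigma>)) \<le> C1 / (cmod z)\<^sup>2"
      if z: "Re z < \<delta>\<^sub>1 / h" "C0 \<le> cmod z" for z
    proof -
      note bz = big[OF z(2)]
      have z0: "0 < cmod z" using bz(1) Cs(1) by linarith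
      have "e z + \<psi> ?u / (z - complex_of_real \<sigma>) = f z * s v z - (s ?u z - \<psi> ?u / (z - complex_of_real \<sigma>))"
        using e(2)[OF Cs(2)[OF bz(1)]] z(1) unfolding H_def by simp
      hence "cmod (e z + \<psi> ?u / (z - complex_of_real \<sigma>)) \<le> cmod (f z * s v z) + cmod (s ?u z - \<psi> ?u / (z - complex_of_real \<sigma>))"
        by (simp only: norm_triangle_ineq4)
      also have "cmod (f z * s v z) \<le> (C / (h * cmod z)) * (2 * \<nu> v / cmod z)"
        unfolding norm_mult using fb[OF bz(3)] Cs(3)[OF v bz(1)] C h z0 by (intro mult_mono) auto
      also have "\<dots> = 2 * \<nu> v * C / h / (cmod z)\<^sup>2" by (simp add: power2_eq_square mult_ac)
      also have "cmod (s ?u z - \<psi> ?u / (z - complex_of_real \<sigma>)) \<le> Cu / (cmod z)\<^sup>2" by (rule su_far[OF z(2)])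
      also have "2 * \<nu> v * C / h / (cmod z)\<^sup>2 + Cu / (cmod z)\<^sup>2 \<le> C1 / (cmod z)\<^sup>2"
        unfolding C1_def add_divide_distrib[symmetric] by (intro divide_right_mono) auto
      finally show ?thesis by simp
    qed
    define Fs where "Fs z = f z * s v z" for z
    define \<Phi> where "\<Phi> z = \<i> / (2 * complex_of_real pi) * hyp' \<alpha> \<mu> z * Fs (hyp \<alpha> \<sigma> \<mu> z)" for z
    define G0 where "G0 = M * C\<^sub>3 / (2 * pi * (1 - sin (\<alpha> + d))) * \<nu> v"
    have sin1: "sin (\<alpha> + d) < 1"
    proof -
      have "sin (\<alpha> + d) < sin (pi / 2)" using d \<phi> by (intro sin_monotone_2pi) auto
      thus ?thesis by simp
    qed
    have G00: "0 \<le> G0" unfolding G0_def using M C\<^sub>3 sin1 vec_norm_nonneg[OF \<nu> v] by simp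
    have Gr0: "0 \<le> Gr"
    proof -
      have "0 \<le> (1 + C\<^sub>2 * (h * \<mu> + h * max \<sigma> 0)) ^ n"
        using C\<^sub>2 h \<mu> by (intro zero_le_power add_nonneg_nonneg mult_nonneg_nonneg) auto
      thus ?thesis using Gr by linarith
    qed
    \<comment> \<open>The estimate is uniform in \<open>\<mu>\<close>: the growth
      \<open>\<mu> * cosh x\<close> of \<open>hyp'\<close> cancels against the resolvent bound, as
      the distance to \<open>\<sigma>\<close> is at least
      \<open>\<mu> * (1 - sin (\<alpha> + d)) * cosh x\<close>.\<close>
    have \<Phi>_bound: "cmod (\<Phi> (Complex x y)) \<le> G0 * Gr / (1 + c\<^sub>2 * sin (\<alpha> - d) * (h * \<mu> * cosh x)) ^ n"
      if y: "\<bar>y\<bar> \<le> d" for x y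
    proof -
      let ?z = "hyp \<alpha> \<sigma> \<mu> (Complex x y)" and ?X = "1 + c\<^sub>2 * sin (\<alpha> - d) * (h * \<mu> * cosh x)"
      have \<alpha>d: "0 < \<alpha> - d" "\<alpha> + d < pi / 2" using d \<phi> by auto
      note st = hyp_stability[OF stab C\<^sub>2 c\<^sub>2 \<alpha>d h \<mu> \<delta> y, of x]
      have X: "0 < ?X" using c\<^sub>2 h \<mu> \<alpha>d d by (intro add_pos_nonneg mult_nonneg_nonneg sin_ge_zero) auto
      have "cmod (rk_r \<O> b (complex_of_real h * ?z)) ^ n
          \<le> ((1 + C\<^sub>2 * (h * \<mu> + h * max \<sigma> 0)) / ?X) ^ n" by (rule power_mono[OF st(1)]) auto
      also have "\<dots> \<le> Gr / ?X ^ n" unfolding power_divide using Gr X by (intro divide_right_mono) auto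
      finally have fz: "cmod (f ?z) \<le> Gr / ?X ^ n * C\<^sub>3"
        unfolding f_def norm_mult norm_power using qb[OF j st(2)] Gr0 X by (intro mult_mono) auto
      have zs: "?z \<in> sector \<sigma> \<phi>" by (rule hyp_in_sector[OF \<mu> _ _ \<phi>]) (use y d in auto)
      have dist: "\<mu> * (1 - sin (\<alpha> + d)) * cosh x \<le> cmod (?z - complex_of_real \<sigma>)"
      proof -
        have "sin (\<alpha> - y) \<le> sin (\<alpha> + d)" using y d \<phi> by (intro sin_monotone_2pi_le) auto
        moreover have "0 \<le> sin (\<alpha> + d)" using d \<phi> by (intro sin_ge_zero) auto
        hence "sin (\<alpha> + d) * 1 \<le> sin (\<alpha> + d) * cosh x" using cosh_real_ge_1[of x] by (intro mult_left_mono) auto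
        ultimately have "(1 - sin (\<alpha> + d)) * cosh x \<le> cosh x - sin (\<alpha> - y)" by (simp add: algebra_simps)
        thus ?thesis unfolding hyp_dist[OF less_imp_le[OF \<mu>]] using \<mu> by (simp add: mult.assoc)
      qed
      have pos: "0 < \<mu> * (1 - sin (\<alpha> + d)) * cosh x" using \<mu> sin1 by (intro mult_pos_pos) auto
      have "cmod (s v ?z) \<le> op_norm N \<nu> (resolvent A ?z) * \<nu> v" by (rule s_bound[OF _ v]) (use zs secR in auto)
      also have "\<dots> \<le> M / cmod (?z - complex_of_real \<sigma>) * \<nu> v"
        using sectorial_sector(2)[OF sec \<phi> zs] vec_norm_nonneg[OF \<nu> v] by (rule mult_right_mono)
      also have "\<dots> \<le> M / (\<mu> * (1 - sin (\<alpha> + d)) * cosh x) * \<nu> v"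
        by (intro mult_right_mono divide_left_mono dist mult_pos_pos[OF less_le_trans[OF pos dist] pos])
           (use M vec_norm_nonneg[OF \<nu> v] in auto)
      finally have sz: "cmod (s v ?z) \<le> M / (\<mu> * (1 - sin (\<alpha> + d)) * cosh x) * \<nu> v" .
      have hz: "cmod (hyp' \<alpha> \<mu> (Complex x y)) \<le> \<mu> * cosh x"
        unfolding hyp'_def hyp_arg using mult_left_mono[OF cmod_cos_le[of "\<alpha> - y" x], of \<mu>] \<mu> by (simp add: norm_mult)
      have "cmod (\<Phi> (Complex x y)) = 1 / (2 * pi) * cmod (hyp' \<alpha> \<mu> (Complex x y)) * (cmod (f ?z) * cmod (s v ?z))"
        unfolding \<Phi>_def Fs_def by (simp add: norm_mult norm_divide)
      also have "\<dots> \<le> 1 / (2 * pi) * (\<mu> * cosh x) * ((Gr / ?X ^ n * C\<^sub>3) * (M / (\<mu> * (1 - sin (\<alpha> + d)) * cosh x) * \<nu> v))"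
        using hz fz sz \<mu> Gr0 X C\<^sub>3 by (intro mult_mono mult_left_mono mult_nonneg_nonneg) auto
      also have "\<dots> = G0 * Gr / ?X ^ n" 
      proof -
        have alg: "1 / (2 * pi) * a * ((g / x * q) * (M / (a * k) * l)) = M * q / (2 * pi * k) * l * g / x"
          if "0 < a" "0 < k" for a g x q k l :: real using that by (simp add: mult_ac)
        have eq: "\<mu> * (1 - sin (\<alpha> + d)) * cosh x = (\<mu> * cosh x) * (1 - sin (\<alpha> + d))" by simp
        show ?thesis unfolding G0_def eq by (rule alg) (use \<mu> sin1 in auto)
      qed
      finally show ?thesis .
    qed
    have G: "cmod (\<Phi> (Complex x y)) \<le> G0 * Gr" if y: "\<bar>y\<bar> \<le> d" for x y
    proof -
      have "1 \<le> 1 + c\<^sub>2 * sin (\<alpha> - d) * (h * \<mu> * cosh x)"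
        using c\<^sub>2 hm d \<phi> sin_ge_zero[of "\<alpha> - d"] by simp
      hence "1 \<le> (1 + c\<^sub>2 * sin (\<alpha> - d) * (h * \<mu> * cosh x)) ^ n" by (rule one_le_power)
      hence "G0 * Gr / (1 + c\<^sub>2 * sin (\<alpha> - d) * (h * \<mu> * cosh x)) ^ n \<le> G0 * Gr / 1"
        using G00 Gr0 by (intro divide_left_mono) auto
      thus ?thesis using \<Phi>_bound[OF y, of x] by simp
    qed
    have Gt: "cmod (\<Phi> (Complex x y)) \<le> G0 * Gr * exp (- (p * L)) * exp (- \<bar>x\<bar>)" if y: "\<bar>y\<bar> \<le> d" and x: "\<Theta> \<le> \<bar>x\<bar>" for x y
    proof -
      have "G0 * Gr / (1 + c\<^sub>2 * sin (\<alpha> - d) * (h * \<mu> * cosh x)) ^ n \<le> G0 * Gr / exp (p * L + \<bar>x\<bar>)"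
        using tail[OF x] G00 Gr0 by (intro divide_left_mono mult_pos_pos) (auto intro: less_le_trans[OF exp_gt_zero])
      also have "\<dots> = G0 * Gr * exp (- (p * L)) * exp (- \<bar>x\<bar>)" by (simp add: exp_add exp_minus field_simps)
      finally show ?thesis using \<Phi>_bound[OF y, of x] by simp
    qed
    have quad: "cmod (\<psi> ?u - complex_of_real \<tau> * (\<Sum>k\<in>{- int K..int K}. \<Phi> (complex_of_real (of_int k * \<tau>))))
        \<le> 8 * \<Theta> * (G0 * Gr) * \<eta> + 4 * d * (G0 * Gr * exp (- (p * L))) + 2 * (G0 * Gr * exp (- (p * L)))"
    proof (rule hyperbola_quadrature[OF \<mu> d(1,2,3,4) \<phi> x0 _ _ _ _ _ C1 \<Phi>_def \<tau> \<Theta> G Gt \<eta>])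
      show "s ?u holomorphic_on sector \<sigma> \<phi>" by (rule s_holomorphic[OF open_sector secR u])
      show "e holomorphic_on {z. Re z < \<delta>\<^sub>1 / h}" using e(1) unfolding H_def .
      show "Fs z = s ?u z + e z" if "z \<in> sector \<sigma> \<phi>" "Re z < \<delta>\<^sub>1 / h" for z
        unfolding Fs_def by (rule e(2)) (use that secR in \<open>auto simp: H_def\<close>)
      show "cmod (s ?u z - \<psi> ?u / (z - complex_of_real \<sigma>)) \<le> C1 / (cmod z)\<^sup>2" if "C0 \<le> cmod z" for z
        by (rule far_su[OF that])
      show "cmod (e z + \<psi> ?u / (z - complex_of_real \<sigma>)) \<le> C1 / (cmod z)\<^sup>2"
        if "Re z < \<delta>\<^sub>1 / h" "C0 \<le> cmod z" for z by (rule far_e[OF that])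
    qed
    have pts: "quad_point \<alpha> \<sigma> \<mu> \<tau> k \<in> R" for k
    proof -
      have "quad_point \<alpha> \<sigma> \<mu> \<tau> k = hyp \<alpha> \<sigma> \<mu> (Complex (of_int k * \<tau>) 0)"
        unfolding quad_point_def hyp_of_real[symmetric] by (simp add: complex_of_real_def)
      thus ?thesis using hyp_in_sector[OF \<mu> _ _ \<phi>, of \<alpha> 0 \<sigma>] d secR by auto
    qed
    note err = quad_error_functional[OF psi v Fc pts, of K]
    have "cmod (\<psi> (?E *\<^sub>v v)) \<le> 8 * \<Theta> * (G0 * Gr) * \<eta> + 4 * d * (G0 * Gr * exp (- (p * L))) + 2 * (G0 * Gr * exp (- (p * L)))"
      using quad unfolding err(2) \<Phi>_def Fs_def f_def .
    also have "\<dots> = (M * C\<^sub>3 / (2 * pi * (1 - sin (\<alpha> + d))) * Gr * (8 * \<Theta> * \<eta> + (4 * d + 2) * exp (- (p * L)))) * \<nu> v"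
      unfolding G0_def by (simp add: algebra_simps add_divide_distrib)
    finally show ?thesis using err(1) by simp
  qed
  show ?thesis
  proof (rule op_norm_le[OF \<nu> N])
    fix v :: "complex vec" assume v: "v \<in> carrier_vec N"
    \<comment> \<open>The norming functional depends on the error matrix applied to
      \<open>v\<close>, so its carrier is obtained first, by means of the zero functional.\<close>
    have zero: "resolvent_functional N \<nu> A (\<lambda>_. 0)"
      by unfold_locales (use \<nu> A vec_norm_nonneg[OF \<nu>] in auto)
    have Ec: "?E \<in> carrier_mat N N" using Fc_and_bound[OF zero v] by simp
    obtain \<psi> where \<psi>: "\<And>v w. v \<in> carrier_vec N \<Longrightarrow> w \<in> carrier_vec N \<Longrightarrow> \<psi> (v + w) = \<psi> v + \<psi> w"
      "\<And>v c. v \<in> carrier_vec N \<Longrightarrow> \<psi> (c \<cdot>\<^sub>v v) = c * \<psi> v"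
      "\<And>v. v \<in> carrier_vec N \<Longrightarrow> cmod (\<psi> v) \<le> \<nu> v" "cmod (\<psi> (?E *\<^sub>v v)) = \<nu> (?E *\<^sub>v v)"
      by (rule norming_functional[OF \<nu> mult_mat_vec_carrier[OF Ec v], OF that])
    have "resolvent_functional N \<nu> A \<psi>" by unfold_locales (use \<nu> A \<psi> in auto)
    from Fc_and_bound[OF this v] show "\<nu> (?E *\<^sub>v v)
      \<le> (M * C\<^sub>3 / (2 * pi * (1 - sin (\<alpha> + d))) * Gr * (8 * \<Theta> * \<eta> + (4 * d + 2) * exp (- (p * L)))) * \<nu> v"
      unfolding \<psi>(4) by simp
  qed
qed

text \<open>The final time enters only through the growth factor
  \<open>exp (C\<^sub>2 * \<omega>)\<close> with \<open>T * max \<sigma> 0 \<le> \<omega>\<close>. A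
  fixed \<open>T\<close> is covered by taking equality; for \<open>\<sigma> \<le> 0\<close> the
  choice \<open>\<omega> = 0\<close> admits all \<open>T\<close> at once.\<close>

lemma quad_uniform:
  fixes B :: nat and M \<sigma> \<phi> \<alpha> \<omega> :: real
  assumes B: "1 < B" and M: "0 < M" and \<phi>: "0 < \<phi>" "\<phi> < pi / 2" and \<alpha>: "0 < \<alpha>" "\<alpha> < pi / 2 - \<phi>"
    and \<omega>: "0 \<le> \<omega>"
  obtains c h\<^sub>0 \<kappa> where "0 < c" "0 < h\<^sub>0" "0 < \<kappa>"
    "\<And>\<epsilon>. 0 < \<epsilon> \<Longrightarrow> \<epsilon> \<le> 1 / 2 \<Longrightarrow> \<exists>(K::nat) \<tau>. 1 \<le> K \<and> real K \<le> \<kappa> * ln (1 / \<epsilon>) \<and> 0 < \<tau> \<and>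
      (\<forall>T. T * max \<sigma> 0 \<le> \<omega> \<longrightarrow> quad_accurate \<O> b B M \<sigma> \<phi> \<alpha> T c h\<^sub>0 \<epsilon> K \<tau>)"
proof -
  \<comment> \<open>Half of the distance from \<open>\<alpha>\<close> to the ends of the admissible
    interval of angles, which leaves room for the slightly larger open strip of half-width
    \<open>d'\<close>.\<close>
  define d where "d = min \<alpha> (pi / 2 - \<phi> - \<alpha>) / 2"
  define d' where "d' = 3 / 2 * d"
  have d: "0 < d" "d < d'" "0 < \<alpha> - d'" "\<alpha> + d' < pi / 2 - \<phi>"
  proof -
    have "0 < d" "d \<le> \<alpha> / 2" "d \<le> (pi / 2 - \<phi> - \<alpha>) / 2" using \<alpha> unfolding d_def by auto
    moreover from this have "\<alpha> + 2 * d \<le> pi / 2 - \<phi>" by (simp add: field_simps)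
    ultimately show "0 < d" "d < d'" "0 < \<alpha> - d'" "\<alpha> + d' < pi / 2 - \<phi>"
      unfolding d'_def using \<alpha> by linarith+
  qed
  define s0 where "s0 = sin (\<alpha> - d)"
  have s0: "0 < s0" "s0 \<le> 1" unfolding s0_def using d \<phi> by (auto intro!: sin_gt_zero)
  have sin1: "sin (\<alpha> + d) < 1"
  proof -
    have "sin (\<alpha> + d) < sin (pi / 2)" using d \<phi> \<alpha> by (intro sin_monotone_2pi) auto
    thus ?thesis by simp
  qed
  obtain D P Q \<delta>\<^sub>1 C\<^sub>2 c\<^sub>2 C\<^sub>3 C R\<^sub>0 where
    D: "D \<noteq> 0" and \<delta>\<^sub>1: "0 < \<delta>\<^sub>1" and nz: "\<And>z. Re z < \<delta>\<^sub>1 \<Longrightarrow> poly D z \<noteq> 0"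
    and rP: "\<And>z. poly D z \<noteq> 0 \<Longrightarrow> rk_r \<O> b z = poly P z / poly D z"
    and qQ: "\<And>z j. poly D z \<noteq> 0 \<Longrightarrow> j < m \<Longrightarrow> rk_q \<O> b j z = poly (Q j) z / poly D z"
    and rhol: "rk_r \<O> b holomorphic_on {z. Re z < \<delta>\<^sub>1}"
    and C\<^sub>2: "0 \<le> C\<^sub>2" and c\<^sub>2: "0 < c\<^sub>2"
    and stab: "\<And>w \<delta>. Re w \<le> - s0 * cmod w \<Longrightarrow> 0 \<le> \<delta> \<Longrightarrow> \<delta> \<le> \<delta>\<^sub>1 / 2 \<Longrightarrow>
      cmod (rk_r \<O> b (w + complex_of_real \<delta>)) \<le> (1 + C\<^sub>2 * \<delta>) / (1 + c\<^sub>2 * cmod w)"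
    and C\<^sub>3: "0 < C\<^sub>3" and qb: "\<And>j z. j < m \<Longrightarrow> Re z \<le> \<delta>\<^sub>1 / 2 \<Longrightarrow> cmod (rk_q \<O> b j z) \<le> C\<^sub>3"
    and C: "0 < C" "0 < R\<^sub>0" and rdec: "\<And>z. R\<^sub>0 \<le> cmod z \<Longrightarrow> cmod (rk_r \<O> b z) \<le> C / cmod z"
    and qdec: "\<And>j z. j < m \<Longrightarrow> R\<^sub>0 \<le> cmod z \<Longrightarrow> cmod (rk_q \<O> b j z) \<le> C / cmod z"
    by (rule rk_constants[OF s0, OF that])
  \<comment> \<open>The value \<open>3\<close> is what the tails need;
    \<open>4 / \<delta>\<^sub>1\<close> gives \<open>h * \<mu> \<le> \<delta>\<^sub>1 / 4\<close> as
    soon as \<open>c * L \<le> n\<close>.\<close>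
  define c where "c = max 3 (4 / \<delta>\<^sub>1)"
  have c: "3 \<le> c" "4 / \<delta>\<^sub>1 \<le> c" "0 < c" unfolding c_def by auto
  \<comment> \<open>Reserves the other quarter,
    \<open>h * max \<sigma> 0 \<le> \<delta>\<^sub>1 / 4\<close>.\<close>
  define h\<^sub>0 where "h\<^sub>0 = \<delta>\<^sub>1 / (4 * (\<bar>\<sigma>\<bar> + 1))"
  have h\<^sub>0: "0 < h\<^sub>0" unfolding h\<^sub>0_def using \<delta>\<^sub>1 by simp
  \<comment> \<open>The division by \<open>B\<close> is the loss over one time interval, at whose
    lower end \<open>n * h * \<mu>\<close> is only \<open>L / B\<close>.\<close>
  define c\<^sub>4 where "c\<^sub>4 = c\<^sub>2 * s0 / real B"
  have c\<^sub>4: "0 < c\<^sub>4" unfolding c\<^sub>4_def using c\<^sub>2 s0 B by simp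
  define G0 where "G0 = M * C\<^sub>3 / (2 * pi * (1 - sin (\<alpha> + d))) * exp (C\<^sub>2 * \<omega>)"
  have G0: "0 < G0" unfolding G0_def using M C\<^sub>3 sin1 by (intro mult_pos_pos divide_pos_pos) auto
  define Z where "Z = ln (1 + 2 * G0 * (4 * d + 2))"
  have pd: "0 < 2 * G0 * (4 * d + 2)" using G0 d by (intro mult_pos_pos) auto
  have Z: "0 \<le> Z" unfolding Z_def using pd by simp
  \<comment> \<open>Here \<open>C\<^sub>2\<close> offsets the growth
    \<open>exp (C\<^sub>2 * L)\<close>, the \<open>1\<close> supplies the factor
    \<open>\<epsilon>\<close>, and \<open>2 * Z\<close> beats the constant prefactor; it is doubled
    because \<open>L\<close> is only known to be at least \<open>1 / 2\<close>.\<close>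
  define p where "p = C\<^sub>2 + 1 + 2 * Z"
  obtain \<Theta>\<^sub>0 where \<Theta>\<^sub>0: "0 < \<Theta>\<^sub>0" "\<And>\<theta>. \<Theta>\<^sub>0 \<le> \<theta> \<Longrightarrow> p + 2 * \<theta> \<le> c * ln (1 + c\<^sub>4 * cosh \<theta> / c)"
    using log_cosh_dominates[OF c(1) c\<^sub>4, of p] by auto
  \<comment> \<open>An upper bound for the actual abscissa: rounding and the half step add at most
    \<open>3 / 2 * \<tau>\<close>, and \<open>\<tau> \<le> 4 * pi * d\<close> uses only
    \<open>1 \<le> q\<close>. Hence this bound is available before \<open>q\<close> is
    fixed.\<close>
  define \<Theta>\<^sub>m where "\<Theta>\<^sub>m = \<Theta>\<^sub>0 + 6 * pi * d"
  have \<Theta>\<^sub>m: "0 < \<Theta>\<^sub>m" unfolding \<Theta>\<^sub>m_def using \<Theta>\<^sub>0 d by (intro add_pos_pos) auto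
  define Y where "Y = ln (1 + 2 * G0 * (8 * \<Theta>\<^sub>m))"
  have pY: "0 < 2 * G0 * (8 * \<Theta>\<^sub>m)" using G0 \<Theta>\<^sub>m by (intro mult_pos_pos) auto
  have Y: "0 \<le> Y" unfolding Y_def using pY by simp
  define q where "q = C\<^sub>2 + 1 + 2 * Y"
  have q1: "1 \<le> q" unfolding q_def using C\<^sub>2 Y by simp
  \<comment> \<open>The first term is \<open>\<Theta>\<^sub>0 / \<tau>\<close> divided by
    \<open>L\<close>; the \<open>2\<close> pays for rounding up, as
    \<open>2 * L \<ge> 1\<close>.\<close>
  define \<kappa> where "\<kappa> = \<Theta>\<^sub>0 * q / (2 * pi * d) + 2"
  have \<kappa>: "0 < \<kappa>" unfolding \<kappa>_def using \<Theta>\<^sub>0 q1 d by (intro add_nonneg_pos divide_nonneg_pos) auto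
  \<comment> \<open>The common recipe behind \<open>p\<close> and \<open>q\<close>: a prefactor
    \<open>a * G0\<close> is beaten by \<open>1 / (1 + 2 * G0 * a)\<close>, which leaves half of
    \<open>\<epsilon>\<close>.\<close>
  have small: "a * (G0 * exp (C\<^sub>2 * L) * exp (- ((C\<^sub>2 + 1 + 2 * ln (1 + 2 * G0 * a)) * L))) \<le> exp (- L) / 2"
    if "1 / 2 \<le> L" "0 < 2 * G0 * a" for a L
  proof -
    let ?w = "ln (1 + 2 * G0 * a)"
    have w: "0 \<le> ?w" using that(2) by simp
    have a: "0 < a" using that(2) G0 by (simp add: zero_less_mult_iff)
    have "exp (C\<^sub>2 * L) * exp (- ((C\<^sub>2 + 1 + 2 * ?w) * L)) = exp (- L) * exp (- (2 * ?w * L))"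
      by (simp add: exp_add[symmetric] algebra_simps)
    also have "\<dots> \<le> exp (- L) * exp (- ?w)"
      using mult_left_mono[OF that(1), of "2 * ?w"] w by (intro mult_left_mono) auto
    also have "exp (- ?w) = 1 / (1 + 2 * G0 * a)" using that(2) by (simp add: exp_minus inverse_eq_divide)
    finally have "exp (C\<^sub>2 * L) * exp (- ((C\<^sub>2 + 1 + 2 * ?w) * L)) \<le> exp (- L) * (1 / (1 + 2 * G0 * a))" .
    hence "(a * G0) * (exp (C\<^sub>2 * L) * exp (- ((C\<^sub>2 + 1 + 2 * ?w) * L))) \<le> (a * G0) * (exp (- L) * (1 / (1 + 2 * G0 * a)))"
      using a G0 by (intro mult_left_mono) auto
    also have "\<dots> = exp (- L) * (a * G0 / (1 + 2 * G0 * a))" by simp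
    also have "\<dots> \<le> exp (- L) * (1 / 2)"
      using that(2) by (intro mult_left_mono) (auto simp: field_simps)
    finally show ?thesis by (simp add: mult_ac)
  qed
  have main: "\<exists>(K::nat) \<tau>. 1 \<le> K \<and> real K \<le> \<kappa> * ln (1 / \<epsilon>) \<and> 0 < \<tau> \<and>
      (\<forall>T. T * max \<sigma> 0 \<le> \<omega> \<longrightarrow> quad_accurate \<O> b B M \<sigma> \<phi> \<alpha> T c h\<^sub>0 \<epsilon> K \<tau>)"
    if \<epsilon>: "0 < \<epsilon>" "\<epsilon> \<le> 1 / 2" for \<epsilon>
  proof -
    define L where "L = ln (1 / \<epsilon>)"
    have eL: "exp (- L) = \<epsilon>" unfolding L_def using \<epsilon> by (simp add: ln_div)
    have L: "1 / 2 \<le> L"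
    proof -
      have "ln 2 \<le> L" unfolding L_def using \<epsilon> by (intro ln_mono) (auto simp: field_simps)
      moreover have "1 / 2 \<le> ln (2 :: real)" by (rule order_trans[OF _ ln2_ge_two_thirds]) simp
      ultimately show ?thesis by linarith
    qed
    \<comment> \<open>Solves \<open>exp (- (2 * pi * d / \<tau>)) = exp (- (q * L))\<close>.\<close>
    define \<tau> where "\<tau> = 2 * pi * d / (q * L)"
    have qL: "1 / 2 \<le> q * L" using mult_mono[OF q1 L] q1 by simp
    have \<tau>: "0 < \<tau>" unfolding \<tau>_def using d qL by simp
    have \<tau>_le: "\<tau> \<le> 4 * pi * d"
    proof -
      have "\<tau> \<le> 2 * pi * d / (1 / 2)" unfolding \<tau>_def using d qL by (intro divide_left_mono) auto
      thus ?thesis by simp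
    qed
    define K where "K = nat \<lceil>\<Theta>\<^sub>0 / \<tau>\<rceil>"
    have pos: "0 < \<Theta>\<^sub>0 / \<tau>" using \<Theta>\<^sub>0 \<tau> by simp
    have K: "\<Theta>\<^sub>0 / \<tau> \<le> real K" "real K \<le> \<Theta>\<^sub>0 / \<tau> + 1" "1 \<le> K"
      unfolding K_def using pos by linarith+
    define \<Theta> where "\<Theta> = (real K + 1 / 2) * \<tau>"
    have \<Theta>_ge: "\<Theta>\<^sub>0 \<le> \<Theta>"
    proof -
      have "\<Theta>\<^sub>0 = \<Theta>\<^sub>0 / \<tau> * \<tau>" using \<tau> by simp
      also have "\<dots> \<le> \<Theta>" unfolding \<Theta>_def using K(1) \<tau> by (intro mult_right_mono) auto
      finally show ?thesis .
    qed
    have \<Theta>_le: "\<Theta> \<le> \<Theta>\<^sub>m"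
    proof -
      have "\<Theta> \<le> (\<Theta>\<^sub>0 / \<tau> + 1 + 1 / 2) * \<tau>" unfolding \<Theta>_def using K(2) \<tau> by (intro mult_right_mono) auto
      also have "\<dots> = \<Theta>\<^sub>0 + 3 / 2 * \<tau>" using \<tau> by (simp add: field_simps)
      also have "\<dots> \<le> \<Theta>\<^sub>m" unfolding \<Theta>\<^sub>m_def using \<tau>_le by simp
      finally show ?thesis .
    qed
    have Kk: "real K \<le> \<kappa> * L"
    proof -
      have "\<Theta>\<^sub>0 / \<tau> = \<Theta>\<^sub>0 * q / (2 * pi * d) * L" unfolding \<tau>_def using d qL by simp
      thus ?thesis using K(2) L unfolding \<kappa>_def by (simp add: distrib_right)
    qed
    define \<eta> where "\<eta> = exp (- (2 * pi * d / \<tau>))"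
    have \<eta>_eq: "\<eta> = exp (- (q * L))" unfolding \<eta>_def \<tau>_def using d qL by simp
    have \<eta>_half: "\<eta> \<le> 1 / 2"
    proof -
      have "1 * L \<le> q * L" using q1 L by (intro mult_right_mono) auto
      hence "\<eta> \<le> exp (- L)" unfolding \<eta>_eq by simp
      thus ?thesis using eL \<epsilon> by simp
    qed
    have "quad_accurate \<O> b B M \<sigma> \<phi> \<alpha> T c h\<^sub>0 \<epsilon> K \<tau>" if T: "T * max \<sigma> 0 \<le> \<omega>" for T
      unfolding quad_accurate_def
    proof (intro allI impI)
      fix h :: real and l :: nat
      assume hl: "0 < h \<and> h \<le> h\<^sub>0 \<and> 1 \<le> l"
      hence h: "0 < h" "h \<le> h\<^sub>0" by auto
      have Bl: "0 < real B ^ l" using B by simp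
      \<comment> \<open>Depends on the interval and on \<open>h\<close>, but on neither
        \<open>n\<close> nor \<open>A\<close>.\<close>
      define \<mu> where "\<mu> = L / (real B ^ l * h)"
      have \<mu>: "0 < \<mu>" unfolding \<mu>_def using L Bl h by (intro divide_pos_pos mult_pos_pos) auto
      have h\<mu>: "h * \<mu> = L / real B ^ l" unfolding \<mu>_def using h by simp
      show "\<exists>\<mu>>0. \<forall>N \<nu> A n. 0 < N \<and> is_vec_norm N \<nu> \<and> A \<in> carrier_mat N N \<and> sectorial N \<nu> M \<sigma> \<phi> A \<and>
          real n * h \<in> {real B ^ (l - 1) * h..<real B ^ l * h} \<and> real n * h \<le> T \<and> c * ln (1 / \<epsilon>) \<le> real n \<longrightarrow>
          tuple_norm (dim_row \<O>) N \<nu> (quad_error \<O> b \<alpha> \<sigma> \<mu> \<tau> K h n A) \<le> \<epsilon>"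
      proof (intro exI[of _ \<mu>] conjI \<mu> allI impI)
        fix N \<nu> A n
        assume as: "0 < N \<and> is_vec_norm N \<nu> \<and> A \<in> carrier_mat N N \<and> sectorial N \<nu> M \<sigma> \<phi> A \<and>
          real n * h \<in> {real B ^ (l - 1) * h..<real B ^ l * h} \<and> real n * h \<le> T \<and> c * ln (1 / \<epsilon>) \<le> real n"
        hence N: "0 < N" and \<nu>: "is_vec_norm N \<nu>" and A: "A \<in> carrier_mat N N" and sec: "sectorial N \<nu> M \<sigma> \<phi> A"
          and nT: "real n * h \<le> T" and cn: "c * L \<le> real n" unfolding L_def by auto
        \<comment> \<open>The step size cancels, so the time interval is a condition on
          \<open>n\<close> alone.\<close>
        have nB: "real B ^ (l - 1) \<le> real n" "real n < real B ^ l" using as h by auto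
        have "h * \<mu> \<le> \<delta>\<^sub>1 / 4"
        proof -
          have cL: "0 < c * L" using c L by (intro mult_pos_pos) auto
          have "c * L \<le> real B ^ l" using cn nB(2) by linarith
          hence "L / real B ^ l \<le> L / (c * L)"
            using L by (intro divide_left_mono mult_pos_pos[OF Bl cL]) auto
          also have "\<dots> = 1 / c" using L by simp
          also have "\<dots> \<le> \<delta>\<^sub>1 / 4" using c(2,3) \<delta>\<^sub>1 by (simp add: field_simps)
          finally show ?thesis unfolding h\<mu> .
        qed
        moreover have "h * max \<sigma> 0 \<le> \<delta>\<^sub>1 / 4"
        proof -
          have "h * max \<sigma> 0 \<le> h\<^sub>0 * (\<bar>\<sigma>\<bar> + 1)" using h h\<^sub>0 by (intro mult_mono) auto
          also have "\<dots> = \<delta>\<^sub>1 / 4"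
          proof -
            have "\<delta>\<^sub>1 / (4 * v) * v = \<delta>\<^sub>1 / 4" if "v \<noteq> 0" for v using that by simp
            moreover have "\<bar>\<sigma>\<bar> + 1 \<noteq> 0" by linarith
            ultimately show ?thesis unfolding h\<^sub>0_def .
          qed
          finally show ?thesis .
        qed
        ultimately have \<delta>: "h * \<mu> + h * max \<sigma> 0 \<le> \<delta>\<^sub>1 / 2" by linarith
        have n\<delta>: "real n * (h * \<mu> + h * max \<sigma> 0) \<le> L + \<omega>"
        proof -
          have "real n * (h * \<mu>) \<le> real B ^ l * (h * \<mu>)" using nB(2) h \<mu> by (intro mult_right_mono) auto
          also have "\<dots> = L" unfolding h\<mu> using Bl by simp
          finally have 1: "real n * (h * \<mu>) \<le> L" .
          have "real n * h * max \<sigma> 0 \<le> T * max \<sigma> 0" by (rule mult_right_mono[OF nT]) simp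
          thus ?thesis using 1 T by (simp add: distrib_left mult.assoc)
        qed
        define Gr where "Gr = exp (C\<^sub>2 * L + C\<^sub>2 * \<omega>)"
        have Gr: "(1 + C\<^sub>2 * (h * \<mu> + h * max \<sigma> 0)) ^ n \<le> Gr"
        proof -
          let ?\<delta> = "h * \<mu> + h * max \<sigma> 0"
          have "0 \<le> C\<^sub>2 * ?\<delta>" using C\<^sub>2 h \<mu> by (intro mult_nonneg_nonneg add_nonneg_nonneg) auto
          hence "(1 + C\<^sub>2 * ?\<delta>) ^ n \<le> exp (C\<^sub>2 * ?\<delta>) ^ n"
            using exp_ge_add_one_self[of "C\<^sub>2 * ?\<delta>"] by (intro power_mono) auto
          also have "\<dots> = exp (C\<^sub>2 * (real n * ?\<delta>))" by (simp add: exp_of_nat_mult[symmetric] mult_ac)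
          also have "\<dots> \<le> Gr" unfolding Gr_def using mult_left_mono[OF n\<delta> C\<^sub>2] by (simp add: distrib_left)
          finally show ?thesis .
        qed
        have tail: "exp (p * L + \<bar>x\<bar>) \<le> (1 + c\<^sub>2 * s0 * (h * \<mu> * cosh x)) ^ n" if x: "\<Theta> \<le> \<bar>x\<bar>" for x
        proof (rule decay_bound[OF \<Theta>\<^sub>0(2) L c(3) c\<^sub>4 \<Theta>\<^sub>0(1) cn])
          show "0 \<le> c\<^sub>2 * s0 * (h * \<mu> * cosh x)" using c\<^sub>2 s0 h \<mu> by simp
          show "\<Theta>\<^sub>0 \<le> \<bar>x\<bar>" using x \<Theta>_ge by simp
          have Bs: "real B ^ l = real B * real B ^ (l - 1)" using hl by (cases l) auto
          have "L / real B = real B ^ (l - 1) * (h * \<mu>)" unfolding h\<mu> Bs using B by simp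
          also have "\<dots> \<le> real n * (h * \<mu>)" using nB(1) h \<mu> by (intro mult_right_mono) auto
          finally have "L / real B \<le> real n * (h * \<mu>)" .
          hence "c\<^sub>2 * s0 * cosh x * (L / real B) \<le> c\<^sub>2 * s0 * cosh x * (real n * (h * \<mu>))"
            using c\<^sub>2 s0 by (intro mult_left_mono) auto
          thus "c\<^sub>4 * L * cosh x \<le> real n * (c\<^sub>2 * s0 * (h * \<mu> * cosh x))"
            unfolding c\<^sub>4_def by (simp add: mult_ac)
        qed
        have bound: "op_norm N \<nu> (quad_error \<O> b \<alpha> \<sigma> \<mu> \<tau> K h n A j) \<le> \<epsilon>" if j: "j < m" for j
        proof -
          have "op_norm N \<nu> (quad_error \<O> b \<alpha> \<sigma> \<mu> \<tau> K h n A j)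
              \<le> M * C\<^sub>3 / (2 * pi * (1 - sin (\<alpha> + d))) * Gr * (8 * \<Theta> * \<eta> + (4 * d + 2) * exp (- (p * L)))"
            by (rule quad_error_bound[OF D \<delta>\<^sub>1 nz rP qQ rhol C\<^sub>2 c\<^sub>2 stab[unfolded s0_def] C\<^sub>3 qb C rdec qdec N \<nu> A sec M \<phi>
                  d h(1) \<mu> \<delta> \<tau> \<Theta>_def \<eta>_def \<eta>_half Gr tail[unfolded s0_def] j])
          also have "\<dots> = G0 * exp (C\<^sub>2 * L) * (8 * \<Theta> * \<eta> + (4 * d + 2) * exp (- (p * L)))"
            unfolding G0_def Gr_def by (simp add: exp_add)
          also have "\<dots> \<le> G0 * exp (C\<^sub>2 * L) * (8 * \<Theta>\<^sub>m * \<eta> + (4 * d + 2) * exp (- (p * L)))"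
            using \<Theta>_le G0 unfolding \<eta>_def by (intro mult_left_mono add_right_mono mult_right_mono) auto
          also have "\<dots> = 8 * \<Theta>\<^sub>m * (G0 * exp (C\<^sub>2 * L) * exp (- (q * L)))
              + (4 * d + 2) * (G0 * exp (C\<^sub>2 * L) * exp (- (p * L)))"
            unfolding \<eta>_eq by (simp add: algebra_simps)
          also have "\<dots> \<le> exp (- L) / 2 + exp (- L) / 2"
            using small[OF L pY] small[OF L pd] unfolding q_def Y_def p_def Z_def by (rule add_mono)
          finally show ?thesis using eL by simp
        qed
        have "dim_row \<O> = m" using \<O> by simp
        moreover have "Max ((\<lambda>j. op_norm N \<nu> (quad_error \<O> b \<alpha> \<sigma> \<mu> \<tau> K h n A j)) ` {..<m}) \<le> \<epsilon>"
          using m_pos bound by (subst Max_le_iff) auto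
        ultimately show "tuple_norm (dim_row \<O>) N \<nu> (quad_error \<O> b \<alpha> \<sigma> \<mu> \<tau> K h n A) \<le> \<epsilon>"
          unfolding tuple_norm_def by simp
      qed
    qed
    thus ?thesis using K(3) Kk \<tau> unfolding L_def by (intro exI[of _ K] exI[of _ \<tau>]) auto
  qed
  show ?thesis by (rule that[OF c(3) h\<^sub>0 \<kappa> main])
qed

end

theorem theorem1:
  fixes m B :: nat and \<O> :: "real mat" and b :: "real vec" and M \<sigma> \<phi> \<alpha> :: real
  assumes "\<O> \<in> carrier_mat m m" and "b \<in> carrier_vec m"
    and "\<And>z. eigenvalue (map_mat complex_of_real \<O>) z \<Longrightarrow> 0 < Re z"
    and "L_stable (rk_r \<O> b)"
    and "(rk_r \<O> b has_field_derivative 1) (at 0)"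
    and "1 < B" and "0 < M" and "0 < \<phi>" and "\<phi> < pi / 2"
    and "0 < \<alpha>" and "\<alpha> < pi / 2 - \<phi>"
  shows "(\<forall>T>0. \<exists>c>0. \<exists>h\<^sub>0>0. \<exists>\<kappa>>0. \<forall>\<epsilon>. 0 < \<epsilon> \<and> \<epsilon> \<le> 1 / 2 \<longrightarrow>
            (\<exists>K::nat. 1 \<le> K \<and> real K \<le> \<kappa> * ln (1 / \<epsilon>) \<and>
              (\<exists>\<tau>>0. quad_accurate \<O> b B M \<sigma> \<phi> \<alpha> T c h\<^sub>0 \<epsilon> K \<tau>)))
       \<and> (\<sigma> \<le> 0 \<longrightarrow>
            (\<exists>c>0. \<exists>h\<^sub>0>0. \<exists>\<kappa>>0. \<forall>\<epsilon>. 0 < \<epsilon> \<and> \<epsilon> \<le> 1 / 2 \<longrightarrow>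
              (\<exists>K::nat. 1 \<le> K \<and> real K \<le> \<kappa> * ln (1 / \<epsilon>) \<and>
                (\<forall>T>0. \<exists>\<tau>>0. quad_accurate \<O> b B M \<sigma> \<phi> \<alpha> T c h\<^sub>0 \<epsilon> K \<tau>))))"
proof -
  interpret runge_kutta m \<O> b by unfold_locales (use assms in auto)
  note uniform = quad_uniform[OF assms(6-11), of _ \<sigma>]
  show ?thesis
  proof (intro conjI allI impI)
    fix T :: real assume T: "0 < T"
    have \<omega>: "0 \<le> T * max \<sigma> 0" using T by simp
    obtain c h\<^sub>0 \<kappa> where pos: "0 < c" "0 < h\<^sub>0" "0 < \<kappa>"
      and U: "\<And>\<epsilon>. 0 < \<epsilon> \<Longrightarrow> \<epsilon> \<le> 1 / 2 \<Longrightarrow> \<exists>(K::nat) \<tau>. 1 \<le> K \<and> real K \<le> \<kappa> * ln (1 / \<epsilon>) \<and> 0 < \<tau> \<and>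
        (\<forall>T'. T' * max \<sigma> 0 \<le> T * max \<sigma> 0 \<longrightarrow> quad_accurate \<O> b B M \<sigma> \<phi> \<alpha> T' c h\<^sub>0 \<epsilon> K \<tau>)"
      by (rule uniform[OF \<omega>, OF that])
    show "\<exists>c>0. \<exists>h\<^sub>0>0. \<exists>\<kappa>>0. \<forall>\<epsilon>. 0 < \<epsilon> \<and> \<epsilon> \<le> 1 / 2 \<longrightarrow>
            (\<exists>K::nat. 1 \<le> K \<and> real K \<le> \<kappa> * ln (1 / \<epsilon>) \<and>
              (\<exists>\<tau>>0. quad_accurate \<O> b B M \<sigma> \<phi> \<alpha> T c h\<^sub>0 \<epsilon> K \<tau>))"
    proof (rule exI[of _ c], rule conjI[OF pos(1)], rule exI[of _ h\<^sub>0], rule conjI[OF pos(2)],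
        rule exI[of _ \<kappa>], rule conjI[OF pos(3)], intro allI impI)
      fix \<epsilon> :: real assume "0 < \<epsilon> \<and> \<epsilon> \<le> 1 / 2"
      hence \<epsilon>: "0 < \<epsilon>" "\<epsilon> \<le> 1 / 2" by simp_all
      from U[OF \<epsilon>] obtain K :: nat and \<tau> where K: "1 \<le> K" "real K \<le> \<kappa> * ln (1 / \<epsilon>)" "0 < \<tau>"
        "\<forall>T'. T' * max \<sigma> 0 \<le> T * max \<sigma> 0 \<longrightarrow> quad_accurate \<O> b B M \<sigma> \<phi> \<alpha> T' c h\<^sub>0 \<epsilon> K \<tau>" by (elim exE conjE)
      have "quad_accurate \<O> b B M \<sigma> \<phi> \<alpha> T c h\<^sub>0 \<epsilon> K \<tau>" using K(4) by simp
      with K(1-3) show "\<exists>K::nat. 1 \<le> K \<and> real K \<le> \<kappa> * ln (1 / \<epsilon>) \<and>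
          (\<exists>\<tau>>0. quad_accurate \<O> b B M \<sigma> \<phi> \<alpha> T c h\<^sub>0 \<epsilon> K \<tau>)"
        by (intro exI[of _ K] conjI exI[of _ \<tau>])
    qed
  next
    assume \<sigma>: "\<sigma> \<le> 0"
    \<comment> \<open>With \<open>\<omega> = 0\<close> the condition on \<open>T\<close> holds for
      every \<open>T\<close>, and even \<open>\<tau>\<close> comes out independent of it.\<close>
    obtain c h\<^sub>0 \<kappa> where pos: "0 < c" "0 < h\<^sub>0" "0 < \<kappa>"
      and U: "\<And>\<epsilon>. 0 < \<epsilon> \<Longrightarrow> \<epsilon> \<le> 1 / 2 \<Longrightarrow> \<exists>(K::nat) \<tau>. 1 \<le> K \<and> real K \<le> \<kappa> * ln (1 / \<epsilon>) \<and> 0 < \<tau> \<and>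
        (\<forall>T. T * max \<sigma> 0 \<le> 0 \<longrightarrow> quad_accurate \<O> b B M \<sigma> \<phi> \<alpha> T c h\<^sub>0 \<epsilon> K \<tau>)"
      by (rule uniform[OF order_refl, OF that])
    show "\<exists>c>0. \<exists>h\<^sub>0>0. \<exists>\<kappa>>0. \<forall>\<epsilon>. 0 < \<epsilon> \<and> \<epsilon> \<le> 1 / 2 \<longrightarrow>
            (\<exists>K::nat. 1 \<le> K \<and> real K \<le> \<kappa> * ln (1 / \<epsilon>) \<and>
              (\<forall>T>0. \<exists>\<tau>>0. quad_accurate \<O> b B M \<sigma> \<phi> \<alpha> T c h\<^sub>0 \<epsilon> K \<tau>))"
    proof (rule exI[of _ c], rule conjI[OF pos(1)], rule exI[of _ h\<^sub>0], rule conjI[OF pos(2)],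
        rule exI[of _ \<kappa>], rule conjI[OF pos(3)], intro allI impI)
      fix \<epsilon> :: real assume "0 < \<epsilon> \<and> \<epsilon> \<le> 1 / 2"
      hence \<epsilon>: "0 < \<epsilon>" "\<epsilon> \<le> 1 / 2" by simp_all
      from U[OF \<epsilon>] obtain K :: nat and \<tau> where K: "1 \<le> K" "real K \<le> \<kappa> * ln (1 / \<epsilon>)" "0 < \<tau>"
        "\<forall>T. T * max \<sigma> 0 \<le> 0 \<longrightarrow> quad_accurate \<O> b B M \<sigma> \<phi> \<alpha> T c h\<^sub>0 \<epsilon> K \<tau>" by (elim exE conjE)
      have "quad_accurate \<O> b B M \<sigma> \<phi> \<alpha> T c h\<^sub>0 \<epsilon> K \<tau>" for T using K(4) \<sigma> by simp
      with K(1-3) show "\<exists>K::nat. 1 \<le> K \<and> real K \<le> \<kappa> * ln (1 / \<epsilon>) \<and>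
          (\<forall>T>0. \<exists>\<tau>>0. quad_accurate \<O> b B M \<sigma> \<phi> \<alpha> T c h\<^sub>0 \<epsilon> K \<tau>)"
        by (intro exI[of _ K] conjI allI impI exI[of _ \<tau>]) auto
    qed
  qed
qed

end
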